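(* For each integer $n \geq 2$, the hypersurface $$X_n := \{(a,b,x,y,z) \in \mathbf{C}^5;\ a^2x + 2aby + b^2z + (xz-y^2)^n = 0\}$$ admits a unique holomorphic symplectic 2-form of weight $2$ up to constant. That is, there is a holomorphic symplectic 2-form of weight $2$ on $(X_n)_{reg}$, and any two such forms $\omega, \omega'$ satisfy $\omega' = \lambda \omega$ for some $\lambda \in \mathbf{C}^*$.
   Context: $X_n$ carries the $\mathbf{C}^*$-action for which the coordinates have weights $wt(a) = wt(b) = 2n-1$ and $wt(x) = wt(y) = wt(z) = 2$ (the defining equation is homogeneous of degree $4n$). $(X_n)_{reg}$ is the smooth locus. A symplectic 2-form is a $d$-closed 2-form on $(X_n)_{reg}$ that is non-degenerate at every point; it has weight $l$ if $\phi_t^*\omega = t^l \omega$ for all $t \in \mathbf{C}^*$, where $\{\phi_t\}$ is the action. *)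

theory Defs
  imports "HOL-Analysis.Analysis"
begin

section \<open>Holomorphic 2-forms in several complex variables\<close>

text \<open>A function of several complex variables is holomorphic on an open set if it is
  complex differentiable at each of its points: the real Frechet derivative exists and is
  linear over the complex numbers.\<close>

definition holomorphic_fun_on :: "(complex^'d \<Rightarrow> complex) \<Rightarrow> (complex^'d) set \<Rightarrow> bool" where
  "holomorphic_fun_on f U \<longleftrightarrow>
     open U \<and>
     (\<forall>z\<in>U. \<exists>f'. (f has_derivative f') (at z) \<and> (\<forall>c v. f' (c *s v) = c * f' v))"

definition holomorphic_map_on ::
    "(complex^'d \<Rightarrow> complex^'m) \<Rightarrow> (complex^'d) set \<Rightarrow> bool" where
  "holomorphic_map_on f U \<longleftrightarrow> (\<forall>i. holomorphic_fun_on (\<lambda>z. f z $ i) U)"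

text \<open>Holomorphic charts of a complex submanifold \<open>M\<close> are represented by their inverses,
  the local parametrizations.\<close>

definition holomorphic_parametrization ::
    "(complex^'m) set \<Rightarrow> (complex^'d) set \<Rightarrow> (complex^'d \<Rightarrow> complex^'m) \<Rightarrow> bool" where
  "holomorphic_parametrization M U \<phi> \<longleftrightarrow>
     holomorphic_map_on \<phi> U \<and>
     openin (top_of_set M) (\<phi> ` U) \<and>
     (\<exists>\<psi>. homeomorphism U (\<phi> ` U) \<phi> \<psi>) \<and>
     (\<forall>z\<in>U. inj (frechet_derivative \<phi> (at z)))"

text \<open>A 2-form on \<open>M\<close> assigns to \<open>p\<close> in \<open>M\<close> and tangent vectors \<open>u\<close>, \<open>v\<close> at \<open>p\<close> the value
  \<open>\<omega> p u v\<close>. Values at other arguments are irrelevant: all notions below, including equality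
  of forms up to a constant, only look at tangent vectors at points of \<open>M\<close>.\<close>

type_synonym 'm form2 = "complex^'m \<Rightarrow> complex^'m \<Rightarrow> complex^'m \<Rightarrow> complex"

definition pullback :: "(complex^'d \<Rightarrow> complex^'m) \<Rightarrow> 'm form2 \<Rightarrow> 'd form2" where
  "pullback \<phi> \<omega> =
     (\<lambda>z u v. \<omega> (\<phi> z) (frechet_derivative \<phi> (at z) u) (frechet_derivative \<phi> (at z) v))"

definition alternating_bilinear_on ::
    "(complex^'m) set \<Rightarrow> (complex^'m \<Rightarrow> complex^'m \<Rightarrow> complex) \<Rightarrow> bool" where
  "alternating_bilinear_on T B \<longleftrightarrow>
     (\<forall>u\<in>T. \<forall>v\<in>T. \<forall>w\<in>T. \<forall>c.
        B (u + v) w = B u w + B v w \<and> B w (u + v) = B w u + B w v \<and>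
        B (c *s u) v = c * B u v \<and> B u (c *s v) = c * B u v \<and>
        B u u = 0)"

definition nondegenerate_on ::
    "(complex^'m) set \<Rightarrow> (complex^'m \<Rightarrow> complex^'m \<Rightarrow> complex) \<Rightarrow> bool" where
  "nondegenerate_on T B \<longleftrightarrow> (\<forall>u\<in>T. (\<forall>v\<in>T. B u v = 0) \<longrightarrow> u = 0)"

definition form_coeff :: "'d::finite form2 \<Rightarrow> 'd \<Rightarrow> 'd \<Rightarrow> complex^'d \<Rightarrow> complex" where
  "form_coeff \<eta> i j = (\<lambda>z. \<eta> z (axis i 1) (axis j 1))"

definition partial_deriv :: "'d::finite \<Rightarrow> (complex^'d \<Rightarrow> complex) \<Rightarrow> complex^'d \<Rightarrow> complex" where
  "partial_deriv i f z = frechet_derivative f (at z) (axis i 1)"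

definition holomorphic_form_on :: "'d::finite form2 \<Rightarrow> (complex^'d) set \<Rightarrow> bool" where
  "holomorphic_form_on \<eta> U \<longleftrightarrow> (\<forall>i j. holomorphic_fun_on (form_coeff \<eta> i j) U)"

definition closed_form_on :: "'d::finite form2 \<Rightarrow> (complex^'d) set \<Rightarrow> bool" where
  "closed_form_on \<eta> U \<longleftrightarrow>
     (\<forall>z\<in>U. \<forall>i j k.
        partial_deriv i (form_coeff \<eta> j k) z
        + partial_deriv j (form_coeff \<eta> k i) z
        + partial_deriv k (form_coeff \<eta> i j) z = 0)"


section \<open>The hypersurfaces\<close>

text \<open>The coordinates \<open>(a, b, x, y, z)\<close> are the components 1 to 5 (the index 5 of the
  five-element index type is also written 0).\<close>

definition X_eq :: "nat \<Rightarrow> complex^5 \<Rightarrow> complex" where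
  "X_eq n p = (let a = p $ 1; b = p $ 2; x = p $ 3; y = p $ 4; z = p $ 5
     in a^2 * x + 2 * a * b * y + b^2 * z + (x * z - y^2)^n)"

definition X :: "nat \<Rightarrow> (complex^5) set" where
  "X n = {p. X_eq n p = 0}"

text \<open>The equation is reduced, so the smooth locus is given by the Jacobian criterion; there
  \<open>X n\<close> is a submanifold of dimension 4 whose tangent space is the kernel of the differential.\<close>

definition X_reg :: "nat \<Rightarrow> (complex^5) set" where
  "X_reg n = {p \<in> X n. \<exists>v. frechet_derivative (X_eq n) (at p) v \<noteq> 0}"

definition X_tangent :: "nat \<Rightarrow> complex^5 \<Rightarrow> (complex^5) set" where
  "X_tangent n p = {v. frechet_derivative (X_eq n) (at p) v = 0}"

definition X_weight :: "nat \<Rightarrow> 5 \<Rightarrow> nat" where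
  "X_weight n i = (if i = 1 \<or> i = 2 then 2 * n - 1 else 2)"

definition X_action :: "nat \<Rightarrow> complex \<Rightarrow> complex^5 \<Rightarrow> complex^5" where
  "X_action n t p = (\<chi> i. t ^ X_weight n i * p $ i)"

definition holomorphic_2form :: "nat \<Rightarrow> 5 form2 \<Rightarrow> bool" where
  "holomorphic_2form n \<omega> \<longleftrightarrow>
     (\<forall>p\<in>X_reg n. alternating_bilinear_on (X_tangent n p) (\<omega> p)) \<and>
     (\<forall>(U :: (complex^4) set) \<phi>. holomorphic_parametrization (X_reg n) U \<phi> \<longrightarrow>
        holomorphic_form_on (pullback \<phi> \<omega>) U)"

definition d_closed :: "nat \<Rightarrow> 5 form2 \<Rightarrow> bool" where
  "d_closed n \<omega> \<longleftrightarrow>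
     (\<forall>(U :: (complex^4) set) \<phi>. holomorphic_parametrization (X_reg n) U \<phi> \<longrightarrow>
        closed_form_on (pullback \<phi> \<omega>) U)"

definition holomorphic_symplectic :: "nat \<Rightarrow> 5 form2 \<Rightarrow> bool" where
  "holomorphic_symplectic n \<omega> \<longleftrightarrow>
     holomorphic_2form n \<omega> \<and> d_closed n \<omega> \<and>
     (\<forall>p\<in>X_reg n. nondegenerate_on (X_tangent n p) (\<omega> p))"

definition has_weight :: "nat \<Rightarrow> 5 form2 \<Rightarrow> int \<Rightarrow> bool" where
  "has_weight n \<omega> l \<longleftrightarrow>
     (\<forall>t. t \<noteq> 0 \<longrightarrow> (\<forall>p\<in>X_reg n. \<forall>u\<in>X_tangent n p. \<forall>v\<in>X_tangent n p.
        pullback (X_action n t) \<omega> p u v = t powi l * \<omega> p u v))"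

end

theory Submission
  imports Defs "HOL-Complex_Analysis.Complex_Analysis"
begin

text \<open>Wedging a 2-form on \<open>X_reg\<close> with \<open>dX\<close> gives a 3-form on the ambient space, that is, a bivector
  tangent to \<open>X\<close>. For a form of weight 2 its components are weighted homogeneous holomorphic functions,
  of weights 2, 2n - 1 and 4n - 4. The slice \<open>x = 1\<close> is a line times the surface singularity
  \<open>D\<^sub>n\<^sub>+\<^sub>1\<close>, which is uniformized by the plane; the maximum principle bounds a weighted function near
  the singular locus, homogeneity turns this into polynomial growth on the uniformization, and Liouville's
  theorem together with the binary dihedral symmetry shows that functions of weight 2 and 2n - 1 are
  linear in \<open>x, y, z\<close> and in \<open>a, b\<close>. Tangency then leaves exactly one bivector up to scale: the Poisson
  structure of sl2 with its modules \<open>(x, y, z)\<close> and \<open>(a, b)\<close>, extended by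
  \<open>{a, b} = - n/2 (xz - y\<^sup>2)\<^sup>n\<^sup>-\<^sup>1\<close>, for which the defining equation is a Casimir function. The form dual to it
  is symplectic of weight 2.\<close>

text \<open>A form on \<open>X_reg\<close> has no canonical components in the five ambient
  coordinates; wedging with \<open>dX\<close> supplies ten global ones. As \<open>dX\<close> has
  weight 4n, the component with indices k, l, m has weight 4n + 2 minus the weights of these
  coordinates. Growth classifies nine of the ten; the one of weight 4n - 4 is the bracket of a and
  b, and tangency expresses it through the others. The obstacle is that the components are known
  only off a = b = 0, while the growth argument needs bounds up to this locus. On the uniformization
  it is just u = w = 0, and a disc in u alone or w alone can avoid it. A second obstacle is that the
  slice x = 1 misses x = 0, which points with large y approach after rescaling; there the symmetry
  exchanging a with b and x with z takes over. Closedness is computed only where the first gradient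
  component \<open>2 * crit p\<close> is nonzero. There the form is a quotient without powers of xz
  - y^2, and the rest follows by density.\<close>

no_notation fps_nth (infixl "$" 75)

abbreviation disc :: "complex^5 \<Rightarrow> complex" where
  "disc p \<equiv> p $ 3 * p $ 5 - (p $ 4)^2"

abbreviation crit :: "complex^5 \<Rightarrow> complex" where
  "crit p \<equiv> p $ 1 * p $ 3 + p $ 2 * p $ 4"

abbreviation poly3 :: "nat \<Rightarrow> (nat \<Rightarrow> nat \<Rightarrow> nat \<Rightarrow> complex) \<Rightarrow> complex \<Rightarrow> complex \<Rightarrow> complex \<Rightarrow> complex" where
  "poly3 d c y u w \<equiv> \<Sum>k\<le>d. \<Sum>i\<le>d. \<Sum>j\<le>d. c k i j * y ^ k * u ^ i * w ^ j"

abbreviation circ :: "real \<Rightarrow> real \<Rightarrow> complex" where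
  "circ r t \<equiv> r * exp (2 * pi * \<i> * of_real t)"

section \<open>Several complex variables\<close>

lemma vec_eq_sum_axis: "v = (\<Sum>i\<in>UNIV. axis i (v $ i))" for v :: "'a::comm_monoid_add ^ 'd"
  by (simp add: vec_eq_iff sum_component axis_def)

lemma axis_scale: "axis i (c * d) = c *s axis i d" for c :: "'a::ring_1"
  by (simp add: vec_eq_iff axis_def)

lemma bounded_linear_axis [bounded_linear]: "bounded_linear (axis i :: 'a::real_normed_vector \<Rightarrow> 'a ^ 'd)"
  by (intro bounded_linear_intro[where K=1])
     (auto simp: vec_eq_iff axis_def norm_vec_def L2_set_def if_distrib[of norm] if_distrib[of "\<lambda>x. x^2"] cong: if_cong)

lemma norm_axis_eq: "norm (axis i x :: 'a::real_normed_vector ^ 'd) = norm x"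
  by (simp add: axis_def norm_vec_def L2_set_def if_distrib[of norm] if_distrib[of "\<lambda>x. x^2"] cong: if_cong)

lemma holomorphic_fun_on_has_derivative:
  assumes "holomorphic_fun_on f U" "z \<in> U"
  shows "(f has_derivative (\<lambda>v. \<Sum>i\<in>UNIV. v $ i * partial_deriv i f z)) (at z)"
proof -
  obtain f' where f': "(f has_derivative f') (at z)" and lin: "\<And>c v. f' (c *s v) = c * f' v"
    using assms unfolding holomorphic_fun_on_def by blast
  have fr: "frechet_derivative f (at z) = f'"
    using frechet_derivative_at[OF f'] by simp
  have "f' v = (\<Sum>i\<in>UNIV. v $ i * partial_deriv i f z)" for v
  proof -
    have "f' v = f' (\<Sum>i\<in>UNIV. (v $ i) *s axis i 1)"
      by (subst vec_eq_sum_axis[of v]) (simp add: axis_scale[symmetric])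
    also have "\<dots> = (\<Sum>i\<in>UNIV. f' ((v $ i) *s axis i 1))"
      using linear_sum[OF has_derivative_linear[OF f']] by blast
    finally show ?thesis by (simp add: lin partial_deriv_def fr)
  qed
  then show ?thesis using f' by (metis (no_types, lifting) ext)
qed

lemma holomorphic_fun_on_open: "holomorphic_fun_on f U \<Longrightarrow> open U"
  by (simp add: holomorphic_fun_on_def)

lemma partial_deriv_eq:
  assumes "(f has_derivative (\<lambda>v. \<Sum>i\<in>UNIV. v $ i * g i)) (at z)"
  shows "partial_deriv i f z = g i"
proof -
  have "frechet_derivative f (at z) = (\<lambda>v. \<Sum>i\<in>UNIV. v $ i * g i)"
    using frechet_derivative_at[OF assms] by simp
  then show ?thesis
    by (simp add: partial_deriv_def axis_def if_distrib[of "\<lambda>x. x * _"] cong: if_cong)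
qed

lemma holomorphic_fun_on_continuous: "holomorphic_fun_on f U \<Longrightarrow> continuous_on U f"
  by (meson continuous_at_imp_continuous_on has_derivative_continuous holomorphic_fun_on_has_derivative)

lemma holomorphic_fun_on_subset: "holomorphic_fun_on f U \<Longrightarrow> open V \<Longrightarrow> V \<subseteq> U \<Longrightarrow> holomorphic_fun_on f V"
  by (auto simp: holomorphic_fun_on_def)

lemma line_has_field_derivative:
  assumes "holomorphic_fun_on f U" "z + axis i \<zeta> \<in> U"
  shows "((\<lambda>\<zeta>. f (z + axis i \<zeta>)) has_field_derivative partial_deriv i f (z + axis i \<zeta>)) (at \<zeta>)"
proof -
  have "((\<lambda>\<zeta>. z + axis i \<zeta>) has_derivative (\<lambda>h. axis i h)) (at \<zeta>)"
    by (auto intro!: derivative_eq_intros bounded_linear.has_derivative[OF bounded_linear_axis])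
  from has_derivative_compose[OF this holomorphic_fun_on_has_derivative[OF assms]]
  have "((\<lambda>\<zeta>. f (z + axis i \<zeta>)) has_derivative (\<lambda>h. \<Sum>j\<in>UNIV. axis i h $ j * partial_deriv j f (z + axis i \<zeta>))) (at \<zeta>)" .
  moreover have "(\<lambda>h. \<Sum>j\<in>UNIV. axis i h $ j * partial_deriv j f (z + axis i \<zeta>)) = (*) (partial_deriv i f (z + axis i \<zeta>))"
    by (auto simp: axis_def if_distrib[of "\<lambda>x. x * _"] mult.commute cong: if_cong)
  ultimately show ?thesis by (simp add: has_field_derivative_def)
qed

text \<open>One radius serves all centres near \<open>z0\<close>, so the Cauchy integrals below
  depend on the centre only through the integrand.\<close>

lemma open_uniform_cball:
  assumes "open U" "z0 \<in> U"
  obtains r where "r > 0" "\<And>z. z \<in> ball z0 r \<Longrightarrow> cball z r \<subseteq> U"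
proof -
  obtain e where e: "e > 0" "ball z0 e \<subseteq> U" using assms openE by blast
  show ?thesis
  proof (rule that[of "e / 3"])
    fix z assume z: "z \<in> ball z0 (e / 3)"
    have "dist z0 x < e" if "x \<in> cball z (e / 3)" for x
      using that z e(1) dist_triangle[of z0 x z] by simp
    then show "cball z (e / 3) \<subseteq> U" using e(2) by auto
  qed (use e in simp)
qed

text \<open>Cauchy's formula for the derivative along one coordinate line; one power of
  \<open>circ r t\<close> cancels against the differential of the circle. With a fixed radius,
  continuity and differentiability of the partial derivative can be proved under the integral,
  starting from mere pointwise differentiability of \<open>f\<close>.\<close>

lemma partial_deriv_integral:
  assumes f: "holomorphic_fun_on f U" and r: "r > 0" and sub: "cball z r \<subseteq> U"
  shows "partial_deriv i f z =
    integral {0..1} (\<lambda>t. f (z + axis i (circ r t)) / (circ r t))"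
proof -
  let ?g = "\<lambda>\<zeta>. f (z + axis i \<zeta>)"
  have inU: "z + axis i \<zeta> \<in> U" if "\<zeta> \<in> cball 0 r" for \<zeta>
    using that sub by (auto simp: dist_norm norm_axis_eq intro!: subsetD[OF sub])
  have der: "(?g has_field_derivative partial_deriv i f (z + axis i \<zeta>)) (at \<zeta>)" if "\<zeta> \<in> cball 0 r" for \<zeta>
    by (rule line_has_field_derivative[OF f inU[OF that]])
  have hol: "?g holomorphic_on cball 0 r"
    unfolding holomorphic_on_def field_differentiable_def
    by (intro ballI exI, rule has_field_derivative_at_within, rule der)
  have hol': "?g holomorphic_on ball 0 r"
    by (rule holomorphic_on_subset[OF hol ball_subset_cball])
  have "deriv ?g 0 = 1 / (2 * pi * \<i>) * contour_integral (circlepath 0 r) (\<lambda>u. ?g u / (u - 0)^2)"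
    using Cauchy_derivative_integral_circlepath(2)[OF holomorphic_on_imp_continuous_on[OF hol] hol', of 0] r
    by (intro DERIV_imp_deriv) simp
  moreover have "deriv ?g 0 = partial_deriv i f z"
    using DERIV_imp_deriv[OF der[of 0]] r by (simp add: axis_def zero_vec_def[symmetric] cong: if_cong)
  moreover have "contour_integral (circlepath 0 r) (\<lambda>u. ?g u / (u - 0)^2) =
      2 * pi * \<i> * integral {0..1} (\<lambda>t. ?g (circ r t) / (circ r t))"
    unfolding contour_integral_integral integral_mult_right[symmetric]
    using r by (intro integral_cong, simp add: vector_derivative_circlepath)
      (simp add: circlepath power2_eq_square field_simps)
  ultimately show ?thesis by (simp add: mult.assoc)
qed

lemma continuous_on_partial_deriv:
  assumes f: "holomorphic_fun_on f U"
  shows "continuous_on U (partial_deriv i f)"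
proof (rule continuous_at_imp_continuous_on, intro ballI)
  fix z0 assume z0: "z0 \<in> U"
  obtain r where r: "r > 0" and sub: "\<And>z. z \<in> ball z0 r \<Longrightarrow> cball z r \<subseteq> U"
    using open_uniform_cball[OF holomorphic_fun_on_open[OF f] z0] by blast
  let ?c = "\<lambda>t. circ r t"
  have "continuous_on (ball z0 r) (\<lambda>z. integral (cbox 0 1) (\<lambda>t. f (z + axis i (?c t)) / ?c t))"
  proof (rule integral_continuous_on_param)
    have "z + axis i (?c t) \<in> U" if "z \<in> ball z0 r" for z t
      using r by (intro subsetD[OF sub[OF that]]) (simp add: dist_norm norm_axis_eq norm_mult)
    then show "continuous_on (ball z0 r \<times> cbox 0 1) (\<lambda>(z, t). f (z + axis i (?c t)) / ?c t)"
      using r unfolding split_beta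
      by (intro continuous_intros continuous_on_compose2[OF holomorphic_fun_on_continuous[OF f]]
            bounded_linear.continuous_on[OF bounded_linear_axis]) auto
  qed
  then have "continuous_on (ball z0 r) (partial_deriv i f)"
    by (rule continuous_on_eq) (simp add: partial_deriv_integral[OF f r sub])
  then show "isCont (partial_deriv i f) z0"
    using r by (simp add: continuous_on_eq_continuous_at)
qed

text \<open>Differentiation under the Cauchy integral. The coefficient of \<open>v $ j\<close> is
  itself a Cauchy integral, that of \<open>partial_deriv j f\<close> in direction \<open>i\<close>;
  this explicit form is what makes mixed derivatives commute.\<close>

lemma partial_deriv_has_derivative:
  fixes f :: "complex ^ 'd::finite \<Rightarrow> complex"
  assumes f: "holomorphic_fun_on f U" and z0: "z0 \<in> U"
  obtains r where "r > 0" "cball z0 r \<subseteq> U"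
    "(partial_deriv i f has_derivative (\<lambda>v. \<Sum>j\<in>UNIV. v $ j *
       integral {0..1} (\<lambda>t. partial_deriv j f (z0 + axis i (circ r t)) / (circ r t)))) (at z0)"
proof -
  obtain r where r: "r > 0" and sub: "\<And>z. z \<in> ball z0 r \<Longrightarrow> cball z r \<subseteq> U"
    using open_uniform_cball[OF holomorphic_fun_on_open[OF f] z0] by blast
  let ?c = "\<lambda>t. circ r t"
  have inU: "z + axis i (?c t) \<in> U" if "z \<in> ball z0 r" for z t
    using r by (intro subsetD[OF sub[OF that]]) (simp add: dist_norm norm_axis_eq norm_mult)
  have c0: "?c t \<noteq> 0" for t using r by simp
  define N :: "'d \<Rightarrow> (complex ^ 'd) \<Rightarrow>\<^sub>L complex" where "N = (\<lambda>j. Blinfun (\<lambda>v. v $ j))"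
  have N: "blinfun_apply (N j) v = v $ j" for j v
    by (simp add: N_def bounded_linear_Blinfun_apply bounded_linear_vec_nth)
  \<comment> \<open>The Leibniz rule wants the derivative of the integrand as a bounded linear map
    depending continuously on both variables.\<close>
  define F where "F = (\<lambda>z t. \<Sum>j\<in>UNIV. blinfun_mult_left (partial_deriv j f (z + axis i (?c t)) / ?c t) o\<^sub>L N j)"
  have F: "blinfun_apply (F z t) v = (\<Sum>j\<in>UNIV. v $ j * (partial_deriv j f (z + axis i (?c t)) / ?c t))" for z t v
    by (simp add: F_def blinfun.sum_left N)
  have contp: "continuous_on (ball z0 r \<times> cbox 0 1) (\<lambda>x. partial_deriv j f (fst x + axis i (?c (snd x))) / ?c (snd x))" for j
    using r inU c0
    by (intro continuous_intros continuous_on_compose2[OF continuous_on_partial_deriv[OF f]]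
            bounded_linear.continuous_on[OF bounded_linear_axis]) auto
  have contF: "continuous_on (ball z0 r \<times> cbox 0 1) (\<lambda>(z, t). F z t)"
    unfolding F_def split_beta
    by (intro continuous_intros bounded_linear.continuous_on[OF bounded_linear_blinfun_mult_left] contp)
  have contf: "continuous_on (cbox 0 1) (\<lambda>t. f (z + axis i (?c t)) / ?c t)" if "z \<in> ball z0 r" for z
    using r inU[OF that] c0
    by (intro continuous_intros continuous_on_compose2[OF holomorphic_fun_on_continuous[OF f]]
            bounded_linear.continuous_on[OF bounded_linear_axis]) auto
  have "((\<lambda>z. integral (cbox 0 1) (\<lambda>t. f (z + axis i (?c t)) / ?c t)) has_derivative
      blinfun_apply (integral (cbox 0 1) (F z0))) (at z0 within ball z0 r)"
  proof (rule leibniz_rule[OF _ _ contF])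
    fix z t assume z: "z \<in> ball z0 r"
    have "((\<lambda>z. f (z + axis i (?c t))) has_derivative
        (\<lambda>v. \<Sum>j\<in>UNIV. v $ j * partial_deriv j f (z + axis i (?c t)))) (at z)"
    proof -
      have "((\<lambda>z. z + axis i (?c t)) has_derivative (\<lambda>v. v)) (at z)"
        by (auto intro!: derivative_eq_intros)
      from has_derivative_compose[OF this holomorphic_fun_on_has_derivative[OF f inU[OF z]]]
      show ?thesis .
    qed
    from has_derivative_mult_left[OF this, of "1 / ?c t"]
    have "((\<lambda>z. f (z + axis i (?c t)) * (1 / ?c t)) has_derivative blinfun_apply (F z t)) (at z)"
      by (rule has_derivative_eq_rhs) (simp add: fun_eq_iff F sum_divide_distrib del: of_real_mult)
    then show "((\<lambda>z. f (z + axis i (?c t)) / ?c t) has_derivative blinfun_apply (F z t)) (at z within ball z0 r)"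
      by (simp only: times_divide_eq_right mult_1_right has_derivative_at_withinI)
  next
    show "(\<lambda>t. f (z + axis i (?c t)) / ?c t) integrable_on cbox 0 1" if "z \<in> ball z0 r" for z
      by (rule integrable_continuous[OF contf[OF that]])
  qed (use r in simp_all)
  moreover have "at z0 within ball z0 r = at z0"
    using r by (intro at_within_open) auto
  ultimately have "((\<lambda>z. integral (cbox 0 1) (\<lambda>t. f (z + axis i (?c t)) / ?c t)) has_derivative
      blinfun_apply (integral (cbox 0 1) (F z0))) (at z0)" by (simp only:)
  then have "(partial_deriv i f has_derivative blinfun_apply (integral (cbox 0 1) (F z0))) (at z0)"
    by (rule has_derivative_transform_within_open[where s="ball z0 r"])
       (use r in \<open>simp_all add: partial_deriv_integral[OF f r sub]\<close>)
  have fin: "blinfun_apply (integral (cbox 0 1) (F z0)) v =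
      (\<Sum>j\<in>UNIV. v $ j * integral {0..1} (\<lambda>t. partial_deriv j f (z0 + axis i (?c t)) / ?c t))" for v
  proof -
    have pc: "continuous_on (cbox 0 1) (\<lambda>t::real. (z0, t))" by (intro continuous_intros)
    have ps: "(\<lambda>t::real. (z0, t)) ` cbox 0 1 \<subseteq> ball z0 r \<times> cbox 0 1" using r by auto
    have cF: "continuous_on (cbox 0 1) (F z0)"
      using continuous_on_compose2[OF contF pc ps] by simp
    have cp: "(\<lambda>t. partial_deriv j f (z0 + axis i (?c t)) / ?c t) integrable_on cbox 0 1" for j
      using continuous_on_compose2[OF contp[of j] pc ps] by (intro integrable_continuous) simp
    have "blinfun_apply (integral (cbox 0 1) (F z0)) v = integral (cbox 0 1) (\<lambda>t. blinfun_apply (F z0 t) v)"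
      by (rule blinfun_apply_integral[OF integrable_continuous[OF cF]])
    also have "\<dots> = (\<Sum>j\<in>UNIV. integral (cbox 0 1) (\<lambda>t. v $ j * (partial_deriv j f (z0 + axis i (?c t)) / ?c t)))"
      unfolding F by (rule integral_sum) (rule finite, rule integrable_on_mult_right[OF cp])
    finally show ?thesis by (simp only: integral_mult_right cbox_interval)
  qed
  from \<open>(partial_deriv i f has_derivative blinfun_apply (integral (cbox 0 1) (F z0))) (at z0)\<close>
  have "(partial_deriv i f has_derivative (\<lambda>v. \<Sum>j\<in>UNIV. v $ j *
       integral {0..1} (\<lambda>t. partial_deriv j f (z0 + axis i (?c t)) / ?c t))) (at z0)"
    by (rule has_derivative_eq_rhs) (rule ext, rule fin)
  then show ?thesis
    using that[OF r sub[of z0]] r by simp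
qed

lemma holomorphic_fun_on_partial_deriv:
  assumes "holomorphic_fun_on f U"
  shows "holomorphic_fun_on (partial_deriv i f) U"
  unfolding holomorphic_fun_on_def
proof (intro conjI ballI holomorphic_fun_on_open[OF assms])
  fix z assume z: "z \<in> U"
  show "\<exists>f'. (partial_deriv i f has_derivative f') (at z) \<and> (\<forall>c v. f' (c *s v) = c * f' v)"
  proof (rule partial_deriv_has_derivative[OF assms z, of i])
    fix r :: real
    let ?g = "\<lambda>j. integral {0..1} (\<lambda>t. partial_deriv j f (z + axis i (circ r t)) / (circ r t))"
    assume "(partial_deriv i f has_derivative (\<lambda>v. \<Sum>j\<in>UNIV. v $ j * ?g j)) (at z)"
    then show ?thesis
      by (intro exI[of _ "\<lambda>v. \<Sum>j\<in>UNIV. v $ j * ?g j"]) (auto simp: sum_distrib_left mult.assoc)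
  qed
qed

lemma partial_deriv_commute:
  assumes "holomorphic_fun_on f U" "z \<in> U"
  shows "partial_deriv j (partial_deriv i f) z = partial_deriv i (partial_deriv j f) z"
proof (rule partial_deriv_has_derivative[OF assms, of i])
  fix r :: real
  let ?g = "\<lambda>j. integral {0..1} (\<lambda>t. partial_deriv j f (z + axis i (circ r t)) / (circ r t))"
  assume r: "r > 0" "cball z r \<subseteq> U"
    and der: "(partial_deriv i f has_derivative (\<lambda>v. \<Sum>j\<in>UNIV. v $ j * ?g j)) (at z)"
  show ?thesis
    using partial_deriv_eq[OF der, of j]
      partial_deriv_integral[OF holomorphic_fun_on_partial_deriv[OF assms(1)] r, of i j] by simp
qed

section \<open>The smooth locus and its graph charts\<close>

lemma exhaust_5: "x = 1 \<or> x = 2 \<or> x = 3 \<or> x = 4 \<or> x = 5" for x :: 5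
proof (induct x)
  case (of_int z)
  then have "0 \<le> z" "z < 5" by simp_all
  then have "z = 0 \<or> z = 1 \<or> z = 2 \<or> z = 3 \<or> z = 4" by arith
  then show ?case by auto
qed

lemma forall_5: "(\<forall>i::5. P i) \<longleftrightarrow> P 1 \<and> P 2 \<and> P 3 \<and> P 4 \<and> P 5"
  by (metis exhaust_5)

lemma UNIV_5: "UNIV = {1, 2, 3, 4, 5::5}"
  using exhaust_5 by auto

lemma sum_5: "sum f (UNIV::5 set) = f 1 + f 2 + f 3 + f 4 + f 5"
  unfolding UNIV_5 by (simp add: ac_simps)

definition grad :: "nat \<Rightarrow> complex^5 \<Rightarrow> complex^5" where
  "grad n p = (let a = p $ 1; b = p $ 2; x = p $ 3; y = p $ 4; z = p $ 5; q = x * z - y^2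
     in \<chi> i. if i = 1 then 2 * (a * x + b * y) else if i = 2 then 2 * (a * y + b * z)
       else if i = 3 then a^2 + of_nat n * z * q ^ (n - 1)
       else if i = 4 then 2 * a * b - 2 * of_nat n * y * q ^ (n - 1)
       else b^2 + of_nat n * x * q ^ (n - 1))"

lemma grad_simps:
  "grad n p $ 1 = 2 * crit p"
  "grad n p $ 2 = 2 * (p $ 1 * p $ 4 + p $ 2 * p $ 5)"
  "grad n p $ 3 = (p $ 1)^2 + of_nat n * p $ 5 * disc p ^ (n - 1)"
  "grad n p $ 4 = 2 * p $ 1 * p $ 2 - 2 * of_nat n * p $ 4 * disc p ^ (n - 1)"
  "grad n p $ 5 = (p $ 2)^2 + of_nat n * p $ 3 * disc p ^ (n - 1)"
  by (simp_all add: grad_def Let_def)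

definition dX :: "nat \<Rightarrow> complex^5 \<Rightarrow> complex^5 \<Rightarrow> complex" where
  "dX n p v = (\<Sum>i\<in>UNIV. v $ i * grad n p $ i)"

lemma X_eq_has_derivative: "(X_eq n has_derivative dX n p) (at p)"
proof -
  have nth: "((\<lambda>p. p $ i) has_derivative (\<lambda>v. v $ i)) (at p)" for i :: 5
    by (rule bounded_linear.has_derivative[OF bounded_linear_vec_nth has_derivative_ident])
  show ?thesis
    unfolding X_eq_def[abs_def] Let_def
    by (auto intro!: derivative_eq_intros nth simp: fun_eq_iff dX_def sum_5 grad_simps)
       (simp add: algebra_simps power2_eq_square)
qed

lemma frechet_X_eq: "frechet_derivative (X_eq n) (at p) = dX n p"
  using frechet_derivative_at[OF X_eq_has_derivative] by simp

lemma X_tangent_iff: "v \<in> X_tangent n p \<longleftrightarrow> dX n p v = 0"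
  by (simp add: X_tangent_def frechet_X_eq)

lemma dX_add: "dX n p (u + v) = dX n p u + dX n p v"
  and dX_diff: "dX n p (u - v) = dX n p u - dX n p v"
  and dX_scale: "dX n p (c *s u) = c * dX n p u"
  by (simp_all add: dX_def sum.distrib algebra_simps sum_subtractf sum_distrib_left)

lemma dX_axis: "dX n p (axis i c) = c * grad n p $ i"
  by (simp add: dX_def axis_def if_distrib[of "\<lambda>x. x * _"] cong: if_cong)

text \<open>If a = b = 0, the equation forces \<open>disc p = 0\<close>, and every term of the
  gradient vanishes. Conversely z (a x + b y) - y (a y + b z) is a times \<open>disc p\<close>, and
  similarly for b; so if the first two components vanish, \<open>disc p\<close> does too, and for
  \<open>n \<ge> 2\<close> components 3 and 5 reduce to the squares of a and b.\<close>

lemma grad_nonzero_iff: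
  assumes n: "n \<ge> 2" and p: "X_eq n p = 0"
  shows "(\<exists>r. grad n p $ r \<noteq> 0) \<longleftrightarrow> p $ 1 \<noteq> 0 \<or> p $ 2 \<noteq> 0"
proof
  assume "\<exists>r. grad n p $ r \<noteq> 0"
  then obtain r where r: "grad n p $ r \<noteq> 0" by blast
  show "p $ 1 \<noteq> 0 \<or> p $ 2 \<noteq> 0"
  proof (rule ccontr)
    assume "\<not> (p $ 1 \<noteq> 0 \<or> p $ 2 \<noteq> 0)"
    then have ab: "p $ 1 = 0" "p $ 2 = 0" by auto
    then have "disc p ^ n = 0" using p n by (simp add: X_eq_def Let_def)
    then have "disc p ^ (n - 1) = 0" using n by simp
    then show False using r ab exhaust_5[of r] by (auto simp: grad_simps)
  qed
next
  assume ab: "p $ 1 \<noteq> 0 \<or> p $ 2 \<noteq> 0"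
  show "\<exists>r. grad n p $ r \<noteq> 0"
  proof (rule ccontr)
    assume "\<not> (\<exists>r. grad n p $ r \<noteq> 0)"
    then have g: "grad n p $ r = 0" for r by blast
    define q where "q = disc p"
    have "p $ 1 * q = 0" "p $ 2 * q = 0"
      using g[of 1] g[of 2] unfolding grad_simps q_def by algebra+
    then have "q = 0" using ab by auto
    then have qn: "q ^ (n - 1) = 0" using n by simp
    show False using g[of 3] g[of 5] ab unfolding grad_simps q_def[symmetric] qn by simp
  qed
qed

lemma X_reg_iff:
  assumes "n \<ge> 2"
  shows "p \<in> X_reg n \<longleftrightarrow> X_eq n p = 0 \<and> (p $ 1 \<noteq> 0 \<or> p $ 2 \<noteq> 0)"
proof -
  have "(\<exists>v. dX n p v \<noteq> 0) \<longleftrightarrow> (\<exists>r. grad n p $ r \<noteq> 0)"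
  proof
    show "\<exists>v. dX n p v \<noteq> 0 \<Longrightarrow> \<exists>r. grad n p $ r \<noteq> 0"
      unfolding dX_def by (metis (no_types, lifting) mult_zero_right sum.neutral)
    show "\<exists>r. grad n p $ r \<noteq> 0 \<Longrightarrow> \<exists>v. dX n p v \<noteq> 0"
      by (metis dX_axis mult_1)
  qed
  then show ?thesis
    using grad_nonzero_iff[OF assms] by (auto simp: X_reg_def X_def frechet_X_eq)
qed

lemma X_regE:
  assumes "n \<ge> 2" "p \<in> X_reg n"
  obtains r where "grad n p $ r \<noteq> 0"
  using assms grad_nonzero_iff X_reg_iff by blast

lemma continuous_on_grad: "continuous_on S (\<lambda>p. grad n p $ r)"
  using exhaust_5[of r] by (elim disjE) (auto simp: grad_simps intro!: continuous_intros)

text \<open>The inverse function theorem for the map that replaces coordinate \<open>r\<close> by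
  the equation; \<open>e\<close> lists the remaining coordinates. The exported derivative says that
  the chart sends basis vectors to the projections of ambient ones along
  \<open>axis r (1 / grad n q $ r)\<close>, which later matches chart coefficients with ambient
  components.\<close>

lemma graph_chart:
  fixes e :: "4 \<Rightarrow> 5"
  assumes n: "n \<ge> 2" and p: "p \<in> X_reg n" and r: "grad n p $ r \<noteq> 0"
    and e: "bij_betw e UNIV (UNIV - {r})"
  obtains U \<phi> W where "open W" "p \<in> W" "holomorphic_parametrization (X_reg n) U \<phi>"
    "\<phi> ` U = X_reg n \<inter> W"
    "\<And>q. q \<in> X_reg n \<Longrightarrow> q \<in> W \<Longrightarrow> (\<chi> j. q $ e j) \<in> U \<and> \<phi> (\<chi> j. q $ e j) = q"
    "\<And>q. q \<in> W \<Longrightarrow> grad n q $ r \<noteq> 0"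
    "\<And>\<zeta> j. \<zeta> \<in> U \<Longrightarrow> frechet_derivative \<phi> (at \<zeta>) (axis j 1) =
       axis (e j) 1 - axis r (grad n (\<phi> \<zeta>) $ e j / grad n (\<phi> \<zeta>) $ r)"
proof -
  \<comment> \<open>The condition on a and b makes every zero of the equation in \<open>O0\<close> a
    point of \<open>X_reg\<close>.\<close>
  define O0 where "O0 = {q :: complex^5. grad n q $ r \<noteq> 0 \<and> (q $ 1 \<noteq> 0 \<or> q $ 2 \<noteq> 0)}"
  have O0: "open O0"
    unfolding O0_def
    by (intro open_Collect_conj open_Collect_disj open_Collect_neq continuous_on_grad continuous_intros)
  have p0: "p \<in> O0" using p r by (simp add: O0_def X_reg_iff[OF n])
  define F where "F = (\<lambda>q. \<chi> i. if i = r then X_eq n q else q $ i)"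
  define N :: "5 \<Rightarrow> (complex^5) \<Rightarrow>\<^sub>L complex" where "N = (\<lambda>j. Blinfun (\<lambda>v. v $ j))"
  have N: "blinfun_apply (N j) v = v $ j" for j v
    by (simp add: N_def bounded_linear_Blinfun_apply bounded_linear_vec_nth)
  define A :: "complex \<Rightarrow>\<^sub>L (complex^5)" where "A = Blinfun (axis r)"
  have A: "blinfun_apply A c = axis r c" for c
    by (simp add: A_def bounded_linear_Blinfun_apply bounded_linear_axis)
  define F' where "F' = (\<lambda>q. id_blinfun - (A o\<^sub>L N r) + (A o\<^sub>L (\<Sum>i\<in>UNIV. blinfun_mult_left (grad n q $ i) o\<^sub>L N i)))"
  have F': "blinfun_apply (F' q) v = (\<chi> i. if i = r then dX n q v else v $ i)" for q v
    by (simp add: F'_def blinfun.add_left blinfun.diff_left N A blinfun.sum_left dX_def vec_eq_iff axis_def)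
  have derF: "(F has_derivative blinfun_apply (F' q)) (at q)" for q
  proof -
    have "((\<lambda>q. q - axis r (q $ r) + axis r (X_eq n q)) has_derivative
        (\<lambda>v. v - axis r (v $ r) + axis r (dX n q v))) (at q)"
      by (intro derivative_intros bounded_linear.has_derivative[OF bounded_linear_axis] X_eq_has_derivative
        bounded_linear.has_derivative[OF bounded_linear_vec_nth])
    moreover have "(\<lambda>q. q - axis r (q $ r) + axis r (X_eq n q)) = F"
      by (auto simp: F_def vec_eq_iff axis_def)
    moreover have "(\<lambda>v. v - axis r (v $ r) + axis r (dX n q v)) = blinfun_apply (F' q)"
      by (auto simp: F' vec_eq_iff axis_def fun_eq_iff)
    ultimately show ?thesis by simp
  qed
  have contF': "continuous_on O0 F'"
    unfolding F'_def by (intro continuous_intros bounded_linear.continuous_on[OF bounded_linear_blinfun_mult_left]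
       continuous_on_grad)
  \<comment> \<open>Explicit solution of the linearized system: all coordinates but \<open>r\<close>
    are copied, and coordinate \<open>r\<close> is solved from \<open>dX\<close>. It yields both
    bijectivity and the derivative of the chart.\<close>
  have FL: "blinfun_apply (F' q) w = u \<longleftrightarrow> w = (\<chi> i. if i = r then (u $ r - dX n q (\<chi> i. if i = r then 0 else u $ i)) / grad n q $ r else u $ i)"
    if "grad n q $ r \<noteq> 0" for q u w
  proof -
    have d: "dX n q w = dX n q (\<chi> i. if i = r then 0 else w $ i) + w $ r * grad n q $ r"
    proof -
      have "w = (\<chi> i. if i = r then 0 else w $ i) + axis r (w $ r)" by (simp add: vec_eq_iff axis_def)
      then show ?thesis by (metis dX_add dX_axis)
    qed
    show ?thesis
    proof
      assume "blinfun_apply (F' q) w = u"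
      then have u: "u $ i = (if i = r then dX n q w else w $ i)" for i by (auto simp: F')
      have "(\<chi> i. if i = r then 0 else u $ i) = (\<chi> i. if i = r then 0 else w $ i)"
        by (simp add: vec_eq_iff u)
      then show "w = (\<chi> i. if i = r then (u $ r - dX n q (\<chi> i. if i = r then 0 else u $ i)) / grad n q $ r else u $ i)"
        using that d by (simp add: vec_eq_iff u)
    next
      assume w: "w = (\<chi> i. if i = r then (u $ r - dX n q (\<chi> i. if i = r then 0 else u $ i)) / grad n q $ r else u $ i)"
      then have "(\<chi> i. if i = r then 0 else w $ i) = (\<chi> i. if i = r then 0 else u $ i)"
        by (simp add: vec_eq_iff)
      moreover have "w $ r * grad n q $ r = u $ r - dX n q (\<chi> i. if i = r then 0 else u $ i)"
        using that by (simp add: w)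
      ultimately have "dX n q w = u $ r" using d by simp
      then show "blinfun_apply (F' q) w = u" by (simp add: F' vec_eq_iff w)
    qed
  qed
  have "bij (blinfun_apply (F' p))"
  proof (rule bijI')
    fix x y
    show "blinfun_apply (F' p) x = blinfun_apply (F' p) y \<longleftrightarrow> x = y"
      using FL[OF r, of x "blinfun_apply (F' p) y"] FL[OF r, of y "blinfun_apply (F' p) y"] by simp
    show "\<exists>w. y = blinfun_apply (F' p) w"
      by (rule exI, rule sym, rule iffD2[OF FL[OF r]], rule refl)
  qed
  then obtain G where G: "linear G" "G \<circ> blinfun_apply (F' p) = id"
    using linear_injective_left_inverse[OF bounded_linear.linear[OF blinfun.bounded_linear_right]]
      bij_is_inj by blast
  define invF where "invF = Blinfun G"
  have "invF o\<^sub>L F' p = id_blinfun"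
    using G by (intro blinfun_eqI) (simp add: invF_def bounded_linear_Blinfun_apply linear_conv_bounded_linear fun_eq_iff)
  note ift = inverse_function_theorem[OF O0 derF contF' p0 this]
  obtain U' V g g' where U': "open U'" "U' \<subseteq> O0" "p \<in> U'" and V: "open V" "F p \<in> V" and hom: "homeomorphism U' V F g"
    and g: "\<And>y. y \<in> V \<Longrightarrow> (g has_derivative (g' y)) (at y)"
      "\<And>y. y \<in> V \<Longrightarrow> g' y = inv (blinfun_apply (F'(g y)))"
      "\<And>y. y \<in> V \<Longrightarrow> bij (blinfun_apply (F'(g y)))"
    by (rule ift) (rule that; assumption)
  define e' where "e' = inv_into UNIV e"
  have er: "e j \<noteq> r" and e'e: "e' (e j) = j" for j
    using e by (auto simp: bij_betw_def e'_def)
  have ee': "i \<noteq> r \<Longrightarrow> e (e' i) = i" for i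
    using e by (auto simp: bij_betw_def e'_def intro!: f_inv_into_f)
  define \<iota> where "\<iota> = (\<lambda>\<zeta>::complex^4. \<chi> i. if i = r then 0 else \<zeta> $ e' i)"
  have lin\<iota>: "bounded_linear \<iota>"
  proof -
    have "linear \<iota>" by (rule linearI) (auto simp: \<iota>_def vec_eq_iff)
    then show ?thesis by (simp add: linear_conv_bounded_linear)
  qed
  define U where "U = \<iota> -` V"
  define \<phi> where "\<phi> = g \<circ> \<iota>"
  define pr where "pr = (\<lambda>q::complex^5. \<chi> j. q $ e j)"
  have U: "open U" unfolding U_def
    by (rule open_vimage[OF V(1) linear_continuous_on[OF lin\<iota>]])
  have hom': "\<And>x. x \<in> U' \<Longrightarrow> g (F x) = x" "\<And>y. y \<in> V \<Longrightarrow> F (g y) = y" "F ` U' = V" "g ` V = U'" "continuous_on V g"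
    using hom by (auto simp: homeomorphism_def)
  have phi1: "\<phi> \<zeta> \<in> U'" "\<phi> \<zeta> \<in> X_reg n" "pr (\<phi> \<zeta>) = \<zeta>" if "\<zeta> \<in> U" for \<zeta>
  proof -
    show 1: "\<phi> \<zeta> \<in> U'" using that hom'(4) by (auto simp: U_def \<phi>_def)
    have F: "F (\<phi> \<zeta>) = \<iota> \<zeta>" using that hom'(2) by (auto simp: U_def \<phi>_def)
    from arg_cong[OF this, of "\<lambda>v. v $ r"] have "X_eq n (\<phi> \<zeta>) = 0"
      by (simp add: F_def \<iota>_def)
    with 1 U'(2) show "\<phi> \<zeta> \<in> X_reg n" by (auto simp: X_reg_iff[OF n] O0_def)
    show "pr (\<phi> \<zeta>) = \<zeta>"
      using arg_cong[OF F, of "\<lambda>v. v $ e _"] by (simp add: vec_eq_iff pr_def F_def \<iota>_def er e'e)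
  qed
  have phi2: "pr q \<in> U \<and> \<phi> (pr q) = q" if "q \<in> X_reg n" "q \<in> U'" for q
  proof -
    have "F q = \<iota> (pr q)"
      using that(1) by (simp add: F_def \<iota>_def vec_eq_iff X_reg_iff[OF n] pr_def ee')
    then have "\<iota> (pr q) \<in> V" "g (\<iota> (pr q)) = q"
      using that(2) hom'(1)[of q] hom'(3) by (auto dest: sym)
    then show ?thesis by (simp add: U_def \<phi>_def)
  qed
  have img: "\<phi> ` U = X_reg n \<inter> U'" using phi1 phi2 by (force intro: rev_image_eqI)
  define \<phi>' where "\<phi>' = (\<lambda>\<zeta> v. \<chi> i. if i = r then - dX n (\<phi> \<zeta>) (\<iota> v) / grad n (\<phi> \<zeta>) $ r else v $ e' i)"
  have gne: "grad n (\<phi> \<zeta>) $ r \<noteq> 0" if "\<zeta> \<in> U" for \<zeta> using phi1(1)[OF that] U'(2) by (auto simp: O0_def)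
  have der\<phi>: "(\<phi> has_derivative \<phi>' \<zeta>) (at \<zeta>)" if "\<zeta> \<in> U" for \<zeta>
  proof -
    have \<zeta>: "\<iota> \<zeta> \<in> V" using that by (simp add: U_def)
    have d: "(\<phi> has_derivative (\<lambda>v. g' (\<iota> \<zeta>) (\<iota> v))) (at \<zeta>)"
      unfolding \<phi>_def o_def
      by (rule has_derivative_compose[OF bounded_linear_imp_has_derivative[OF lin\<iota>] g(1)[OF \<zeta>]])
    have "g' (\<iota> \<zeta>) (\<iota> v) = \<phi>' \<zeta> v" for v
    proof -
      have "blinfun_apply (F' (\<phi> \<zeta>)) (\<phi>' \<zeta> v) = \<iota> v"
      proof -
        have "(\<chi> i. if i = r then 0 else \<iota> v $ i) = \<iota> v" by (simp add: \<iota>_def vec_eq_iff)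
        then show ?thesis
          unfolding FL[OF gne[OF that]] by (simp add: \<phi>'_def \<iota>_def vec_eq_iff)
      qed
      then have "inv (blinfun_apply (F' (\<phi> \<zeta>))) (\<iota> v) = \<phi>' \<zeta> v"
        using inv_f_f[OF bij_is_inj[OF g(3)[OF \<zeta>]], of "\<phi>' \<zeta> v"] by (simp add: \<phi>_def)
      then show ?thesis using g(2)[OF \<zeta>] by (simp add: \<phi>_def)
    qed
    then show ?thesis by (intro has_derivative_eq_rhs[OF d] ext)
  qed
  have fr: "frechet_derivative \<phi> (at \<zeta>) = \<phi>' \<zeta>" if "\<zeta> \<in> U" for \<zeta>
    using frechet_derivative_at[OF der\<phi>[OF that]] by simp
  have scale\<iota>: "\<iota> (c *s v) = c *s \<iota> v" for c v by (simp add: \<iota>_def vec_eq_iff)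
  have par: "holomorphic_parametrization (X_reg n) U \<phi>"
    unfolding holomorphic_parametrization_def
  proof (intro conjI ballI exI)
    show "holomorphic_map_on \<phi> U"
      unfolding holomorphic_map_on_def holomorphic_fun_on_def
    proof (intro allI conjI ballI U)
      fix i z assume z: "z \<in> U"
      have "((\<lambda>z. \<phi> z $ i) has_derivative (\<lambda>v. \<phi>' z v $ i)) (at z)"
        by (rule bounded_linear.has_derivative[OF bounded_linear_vec_nth der\<phi>[OF z]])
      moreover have "\<phi>' z (c *s v) $ i = c * \<phi>' z v $ i" for c v
        by (simp add: \<phi>'_def scale\<iota> dX_scale)
      ultimately show "\<exists>f'. ((\<lambda>z. \<phi> z $ i) has_derivative f') (at z) \<and> (\<forall>c v. f' (c *s v) = c * f' v)"
        by blast
    qed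
    show "openin (top_of_set (X_reg n)) (\<phi> ` U)"
      unfolding img using U'(1) by (simp add: openin_open_Int)
    show "homeomorphism U (\<phi> ` U) \<phi> pr"
    proof (rule homeomorphismI)
      show "continuous_on U \<phi>"
        using der\<phi> has_derivative_continuous by (metis continuous_at_imp_continuous_on)
      show "continuous_on (\<phi> ` U) pr" unfolding pr_def by (intro continuous_intros)
    qed (use phi1 in auto)
    show "inj (frechet_derivative \<phi> (at z))" if "z \<in> U" for z
    proof (rule inj_on_inverseI[where g=pr])
      show "pr (frechet_derivative \<phi> (at z) v) = v" for v
        by (simp add: fr[OF that] \<phi>'_def pr_def vec_eq_iff er e'e)
    qed
  qed
  have fin: "frechet_derivative \<phi> (at \<zeta>) (axis j 1) =
       axis (e j) 1 - axis r (grad n (\<phi> \<zeta>) $ e j / grad n (\<phi> \<zeta>) $ r)" if "\<zeta> \<in> U" for \<zeta> j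
  proof -
    have ej: "i = e j \<longleftrightarrow> e' i = j" if "i \<noteq> r" for i
      using e'e ee'[OF that] by metis
    have "\<iota> (axis j 1) $ i = axis (e j) 1 $ i" for i
      by (cases "i = r") (use er[of j] ej in \<open>auto simp: \<iota>_def axis_def\<close>)
    then have \<iota>: "\<iota> (axis j 1) = axis (e j) 1" by (simp add: vec_eq_iff)
    have "\<phi>' \<zeta> (axis j 1) $ i =
       (axis (e j) 1 - axis r (grad n (\<phi> \<zeta>) $ e j / grad n (\<phi> \<zeta>) $ r)) $ i" for i
      by (cases "i = r") (use er[of j] ej in \<open>auto simp: \<phi>'_def \<iota> dX_axis\<close>, simp_all add: axis_def)
    then show ?thesis
      unfolding fr[OF that] by (simp add: vec_eq_iff)
  qed
  show ?thesis
  proof (rule that[of U' U \<phi>])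
    show "q \<in> U' \<Longrightarrow> grad n q $ r \<noteq> 0" for q using U'(2) by (auto simp: O0_def)
  qed (use U' par img phi2 fin pr_def in auto)
qed

section \<open>Polynomials from growth bounds\<close>

text \<open>\<open>good\<close> stands for membership in a vector space of functions. The divided
  difference (P(s) - P(s0)) / (s - s0) has degree one less and good values at the remaining nodes,
  and Horner's recursion recovers the coefficients of P from its coefficients. The lemma serves for
  vanishing, for holomorphy and for growth bounds.\<close>

lemma coeffs_in_span_of_nodes:
  fixes a :: "nat \<Rightarrow> 'p \<Rightarrow> complex"
  assumes add: "\<And>f g. good f \<Longrightarrow> good g \<Longrightarrow> good (\<lambda>p. f p + g p)"
    and scale: "\<And>c f. good f \<Longrightarrow> good (\<lambda>p. c * f p)"
    and inf: "infinite N"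
    and nodes: "\<And>s. s \<in> N \<Longrightarrow> good (\<lambda>p. \<Sum>k\<le>d. a k p * s ^ k)"
    and k: "k \<le> d"
  shows "good (a k)"
  using inf nodes k
proof (induction d arbitrary: a k N)
  case 0
  then obtain s where "s \<in> N" using infinite_imp_nonempty by blast
  with 0 show ?case by auto
next
  case (Suc d)
  obtain s0 where s0: "s0 \<in> N" using Suc.prems(1) infinite_imp_nonempty by blast
  define b where "b = (\<lambda>k p. \<Sum>j=Suc k..Suc d. a j p * s0 ^ (j - Suc k))"
  have sub: "(\<Sum>k\<le>Suc d. a k p * s ^ k) - (\<Sum>k\<le>Suc d. a k p * s0 ^ k) = (s - s0) * (\<Sum>k\<le>d. b k p * s ^ k)" for s p
    using sub_polyfun[where a="\<lambda>i. a i p" and n="Suc d" and x=s and y=s0]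
    by (simp only: b_def lessThan_Suc_atMost sum_distrib_right)
  have gb: "good (b k)" if "k \<le> d" for k
  proof (rule Suc.IH[of "N - {s0}"])
    show "infinite (N - {s0})" using Suc.prems(1) by simp
    fix s assume s: "s \<in> N - {s0}"
    have "good (\<lambda>p. 1 / (s - s0) * ((\<Sum>k\<le>Suc d. a k p * s ^ k) + (-1) * (\<Sum>k\<le>Suc d. a k p * s0 ^ k)))"
      using s s0 by (intro scale add Suc.prems(2)) auto
    moreover have "1 / (s - s0) * ((\<Sum>k\<le>Suc d. a k p * s ^ k) + (-1) * (\<Sum>k\<le>Suc d. a k p * s0 ^ k))
        = (\<Sum>k\<le>d. b k p * s ^ k)" for p
      using sub[of p s] s by (simp add: field_simps)
    ultimately show "good (\<lambda>p. \<Sum>k\<le>d. b k p * s ^ k)" by (simp only:)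
  qed fact
  have ga: "good (a (Suc j))" if "j \<le> d" for j
  proof -
    have step: "b j p = a (Suc j) p + s0 * (if j < d then b (Suc j) p else 0)" for p
    proof -
      have "{Suc j..Suc d} = insert (Suc j) {Suc (Suc j)..Suc d}" using that by auto
      then have "b j p = a (Suc j) p + (\<Sum>i=Suc (Suc j)..Suc d. a i p * s0 ^ (i - Suc j))"
        unfolding b_def by (simp del: sum.cl_ivl_Suc)
      also have "(\<Sum>i=Suc (Suc j)..Suc d. a i p * s0 ^ (i - Suc j)) = s0 * (\<Sum>i=Suc (Suc j)..Suc d. a i p * s0 ^ (i - Suc (Suc j)))"
        unfolding sum_distrib_left
      proof (rule sum.cong)
        fix i assume "i \<in> {Suc (Suc j)..Suc d}"
        then have "i - Suc j = Suc (i - Suc (Suc j))" by auto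
        then show "a i p * s0 ^ (i - Suc j) = s0 * (a i p * s0 ^ (i - Suc (Suc j)))" by simp
      qed simp
      also have "(\<Sum>i=Suc (Suc j)..Suc d. a i p * s0 ^ (i - Suc (Suc j))) = (if j < d then b (Suc j) p else 0)"
        using that by (auto simp: b_def)
      finally show ?thesis .
    qed
    show ?thesis
    proof (cases "j < d")
      case True
      have "good (\<lambda>p. b j p + (- s0) * b (Suc j) p)" using True by (intro add scale gb) auto
      moreover have "b j p + (- s0) * b (Suc j) p = a (Suc j) p" for p using step[of p] True by simp
      ultimately show ?thesis by (simp only:)
    next
      case False
      have "a (Suc j) = b j" using step False by (simp add: fun_eq_iff)
      then show ?thesis using gb[OF that] by simp
    qed
  qed
  show ?case
  proof (cases k)
    case (Suc j)
    then show ?thesis using ga[of j] Suc.prems by simp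
  next
    case 0
    have "good (\<lambda>p. (\<Sum>k\<le>Suc d. a k p * s0 ^ k) + (- s0) * b 0 p)"
      by (intro add scale gb Suc.prems(2) s0) auto
    moreover have "(\<Sum>k\<le>Suc d. a k p * s0 ^ k) + (- s0) * b 0 p = a 0 p" for p
    proof -
      have "(\<Sum>k\<le>Suc d. a k p * s0 ^ k) = a 0 p + (\<Sum>k\<le>d. a (Suc k) p * s0 ^ (Suc k))"
        by (simp add: sum.atMost_Suc_shift del: sum.atMost_Suc)
      moreover have "s0 * b 0 p = (\<Sum>k\<le>d. a (Suc k) p * s0 ^ (Suc k))"
        unfolding b_def sum_distrib_left
        by (rule sum.reindex_bij_witness[of _ Suc "\<lambda>j. j - 1"]) (auto simp: power_eq_if)
      ultimately show ?thesis by simp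
    qed
    ultimately have "good (a 0)" by (simp only:)
    then show ?thesis using 0 by simp
  qed
qed

lemma poly_coeffs_zero:
  fixes c :: "nat \<Rightarrow> complex"
  assumes "infinite N" "\<And>s. s \<in> N \<Longrightarrow> (\<Sum>k\<le>d. c k * s ^ k) = 0" "k \<le> d"
  shows "c k = 0"
  using coeffs_in_span_of_nodes[where good="\<lambda>f. f () = 0" and N=N and d=d and a="\<lambda>k _. c k" and k=k] assms by simp

lemma infinite_nonzero_complex: "infinite (- {0 :: complex})"
  by (simp add: infinite_UNIV_char_0)

lemma poly_coeffs_zero3:
  fixes c :: "nat \<Rightarrow> nat \<Rightarrow> nat \<Rightarrow> complex"
  assumes "\<And>y u w. u \<noteq> 0 \<Longrightarrow> w \<noteq> 0 \<Longrightarrow> poly3 d c y u w = 0"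
    and "k \<le> d" "i \<le> d" "j \<le> d"
  shows "c k i j = 0"
proof -
  have 1: "(\<Sum>i\<le>d. \<Sum>j\<le>d. c k i j * u ^ i * w ^ j) = 0" if "u \<noteq> 0" "w \<noteq> 0" for u w
    by (rule poly_coeffs_zero[where N=UNIV and d=d and c="\<lambda>k. \<Sum>i\<le>d. \<Sum>j\<le>d. c k i j * u ^ i * w ^ j", OF infinite_UNIV_char_0 _ \<open>k \<le> d\<close>])
       (use assms(1)[OF that] in \<open>simp add: sum_distrib_left sum_distrib_right mult_ac\<close>)
  have 2: "(\<Sum>j\<le>d. c k i j * w ^ j) = 0" if "w \<noteq> 0" for w
    by (rule poly_coeffs_zero[where N="- {0}" and d=d and c="\<lambda>i. \<Sum>j\<le>d. c k i j * w ^ j", OF infinite_nonzero_complex _ \<open>i \<le> d\<close>])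
       (use 1 that in \<open>simp add: sum_distrib_left sum_distrib_right mult_ac\<close>)
  show ?thesis
    by (rule poly_coeffs_zero[where N="- {0}" and d=d and c="\<lambda>j. c k i j", OF infinite_nonzero_complex _ \<open>j \<le> d\<close>])
       (use 2 in simp)
qed

text \<open>The growth bound has Newton polygon \<open>k + max i j \<le> W\<close>; Liouville's theorem is applied to one
  variable after the other, and \<open>coeffs_in_span_of_nodes\<close> transfers holomorphy and the bounds to
  the coefficients.\<close>

lemma polynomial_of_growth:
  fixes h :: "complex \<Rightarrow> complex \<Rightarrow> complex \<Rightarrow> complex"
  assumes hy: "\<And>u w. u \<noteq> 0 \<or> w \<noteq> 0 \<Longrightarrow> (\<lambda>y. h y u w) holomorphic_on UNIV"
    and hu: "\<And>y w. w \<noteq> 0 \<Longrightarrow> (\<lambda>u. h y u w) holomorphic_on UNIV"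
    and hw: "\<And>y u. u \<noteq> 0 \<Longrightarrow> (\<lambda>w. h y u w) holomorphic_on UNIV"
    and C0: "C \<ge> 0"
    and bnd: "\<And>y u w R. u \<noteq> 0 \<or> w \<noteq> 0 \<Longrightarrow> norm y = R \<Longrightarrow> 1 \<le> R \<Longrightarrow> norm u \<le> R \<Longrightarrow> norm w \<le> R \<Longrightarrow>
       norm (u * w) \<le> R / 2 \<Longrightarrow> norm (h y u w) \<le> C * R ^ W"
  obtains c where "\<And>y u w. w \<noteq> 0 \<Longrightarrow> h y u w = poly3 W c y u w"
    "\<And>k i j. W < k + i \<or> W < k + j \<Longrightarrow> c k i j = 0"
proof -
  \<comment> \<open>The least modulus of \<open>y\<close> from which the growth bound applies to
    given \<open>u\<close> and \<open>w\<close>; Cauchy's inequality on this circle bounds the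
    coefficients of the powers of \<open>y\<close>.\<close>
  define \<rho> where "\<rho> = (\<lambda>u w :: complex. max (max 1 (2 * norm (u * w))) (max (norm u) (norm w)))"
  define a where "a = (\<lambda>k u w. (deriv^^k) (\<lambda>y. h y u w) 0 / fact k)"
  have bnd': "norm (h y u w) \<le> C * norm y ^ W" if "u \<noteq> 0 \<or> w \<noteq> 0" "\<rho> u w \<le> norm y" for y u w
    using that by (intro bnd) (auto simp: \<rho>_def)
  have hexp: "h y u w = (\<Sum>k\<le>W. a k u w * y ^ k)" if "u \<noteq> 0 \<or> w \<noteq> 0" for y u w
    unfolding a_def by (rule Liouville_polynomial[OF hy[OF that] bnd'[OF that]])
  have \<rho>1: "\<rho> u w \<ge> 1" for u w by (simp add: \<rho>_def)
  have abnd: "norm (a k u w) \<le> C * \<rho> u w ^ (W - k)" if uw: "u \<noteq> 0 \<or> w \<noteq> 0" and k: "k \<le> W" for k u w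
  proof -
    have "norm ((deriv^^k) (\<lambda>y. h y u w) 0) \<le> fact k * (C * \<rho> u w ^ W) / \<rho> u w ^ k"
    proof (rule Cauchy_inequality)
      show "(\<lambda>y. h y u w) holomorphic_on ball 0 (\<rho> u w)" "continuous_on (cball 0 (\<rho> u w)) (\<lambda>y. h y u w)"
        using hy[OF uw] by (auto intro: holomorphic_on_subset holomorphic_on_imp_continuous_on)
      show "0 < \<rho> u w" using \<rho>1[of u w] by linarith
      show "norm (h x u w) \<le> C * \<rho> u w ^ W" if "norm (0 - x) = \<rho> u w" for x
        using bnd'[OF uw, of x] that by simp
    qed
    then show ?thesis
      using \<rho>1[of u w] k by (simp add: a_def norm_divide field_simps power_diff)
  qed
  have ahol_u: "(\<lambda>u. a k u w) holomorphic_on UNIV" if "w \<noteq> 0" "k \<le> W" for k w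
  proof (rule coeffs_in_span_of_nodes[where N=UNIV and d=W and a="\<lambda>k u. a k u w"])
    show "(\<lambda>u. \<Sum>k\<le>W. a k u w * s ^ k) holomorphic_on UNIV" for s
      using hu[OF that(1), of s] hexp that(1) by simp
  qed (use that in \<open>auto intro!: holomorphic_intros simp: infinite_UNIV_char_0\<close>)
  have ahol_w: "(\<lambda>w. a k u w) holomorphic_on UNIV" if "u \<noteq> 0" "k \<le> W" for k u
  proof (rule coeffs_in_span_of_nodes[where N=UNIV and d=W and a="\<lambda>k w. a k u w"])
    show "(\<lambda>w. \<Sum>k\<le>W. a k u w * s ^ k) holomorphic_on UNIV" for s
      using hw[OF that(1), of s] hexp that(1) by simp
  qed (use that in \<open>auto intro!: holomorphic_intros simp: infinite_UNIV_char_0\<close>)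
  define b where "b = (\<lambda>k i w. (deriv^^i) (\<lambda>u. a k u w) 0 / fact i)"
  \<comment> \<open>For fixed \<open>w\<close> the radius \<open>\<rho> u w\<close> grows at most
    linearly in \<open>u\<close>, so the bound on \<open>a k\<close> becomes one of degree
    \<open>W - k\<close>.\<close>
  have aexp: "a k u w = (\<Sum>i\<le>W - k. b k i w * u ^ i)" if w: "w \<noteq> 0" and k: "k \<le> W" for k u w
    unfolding b_def
  proof (rule Liouville_polynomial[OF ahol_u[OF w k]])
    fix u :: complex assume u: "max 1 (norm w) \<le> norm u"
    have "1 \<le> norm u" "norm w \<le> norm u" using u by auto
    then have "\<rho> u w \<le> norm u + 2 * norm (u * w)"
      using norm_ge_zero[of "u * w"] unfolding \<rho>_def by (intro max.boundedI; linarith)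
    then have "\<rho> u w \<le> (1 + 2 * norm w) * norm u" by (simp add: norm_mult algebra_simps)
    then have "C * \<rho> u w ^ (W - k) \<le> C * ((1 + 2 * norm w) * norm u) ^ (W - k)"
      using \<rho>1[of u w] C0 by (intro mult_left_mono power_mono) auto
    then show "norm (a k u w) \<le> C * (1 + 2 * norm w) ^ (W - k) * norm u ^ (W - k)"
      using abnd[of u w k] w k by (simp add: power_mult_distrib mult.assoc)
  qed
  \<comment> \<open>The expansion in \<open>u\<close> is available only for
    \<open>w \<noteq> 0\<close>, so the coefficient is compared off 0 with an entire function that
    carries the growth bound.\<close>
  define good where "good = (\<lambda>k f. \<exists>g A B. g holomorphic_on UNIV \<and> (\<forall>w. w \<noteq> 0 \<longrightarrow> f w = g w) \<and>
      (\<forall>w. A \<le> norm w \<longrightarrow> norm (g w) \<le> B * norm (w::complex) ^ (W - k)))"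
  have good_b: "good k (b k i)" if k: "k \<le> W" and i: "i \<le> W - k" for k i
  proof (rule coeffs_in_span_of_nodes[where N="- {0}" and d="W - k" and a="b k"])
    fix f g assume "good k f" "good k g"
    then obtain f1 A1 B1 f2 A2 B2 where
      1: "f1 holomorphic_on UNIV" "\<And>w. w \<noteq> 0 \<Longrightarrow> f w = f1 w" "\<And>w. A1 \<le> norm w \<Longrightarrow> norm (f1 w) \<le> B1 * norm w ^ (W - k)"
      and 2: "f2 holomorphic_on UNIV" "\<And>w. w \<noteq> 0 \<Longrightarrow> g w = f2 w" "\<And>w. A2 \<le> norm w \<Longrightarrow> norm (f2 w) \<le> B2 * norm w ^ (W - k)"
      unfolding good_def by metis
    have "norm (f1 w + f2 w) \<le> (B1 + B2) * norm w ^ (W - k)" if "max A1 A2 \<le> norm w" for w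
      using 1(3)[of w] 2(3)[of w] that norm_triangle_ineq[of "f1 w" "f2 w"] by (simp add: algebra_simps)
    then show "good k (\<lambda>w. f w + g w)"
      unfolding good_def using 1(1,2) 2(1,2)
      by (intro exI[of _ "\<lambda>w. f1 w + f2 w"] exI[of _ "max A1 A2"] exI[of _ "B1 + B2"]) (auto intro!: holomorphic_intros)
  next
    fix c f assume "good k f"
    then obtain f1 A1 B1 where
      1: "f1 holomorphic_on UNIV" "\<And>w. w \<noteq> 0 \<Longrightarrow> f w = f1 w" "\<And>w. A1 \<le> norm w \<Longrightarrow> norm (f1 w) \<le> B1 * norm w ^ (W - k)"
      unfolding good_def by metis
    have "norm (c * f1 w) \<le> (norm c * B1) * norm w ^ (W - k)" if "A1 \<le> norm w" for w
      using mult_left_mono[OF 1(3)[OF that], of "norm c"] by (simp add: norm_mult mult.assoc)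
    then show "good k (\<lambda>w. c * f w)"
      unfolding good_def using 1(1,2)
      by (intro exI[of _ "\<lambda>w. c * f1 w"] exI[of _ A1] exI[of _ "norm c * B1"]) (auto intro!: holomorphic_intros)
  next
    fix u :: complex assume "u \<in> - {0}"
    then have u: "u \<noteq> 0" by simp
    have "norm (a k u w) \<le> C * (1 + 2 * norm u) ^ (W - k) * norm w ^ (W - k)" if w: "max 1 (norm u) \<le> norm w" for w
    proof -
      have "1 \<le> norm w" "norm u \<le> norm w" using w by auto
    then have "\<rho> u w \<le> norm w + 2 * norm (u * w)"
      using norm_ge_zero[of "u * w"] unfolding \<rho>_def by (intro max.boundedI; linarith)
    then have "\<rho> u w \<le> (1 + 2 * norm u) * norm w" by (simp add: norm_mult algebra_simps)
      then have "C * \<rho> u w ^ (W - k) \<le> C * ((1 + 2 * norm u) * norm w) ^ (W - k)"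
        using \<rho>1[of u w] C0 by (intro mult_left_mono power_mono) auto
      then show ?thesis
        using abnd[of u w k] u k by (simp add: power_mult_distrib mult.assoc)
    qed
    then show "good k (\<lambda>w. \<Sum>i\<le>W - k. b k i w * u ^ i)"
      unfolding good_def using ahol_w[OF u k] aexp[OF _ k]
      by (intro exI[of _ "a k u"] exI[of _ "max 1 (norm u)"] exI[of _ "C * (1 + 2 * norm u) ^ (W - k)"]) auto
  qed (use i infinite_nonzero_complex in auto)
  have "\<exists>c. \<forall>w. w \<noteq> 0 \<longrightarrow> b k i w = (\<Sum>j\<le>W - k. c j * w ^ j)" if "k \<le> W" "i \<le> W - k" for k i
  proof -
    obtain g A B where g: "g holomorphic_on UNIV" "\<And>w. w \<noteq> 0 \<Longrightarrow> b k i w = g w"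
      "\<And>w. A \<le> norm w \<Longrightarrow> norm (g w) \<le> B * norm w ^ (W - k)"
      using good_b[OF \<open>k \<le> W\<close> \<open>i \<le> W - k\<close>] unfolding good_def by metis
    show ?thesis
      by (intro exI[of _ "\<lambda>j. (deriv^^j) g 0 / fact j"] allI impI)
         (subst g(2), assumption, rule Liouville_polynomial[OF g(1,3)])
  qed
  then obtain c where c: "\<And>k i w. k \<le> W \<Longrightarrow> i \<le> W - k \<Longrightarrow> w \<noteq> 0 \<Longrightarrow> b k i w = (\<Sum>j\<le>W - k. c k i j * w ^ j)"
    by metis
  define c' where "c' = (\<lambda>k i j. if k \<le> W \<and> i \<le> W - k \<and> j \<le> W - k then c k i j else 0)"
  show ?thesis
  proof (rule that[of c'])
    fix y u w :: complex assume w: "w \<noteq> 0"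
    have "h y u w = (\<Sum>k\<le>W. \<Sum>i\<le>W - k. \<Sum>j\<le>W - k. c k i j * y ^ k * u ^ i * w ^ j)"
      using w by (simp add: hexp aexp c sum_distrib_left sum_distrib_right mult_ac)
    also have "\<dots> = (\<Sum>k\<le>W. \<Sum>i\<le>W. \<Sum>j\<le>W. c' k i j * y ^ k * u ^ i * w ^ j)"
    proof (rule sum.cong[OF refl])
      fix k assume k: "k \<in> {..W}"
      have "(\<Sum>i\<le>W - k. \<Sum>j\<le>W - k. c k i j * y ^ k * u ^ i * w ^ j)
          = (\<Sum>i\<le>W - k. \<Sum>j\<le>W. c' k i j * y ^ k * u ^ i * w ^ j)"
        using k by (intro sum.cong[OF refl] sum.mono_neutral_cong_left) (auto simp: c'_def)
      also have "\<dots> = (\<Sum>i\<le>W. \<Sum>j\<le>W. c' k i j * y ^ k * u ^ i * w ^ j)"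
        by (intro sum.mono_neutral_left) (auto simp: c'_def)
      finally show "(\<Sum>i\<le>W - k. \<Sum>j\<le>W - k. c k i j * y ^ k * u ^ i * w ^ j)
          = (\<Sum>i\<le>W. \<Sum>j\<le>W. c' k i j * y ^ k * u ^ i * w ^ j)" .
    qed
    finally show "h y u w = (\<Sum>k\<le>W. \<Sum>i\<le>W. \<Sum>j\<le>W. c' k i j * y ^ k * u ^ i * w ^ j)" .
  qed (auto simp: c'_def)
qed

section \<open>Regular functions and the 3-form of a 2-form\<close>

text \<open>Holomorphy on a submanifold, tested along holomorphic curves: the curves that matter are
  the coordinate lines of \<open>Phi\<close> and the test curve. Continuity is required besides for
  the compactness and density arguments.\<close>

definition regular_fun :: "(complex^5) set \<Rightarrow> (complex^5 \<Rightarrow> complex) \<Rightarrow> bool" where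
  "regular_fun M g \<longleftrightarrow> continuous_on M g \<and>
     (\<forall>\<gamma> V. open V \<longrightarrow> (\<forall>i. (\<lambda>s. \<gamma> s $ i) holomorphic_on V) \<longrightarrow> \<gamma> ` V \<subseteq> M \<longrightarrow> (\<lambda>s. g (\<gamma> s)) holomorphic_on V)"

lemma regular_fun_add: "regular_fun M f \<Longrightarrow> regular_fun M g \<Longrightarrow> regular_fun M (\<lambda>p. f p + g p)"
  and regular_fun_mult: "regular_fun M f \<Longrightarrow> regular_fun M g \<Longrightarrow> regular_fun M (\<lambda>p. f p * g p)"
  and regular_fun_const: "regular_fun M (\<lambda>p. c)"
  by (auto simp: regular_fun_def intro!: continuous_intros holomorphic_intros)

lemma regular_fun_grad: "regular_fun M (\<lambda>p. grad n p $ i)"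
  using exhaust_5[of i]
  by (elim disjE) (auto simp: grad_simps regular_fun_def intro!: continuous_intros holomorphic_intros)

lemma holomorphic_vec_continuous:
  fixes \<gamma> :: "complex \<Rightarrow> complex^'d"
  assumes "\<And>i. (\<lambda>s. \<gamma> s $ i) holomorphic_on V"
  shows "continuous_on V \<gamma>"
proof -
  have "continuous_on V (\<lambda>s. \<chi> i. \<gamma> s $ i)"
    by (intro continuous_on_vec_lambda holomorphic_on_imp_continuous_on assms)
  then show ?thesis by simp
qed

lemma regular_fun_local:
  assumes loc: "\<And>p. p \<in> M \<Longrightarrow> \<exists>W g. open W \<and> p \<in> W \<and> regular_fun (M \<inter> W) g \<and> (\<forall>q\<in>M \<inter> W. f q = g q)"
  shows "regular_fun M f"
  unfolding regular_fun_def
proof (intro conjI allI impI)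
  show "continuous_on M f"
    unfolding continuous_on_eq_continuous_within
  proof
    fix p assume p: "p \<in> M"
    then obtain W g where W: "open W" "p \<in> W" and g: "regular_fun (M \<inter> W) g" "\<And>q. q \<in> M \<inter> W \<Longrightarrow> f q = g q"
      using loc by metis
    have "continuous_on (M \<inter> W) f"
      using g by (metis continuous_on_eq regular_fun_def)
    then have "continuous (at p within M \<inter> W) f"
      using p W by (simp add: continuous_on_eq_continuous_within)
    moreover have "at p within M \<inter> W = at p within M"
      by (rule at_within_nhd[OF W(2,1)]) auto
    ultimately show "continuous (at p within M) f" by simp
  qed
next
  fix \<gamma> :: "complex \<Rightarrow> complex^5" and V
  assume V: "open V" and \<gamma>: "\<forall>i. (\<lambda>s. \<gamma> s $ i) holomorphic_on V" and im: "\<gamma> ` V \<subseteq> M"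
  show "(\<lambda>s. f (\<gamma> s)) holomorphic_on V"
    unfolding holomorphic_on_def
  proof
    fix s0 assume s0: "s0 \<in> V"
    then obtain W g where W: "open W" "\<gamma> s0 \<in> W" and g: "regular_fun (M \<inter> W) g" "\<And>q. q \<in> M \<inter> W \<Longrightarrow> f q = g q"
      using loc[of "\<gamma> s0"] im by blast
    define V' where "V' = V \<inter> \<gamma> -` W"
    have V': "open V'"
      unfolding V'_def by (rule continuous_open_preimage[OF holomorphic_vec_continuous V W(1)]) (use \<gamma> in auto)
    have "(\<lambda>s. g (\<gamma> s)) holomorphic_on V'"
    proof -
      have "\<gamma> ` V' \<subseteq> M \<inter> W" "\<forall>i. (\<lambda>s. \<gamma> s $ i) holomorphic_on V'"
        using im \<gamma> by (auto simp: V'_def intro: holomorphic_on_subset)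
      then show ?thesis using g(1) V' unfolding regular_fun_def by blast
    qed
    then have "(\<lambda>s. f (\<gamma> s)) holomorphic_on V'"
      by (rule holomorphic_transform) (use g(2) im V'_def in auto)
    then have "(\<lambda>s. f (\<gamma> s)) field_differentiable at s0"
      using V' s0 W by (simp add: holomorphic_on_open field_differentiable_def V'_def)
    then show "(\<lambda>s. f (\<gamma> s)) field_differentiable at s0 within V"
      by (rule field_differentiable_at_within)
  qed
qed

lemma holomorphic_fun_on_compose_curve:
  fixes f :: "complex^'d::finite \<Rightarrow> complex" and \<delta> :: "complex \<Rightarrow> complex^'d"
  assumes f: "holomorphic_fun_on f U" and V: "open V"
    and \<delta>: "\<And>i. (\<lambda>s. \<delta> s $ i) holomorphic_on V" and im: "\<delta> ` V \<subseteq> U"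
  shows "(\<lambda>s. f (\<delta> s)) holomorphic_on V"
proof (rule holomorphic_onI)
  fix s assume s: "s \<in> V"
  define d where "d = (\<lambda>i. deriv (\<lambda>s. \<delta> s $ i) s)"
  have d: "((\<lambda>s. \<delta> s $ i) has_derivative (\<lambda>h. d i * h)) (at s)" for i
    using holomorphic_derivI[OF \<delta> V s, of i] by (simp add: has_field_derivative_def d_def)
  have "((\<lambda>s. \<Sum>i\<in>UNIV. axis i (\<delta> s $ i)) has_derivative (\<lambda>h. \<Sum>i\<in>UNIV. axis i (d i * h))) (at s)"
    by (intro has_derivative_sum bounded_linear.has_derivative[OF bounded_linear_axis] d)
  then have "(\<delta> has_derivative (\<lambda>h. \<Sum>i\<in>UNIV. axis i (d i * h))) (at s)"
    by (simp add: vec_eq_sum_axis[symmetric])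
  from has_derivative_compose[OF this holomorphic_fun_on_has_derivative[OF f]] im s
  have "((\<lambda>s. f (\<delta> s)) has_derivative
     (\<lambda>h. \<Sum>j\<in>UNIV. (\<Sum>i\<in>UNIV. axis i (d i * h)) $ j * partial_deriv j f (\<delta> s))) (at s)" by blast
  moreover have "(\<lambda>h. \<Sum>j\<in>UNIV. (\<Sum>i\<in>UNIV. axis i (d i * h)) $ j * partial_deriv j f (\<delta> s)) =
      (*) (\<Sum>j\<in>UNIV. d j * partial_deriv j f (\<delta> s))"
    by (simp add: fun_eq_iff axis_def sum_component sum_distrib_left sum_distrib_right mult_ac)
  ultimately have "((\<lambda>s. f (\<delta> s)) has_field_derivative (\<Sum>j\<in>UNIV. d j * partial_deriv j f (\<delta> s))) (at s)"
    by (simp add: has_field_derivative_def)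
  then show "(\<lambda>s. f (\<delta> s)) field_differentiable at s within V"
    using field_differentiable_at_within field_differentiable_def by blast
qed

text \<open>For \<open>dX n p N = 1\<close> this is the projection onto the tangent space along
  \<open>N\<close>; through it a form known only on tangent vectors can be evaluated on ambient
  ones.\<close>

definition tangent_proj :: "nat \<Rightarrow> complex^5 \<Rightarrow> complex^5 \<Rightarrow> complex^5 \<Rightarrow> complex^5" where
  "tangent_proj n p N u = u - dX n p u *s N"

definition wedge_dX :: "nat \<Rightarrow> 5 form2 \<Rightarrow> complex^5 \<Rightarrow> complex^5 \<Rightarrow> complex^5 \<Rightarrow> complex^5 \<Rightarrow> complex^5 \<Rightarrow> complex" where
  "wedge_dX n \<omega> N p u v w =
     \<omega> p (tangent_proj n p N u) (tangent_proj n p N v) * dX n p w +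
     \<omega> p (tangent_proj n p N v) (tangent_proj n p N w) * dX n p u +
     \<omega> p (tangent_proj n p N w) (tangent_proj n p N u) * dX n p v"

lemma tangent_proj_in: "dX n p N = 1 \<Longrightarrow> tangent_proj n p N u \<in> X_tangent n p"
  by (simp add: X_tangent_iff tangent_proj_def dX_diff dX_scale)

lemma tangent_diff: "u \<in> X_tangent n p \<Longrightarrow> v \<in> X_tangent n p \<Longrightarrow> u - v \<in> X_tangent n p"
  and tangent_add: "u \<in> X_tangent n p \<Longrightarrow> v \<in> X_tangent n p \<Longrightarrow> u + v \<in> X_tangent n p"
  and tangent_scale: "u \<in> X_tangent n p \<Longrightarrow> c *s u \<in> X_tangent n p"
  by (simp_all add: X_tangent_iff dX_diff dX_add dX_scale)

context
  fixes n :: nat and p :: "complex^5" and \<omega> :: "5 form2"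
  assumes alt: "alternating_bilinear_on (X_tangent n p) (\<omega> p)"
begin

lemma form_add_left: "u \<in> X_tangent n p \<Longrightarrow> v \<in> X_tangent n p \<Longrightarrow> w \<in> X_tangent n p \<Longrightarrow> \<omega> p (u + v) w = \<omega> p u w + \<omega> p v w"
  and form_add_right: "u \<in> X_tangent n p \<Longrightarrow> v \<in> X_tangent n p \<Longrightarrow> w \<in> X_tangent n p \<Longrightarrow> \<omega> p w (u + v) = \<omega> p w u + \<omega> p w v"
  and form_scale_left: "u \<in> X_tangent n p \<Longrightarrow> v \<in> X_tangent n p \<Longrightarrow> \<omega> p (c *s u) v = c * \<omega> p u v"
  and form_scale_right: "u \<in> X_tangent n p \<Longrightarrow> v \<in> X_tangent n p \<Longrightarrow> \<omega> p u (c *s v) = c * \<omega> p u v"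
  and form_self: "u \<in> X_tangent n p \<Longrightarrow> \<omega> p u u = 0"
  using alt unfolding alternating_bilinear_on_def by blast+

lemma form_diff_left: "u \<in> X_tangent n p \<Longrightarrow> v \<in> X_tangent n p \<Longrightarrow> w \<in> X_tangent n p \<Longrightarrow> \<omega> p (u - v) w = \<omega> p u w - \<omega> p v w"
  using form_add_left[of u "(-1) *s v" w] form_scale_left[of v w "-1"] tangent_scale[of v n p "-1"] by simp

lemma form_diff_right: "u \<in> X_tangent n p \<Longrightarrow> v \<in> X_tangent n p \<Longrightarrow> w \<in> X_tangent n p \<Longrightarrow> \<omega> p w (u - v) = \<omega> p w u - \<omega> p w v"
  using form_add_right[of u "(-1) *s v" w] form_scale_right[of w v "-1"] tangent_scale[of v n p "-1"] by simp

lemma form_anti: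
  assumes "u \<in> X_tangent n p" "v \<in> X_tangent n p"
  shows "\<omega> p v u = - \<omega> p u v"
  using form_self[OF tangent_add[OF assms]] form_add_left[OF assms tangent_add[OF assms]]
    form_add_right[OF assms assms(1)] form_add_right[OF assms assms(2)] form_self[OF assms(1)] form_self[OF assms(2)]
  by (simp add: eq_neg_iff_add_eq_0 add.commute)

text \<open>Two normals differ by a tangent vector \<open>k\<close>. The correction to the form on
  projected vectors consists of terms with a factor \<open>dX n p u\<close> or
  \<open>dX n p v\<close>, and these cancel in the cyclic sum.\<close>

lemma wedge_dX_independent:
  assumes N: "dX n p N = 1" "dX n p N' = 1"
  shows "wedge_dX n \<omega> N' p u v w = wedge_dX n \<omega> N p u v w"
proof -
  define k where "k = N' - N"
  have k: "k \<in> X_tangent n p" using N by (simp add: k_def X_tangent_iff dX_diff)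
  have proj: "tangent_proj n p N' u = tangent_proj n p N u - dX n p u *s k" for u
    by (simp add: tangent_proj_def k_def vec_eq_iff algebra_simps)
  note T = tangent_proj_in[OF N(1)]
  have "\<omega> p (tangent_proj n p N' u) (tangent_proj n p N' v) =
      \<omega> p (tangent_proj n p N u) (tangent_proj n p N v)
      - dX n p v * \<omega> p (tangent_proj n p N u) k + dX n p u * \<omega> p (tangent_proj n p N v) k" for u v
    unfolding proj using T k form_anti[OF T[of v] k] form_self[OF k]
    by (simp add: form_diff_left form_diff_right form_scale_left form_scale_right tangent_diff tangent_scale)
  then show ?thesis unfolding wedge_dX_def by (simp only:) (simp add: algebra_simps)
qed

text \<open>Inserting the normal recovers the form, so nothing is lost by passing to the
  3-form.\<close>

lemma wedge_dX_normal:
  assumes N: "dX n p N = 1" and u: "u \<in> X_tangent n p" and v: "v \<in> X_tangent n p"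
  shows "wedge_dX n \<omega> N p u v N = \<omega> p u v"
  using assms by (simp add: wedge_dX_def X_tangent_iff tangent_proj_def)

lemma wedge_dX_anti:
  assumes N: "dX n p N = 1"
  shows "wedge_dX n \<omega> N p v u w = - wedge_dX n \<omega> N p u v w"
  unfolding wedge_dX_def
  using form_anti[OF tangent_proj_in[OF N] tangent_proj_in[OF N], of u v]
    form_anti[OF tangent_proj_in[OF N] tangent_proj_in[OF N], of u w]
    form_anti[OF tangent_proj_in[OF N] tangent_proj_in[OF N], of v w]
  by (simp add: algebra_simps)

lemma wedge_dX_cyclic: "wedge_dX n \<omega> N p u v w = wedge_dX n \<omega> N p v w u"
  by (simp add: wedge_dX_def)

lemma wedge_dX_add:
  assumes N: "dX n p N = 1"
  shows "wedge_dX n \<omega> N p u v (w + w') = wedge_dX n \<omega> N p u v w + wedge_dX n \<omega> N p u v w'"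
proof -
  have "tangent_proj n p N (w + w') = tangent_proj n p N w + tangent_proj n p N w'"
    by (simp add: tangent_proj_def dX_add vec_eq_iff algebra_simps)
  then show ?thesis
    using tangent_proj_in[OF N] by (simp add: wedge_dX_def dX_add form_add_left form_add_right algebra_simps)
qed

lemma wedge_dX_scale:
  assumes N: "dX n p N = 1"
  shows "wedge_dX n \<omega> N p u v (c *s w) = c * wedge_dX n \<omega> N p u v w"
proof -
  have "tangent_proj n p N (c *s w) = c *s tangent_proj n p N w"
    by (simp add: tangent_proj_def dX_scale vec_eq_iff algebra_simps)
  then show ?thesis
    using tangent_proj_in[OF N] by (simp add: wedge_dX_def dX_scale form_scale_left form_scale_right algebra_simps)
qed

lemma wedge_dX_expand:
  assumes N: "dX n p N = 1"
  shows "wedge_dX n \<omega> N p u v w = (\<Sum>m\<in>UNIV. w $ m * wedge_dX n \<omega> N p u v (axis m 1))"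
proof -
  have w: "w = (\<Sum>m\<in>UNIV. (w $ m) *s axis m 1)"
    by (subst vec_eq_sum_axis[of w]) (simp add: axis_scale[symmetric])
  have z: "wedge_dX n \<omega> N p u v 0 = 0"
    using wedge_dX_scale[OF N, of u v 0 0] by simp
  have "wedge_dX n \<omega> N p u v (\<Sum>m\<in>S. (w $ m) *s axis m 1) = (\<Sum>m\<in>S. w $ m * wedge_dX n \<omega> N p u v (axis m 1))" for S
    by (induction S rule: infinite_finite_induct) (simp_all add: z wedge_dX_add[OF N] wedge_dX_scale[OF N])
  then show ?thesis by (subst w)
qed

text \<open>The vanishing of dX wedge (omega wedge dX), evaluated on four vectors. For the dual
  bivector this is tangency to the hypersurface.\<close>

lemma wedge_dX_relation:
  assumes N: "dX n p N = 1"
  shows "dX n p a * wedge_dX n \<omega> N p b c d - dX n p b * wedge_dX n \<omega> N p a c d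
    + dX n p c * wedge_dX n \<omega> N p a b d - dX n p d * wedge_dX n \<omega> N p a b c = 0"
  unfolding wedge_dX_def
  using form_anti[OF tangent_proj_in[OF N] tangent_proj_in[OF N], of a b]
    form_anti[OF tangent_proj_in[OF N] tangent_proj_in[OF N], of a c]
    form_anti[OF tangent_proj_in[OF N] tangent_proj_in[OF N], of a d]
    form_anti[OF tangent_proj_in[OF N] tangent_proj_in[OF N], of b c]
    form_anti[OF tangent_proj_in[OF N] tangent_proj_in[OF N], of b d]
    form_anti[OF tangent_proj_in[OF N] tangent_proj_in[OF N], of c d]
  by (simp add: algebra_simps)

end

text \<open>The components of the 3-form \<open>\<omega> \<and> dX\<close>, which does not depend on how \<open>\<omega>\<close> is extended from the
  tangent spaces to the ambient space; the unit normal only serves to write down one extension.\<close>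

definition wedge_coeff :: "nat \<Rightarrow> 5 form2 \<Rightarrow> 5 \<Rightarrow> 5 \<Rightarrow> 5 \<Rightarrow> complex^5 \<Rightarrow> complex" where
  "wedge_coeff n \<omega> k l m p =
     wedge_dX n \<omega> (SOME N. dX n p N = 1) p (axis k 1) (axis l 1) (axis m 1)"

lemma dX_axis_normal: "grad n p $ r \<noteq> 0 \<Longrightarrow> dX n p (axis r (1 / grad n p $ r)) = 1"
  by (simp add: dX_axis)

lemma wedge_coeff_eq:
  assumes "alternating_bilinear_on (X_tangent n p) (\<omega> p)" "dX n p N = 1"
  shows "wedge_coeff n \<omega> k l m p = wedge_dX n \<omega> N p (axis k 1) (axis l 1) (axis m 1)"
proof -
  have "dX n p (SOME N. dX n p N = 1) = 1" using assms(2) by (rule someI)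
  then show ?thesis
    unfolding wedge_coeff_def by (intro wedge_dX_independent[where \<omega>=\<omega>, OF assms(1)]) (use assms in auto)
qed

text \<open>In the chart that omits coordinate \<open>r\<close>, take the normal along
  \<open>axis r\<close>. The projection of \<open>axis r 1\<close> is 0 and those of the other basis
  vectors are the coordinate fields of the chart, so the component is a polynomial in chart
  coefficients of the form and components of the gradient.\<close>

lemma wedge_coeff_regular:
  assumes n: "n \<ge> 2" and \<omega>: "holomorphic_2form n \<omega>"
  shows "regular_fun (X_reg n) (wedge_coeff n \<omega> k l m)"
proof (rule regular_fun_local)
  fix p assume p: "p \<in> X_reg n"
  obtain r where r: "grad n p $ r \<noteq> 0" using X_regE[OF n p] .
  have "\<exists>e :: 4 \<Rightarrow> 5. bij_betw e UNIV (UNIV - {r})"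
    by (rule finite_same_card_bij) (simp_all add: card_Diff_singleton)
  then obtain e :: "4 \<Rightarrow> 5" where e: "bij_betw e UNIV (UNIV - {r})" by blast
  from graph_chart[OF n p r e] obtain U \<phi> W where W: "open W" "p \<in> W"
    and par: "holomorphic_parametrization (X_reg n) U \<phi>"
    and pr: "\<And>q. q \<in> X_reg n \<Longrightarrow> q \<in> W \<Longrightarrow> (\<chi> j. q $ e j) \<in> U \<and> \<phi> (\<chi> j. q $ e j) = q"
    and gr: "\<And>q. q \<in> W \<Longrightarrow> grad n q $ r \<noteq> 0"
    and fr: "\<And>\<zeta> j. \<zeta> \<in> U \<Longrightarrow> frechet_derivative \<phi> (at \<zeta>) (axis j 1) =
       axis (e j) 1 - axis r (grad n (\<phi> \<zeta>) $ e j / grad n (\<phi> \<zeta>) $ r)" by metis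
  have holf: "holomorphic_fun_on (form_coeff (pullback \<phi> \<omega>) i j) U" for i j
    using \<omega> par unfolding holomorphic_2form_def holomorphic_form_on_def by blast
  have alt: "alternating_bilinear_on (X_tangent n q) (\<omega> q)" if "q \<in> X_reg n" for q
    using \<omega> that unfolding holomorphic_2form_def by blast
  define e' where "e' = inv_into UNIV e"
  have ee': "i \<noteq> r \<Longrightarrow> e (e' i) = i" for i
    using e by (auto simp: bij_betw_def e'_def intro!: f_inv_into_f)
  define c where "c = (\<lambda>i j q. if i = r \<or> j = r then 0 else form_coeff (pullback \<phi> \<omega>) (e' i) (e' j) (\<chi> j. q $ e j))"
  have creg: "regular_fun (X_reg n \<inter> W) (c i j)" for i j
  proof (cases "i = r \<or> j = r")
    case True
    then have "c i j = (\<lambda>q. 0)" by (auto simp: c_def)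
    then show ?thesis by (simp add: regular_fun_const)
  next
    case False
    then have c: "c i j = (\<lambda>q. form_coeff (pullback \<phi> \<omega>) (e' i) (e' j) (\<chi> j. q $ e j))" by (auto simp: c_def)
    show ?thesis
      unfolding c regular_fun_def
    proof (intro conjI allI impI)
      show "continuous_on (X_reg n \<inter> W) (\<lambda>q. form_coeff (pullback \<phi> \<omega>) (e' i) (e' j) (\<chi> j. q $ e j))"
        by (intro continuous_on_compose2[OF holomorphic_fun_on_continuous[OF holf]] continuous_intros) (use pr in auto)
    next
      fix \<gamma> :: "complex \<Rightarrow> complex^5" and V
      assume a: "open V" "\<forall>i. (\<lambda>s. \<gamma> s $ i) holomorphic_on V" "\<gamma> ` V \<subseteq> X_reg n \<inter> W"
      then have "\<And>s. s \<in> V \<Longrightarrow> \<gamma> s \<in> X_reg n \<and> \<gamma> s \<in> W" by auto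
      with a(1,2) show "(\<lambda>s. form_coeff (pullback \<phi> \<omega>) (e' i) (e' j) (\<chi> j. \<gamma> s $ e j)) holomorphic_on V"
        by (intro holomorphic_fun_on_compose_curve[OF holf]) (use pr in auto)
    qed
  qed
  define g where "g = (\<lambda>q. c k l q * grad n q $ m + c l m q * grad n q $ k + c m k q * grad n q $ l)"
  have "regular_fun (X_reg n \<inter> W) g"
    unfolding g_def by (intro regular_fun_add regular_fun_mult creg regular_fun_grad)
  moreover have "wedge_coeff n \<omega> k l m q = g q" if q: "q \<in> X_reg n \<inter> W" for q
  proof -
    define N where "N = axis r (1 / grad n q $ r)"
    have N: "dX n q N = 1" unfolding N_def by (rule dX_axis_normal) (use gr q in auto)
    have pr0: "tangent_proj n q N (axis r 1) = 0"
      using gr[of q] q by (simp add: tangent_proj_def N_def dX_axis) (simp add: vec_eq_iff axis_def)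
    have pr1: "tangent_proj n q N (axis i 1) = frechet_derivative \<phi> (at (\<chi> j. q $ e j)) (axis (e' i) 1)" if "i \<noteq> r" for i
    proof -
      have "tangent_proj n q N (axis i 1) = axis i 1 - axis r (grad n q $ i / grad n q $ r)"
        by (simp add: tangent_proj_def N_def dX_axis) (simp add: vec_eq_iff axis_def)
      also have "\<dots> = frechet_derivative \<phi> (at (\<chi> j. q $ e j)) (axis (e' i) 1)"
        using pr[of q] q fr[of "\<chi> j. q $ e j" "e' i"] ee'[OF that] by auto
      finally show ?thesis .
    qed
    have z: "\<omega> q 0 v = 0" "\<omega> q v 0 = 0" if "v \<in> X_tangent n q" for v
      using form_scale_left[where \<omega>=\<omega> and c=0, OF alt that that] form_scale_right[where \<omega>=\<omega> and c=0, OF alt that that] q by auto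
    have "\<omega> q (tangent_proj n q N (axis i 1)) (tangent_proj n q N (axis j 1)) = c i j q" for i j
      using z[OF tangent_proj_in[OF N]] pr[of q] q
      by (auto simp: c_def pr0 pr1 form_coeff_def pullback_def)
    then show ?thesis
      using q by (simp add: wedge_coeff_eq[where \<omega>=\<omega>, OF alt N] wedge_dX_def g_def dX_axis)
  qed
  ultimately show "\<exists>W g. open W \<and> p \<in> W \<and> regular_fun (X_reg n \<inter> W) g \<and> (\<forall>q\<in>X_reg n \<inter> W. wedge_coeff n \<omega> k l m q = g q)"
    using W by blast
qed

section \<open>Weights under the action of the multiplicative group\<close>

lemma X_weight_simps:
  "X_weight n 1 = 2 * n - 1" "X_weight n 2 = 2 * n - 1" "X_weight n 3 = 2" "X_weight n 4 = 2" "X_weight n 5 = 2"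
  by (simp_all add: X_weight_def)

lemma X_action_simps:
  "X_action n t p $ 1 = t ^ (2 * n - 1) * p $ 1" "X_action n t p $ 2 = t ^ (2 * n - 1) * p $ 2"
  "X_action n t p $ 3 = t ^ 2 * p $ 3" "X_action n t p $ 4 = t ^ 2 * p $ 4" "X_action n t p $ 5 = t ^ 2 * p $ 5"
  by (simp_all add: X_action_def X_weight_def)

lemma X_eq_action:
  assumes "n \<ge> 2"
  shows "X_eq n (X_action n t p) = t ^ (4 * n) * X_eq n p"
proof -
  obtain m where m: "n = Suc m" using assms by (cases n) auto
  have 1: "t ^ (2 * n - 1) = (t ^ m)^2 * t" "t ^ (4 * n) = (t ^ m)^4 * t^4"
    by (simp_all add: m power_add power_mult[symmetric] mult.commute)
  have 2: "((t^2 * x) * (t^2 * z) - (t^2 * y)^2) ^ n = (t ^ m)^4 * t^4 * (x * z - y^2) ^ n" for x y z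
  proof -
    have "(t^2 * x) * (t^2 * z) - (t^2 * y)^2 = t^4 * (x * z - y^2)" by algebra
    then show ?thesis using 1(2) by (simp add: power_mult_distrib power_mult[symmetric])
  qed
  show ?thesis
    unfolding X_eq_def Let_def X_action_simps 1 2 by algebra
qed

lemma grad_action:
  assumes "n \<ge> 2"
  shows "t ^ X_weight n i * grad n (X_action n t p) $ i = t ^ (4 * n) * grad n p $ i"
proof -
  obtain m where m: "n = Suc m" using assms by (cases n) auto
  have 1: "t ^ (2 * n - 1) = (t ^ m)^2 * t" "t ^ (4 * n) = (t ^ m)^4 * t^4"
    by (simp_all add: m power_add power_mult[symmetric] mult.commute)
  have 2: "((t^2 * x) * (t^2 * z) - (t^2 * y)^2) ^ (n - 1) = (t ^ m)^4 * (x * z - y^2) ^ (n - 1)" for x y z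
  proof -
    have "(t^2 * x) * (t^2 * z) - (t^2 * y)^2 = t^4 * (x * z - y^2)" by algebra
    then show ?thesis by (simp add: power_mult_distrib power_mult[symmetric] m mult.commute)
  qed
  show ?thesis
    using exhaust_5[of i]
    by (elim disjE; simp only: X_weight_simps grad_simps X_action_simps 1 2; simp add: algebra_simps power2_eq_square power4_eq_xxxx)
qed

lemma X_reg_action:
  assumes "n \<ge> 2" "t \<noteq> 0" "p \<in> X_reg n"
  shows "X_action n t p \<in> X_reg n"
  using assms by (simp add: X_reg_iff X_eq_action X_action_simps)

lemma dX_action:
  assumes "n \<ge> 2"
  shows "dX n (X_action n t p) (X_action n t v) = t ^ (4 * n) * dX n p v"
  unfolding dX_def sum_distrib_left
proof (rule sum.cong[OF refl])
  fix i
  show "X_action n t v $ i * grad n (X_action n t p) $ i = t ^ (4 * n) * (v $ i * grad n p $ i)"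
    using grad_action[OF assms, of t i p] by (simp add: X_action_def)
qed

lemma frechet_X_action: "frechet_derivative (X_action n t) (at p) = X_action n t"
proof -
  have "linear (X_action n t)"
    by (rule linearI) (auto simp: X_action_def vec_eq_iff algebra_simps)
  then have "bounded_linear (X_action n t)" by (simp add: linear_conv_bounded_linear)
  then show ?thesis
    using frechet_derivative_at[OF bounded_linear_imp_has_derivative] by metis
qed

text \<open>The differential of the equation has weight 4n and the form weight 2; evaluation on
  three basis vectors takes off their weights. The hypothesis on \<open>W\<close> is additive to
  avoid truncated subtraction.\<close>

lemma wedge_coeff_action:
  assumes n: "n \<ge> 2" and \<omega>: "holomorphic_2form n \<omega>" "has_weight n \<omega> 2" and t: "t \<noteq> 0" and p: "p \<in> X_reg n"
    and W: "W + (X_weight n k + X_weight n l + X_weight n m) = 4 * n + 2"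
  shows "wedge_coeff n \<omega> k l m (X_action n t p) = t ^ W * wedge_coeff n \<omega> k l m p"
proof -
  let ?A = "X_action n t"
  obtain r where r: "grad n p $ r \<noteq> 0" using X_regE[OF n p] .
  define N where "N = axis r (1 / grad n p $ r)"
  have N: "dX n p N = 1" unfolding N_def by (rule dX_axis_normal[OF r])
  define N' where "N' = (1 / t ^ (4 * n)) *s ?A N"
  have N': "dX n (?A p) N' = 1" using t by (simp add: N'_def dX_scale dX_action[OF n] N)
  have alt: "alternating_bilinear_on (X_tangent n q) (\<omega> q)" if "q \<in> X_reg n" for q
    using \<omega> that unfolding holomorphic_2form_def by blast
  note pA = X_reg_action[OF n t p]
  have proj: "tangent_proj n (?A p) N' (?A u) = ?A (tangent_proj n p N u)" for u
    using t by (simp add: tangent_proj_def N'_def dX_action[OF n]) (simp add: X_action_def vec_eq_iff algebra_simps)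
  have "\<omega> (?A p) (?A u) (?A v) = t^2 * \<omega> p u v" if "u \<in> X_tangent n p" "v \<in> X_tangent n p" for u v
    using \<omega>(2) t p that unfolding has_weight_def pullback_def frechet_X_action by simp
  then have "wedge_dX n \<omega> N' (?A p) (?A u) (?A v) (?A w) = t ^ (4 * n + 2) * wedge_dX n \<omega> N p u v w" for u v w
    using tangent_proj_in[OF N] by (simp add: wedge_dX_def proj dX_action[OF n] algebra_simps power_add power2_eq_square)
  from this[of "axis k 1" "axis l 1" "axis m 1"]
  have 1: "wedge_dX n \<omega> N' (?A p) (?A (axis k 1)) (?A (axis l 1)) (?A (axis m 1)) = t ^ (4 * n + 2) * wedge_coeff n \<omega> k l m p"
    by (simp add: wedge_coeff_eq[where \<omega>=\<omega>, OF alt[OF p] N])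
  have ax: "?A (axis i 1) = t ^ X_weight n i *s axis i 1" for i
    by (simp add: X_action_def vec_eq_iff axis_def)
  note sc = wedge_dX_scale[where \<omega>=\<omega>, OF alt[OF pA] N'] and cyc = wedge_dX_cyclic[where \<omega>=\<omega>, OF alt[OF pA]]
  \<comment> \<open>Cyclic rotation brings each argument in turn to the third place, where scaling
    is known.\<close>
  have tri: "wedge_dX n \<omega> N' (?A p) (a *s u) (b *s v) (c *s w) = a * b * c * wedge_dX n \<omega> N' (?A p) u v w" for a b c u v w
    by (subst sc, subst cyc, subst sc, subst cyc, subst sc, subst cyc) (simp add: mult_ac)
  have "wedge_dX n \<omega> N' (?A p) (?A (axis k 1)) (?A (axis l 1)) (?A (axis m 1))
      = t ^ (X_weight n k + X_weight n l + X_weight n m) * wedge_coeff n \<omega> k l m (?A p)"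
    unfolding ax wedge_coeff_eq[where \<omega>=\<omega>, OF alt[OF pA] N'] tri by (simp add: power_add)
  with 1 have "t ^ (X_weight n k + X_weight n l + X_weight n m) * wedge_coeff n \<omega> k l m (?A p)
     = t ^ (X_weight n k + X_weight n l + X_weight n m) * (t ^ W * wedge_coeff n \<omega> k l m p)"
    unfolding W[symmetric] by (simp add: power_add)
  then show ?thesis using t by simp
qed

section \<open>Growth of weighted regular functions\<close>

text \<open>On the slice \<open>x = 1\<close> put \<open>c = a + by\<close> and \<open>q = z - y\<^sup>2\<close>: the equation becomes \<open>c\<^sup>2 + q b\<^sup>2 + q\<^sup>n = 0\<close>,
  the quotient of the \<open>(u, w)\<close>-plane by a binary dihedral group.\<close>

definition Phi :: "nat \<Rightarrow> complex \<Rightarrow> complex \<Rightarrow> complex \<Rightarrow> complex^5" where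
  "Phi n y u w = (\<chi> i.
     if i = 1 then \<i> * u * w * (u ^ (2 * (n - 1)) + w ^ (2 * (n - 1))) / 2 - (w ^ (2 * (n - 1)) - u ^ (2 * (n - 1))) / 2 * y
     else if i = 2 then (w ^ (2 * (n - 1)) - u ^ (2 * (n - 1))) / 2
     else if i = 3 then 1 else if i = 4 then y else u^2 * w^2 + y^2)"

lemma Phi_simps:
  "Phi n y u w $ 1 = \<i> * u * w * (u ^ (2 * (n - 1)) + w ^ (2 * (n - 1))) / 2 - (w ^ (2 * (n - 1)) - u ^ (2 * (n - 1))) / 2 * y"
  "Phi n y u w $ 2 = (w ^ (2 * (n - 1)) - u ^ (2 * (n - 1))) / 2"
  "Phi n y u w $ 3 = 1" "Phi n y u w $ 4 = y" "Phi n y u w $ 5 = u^2 * w^2 + y^2"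
  by (simp_all add: Phi_def)

lemma X_eq_Phi:
  assumes "n \<ge> 2"
  shows "X_eq n (Phi n y u w) = 0"
proof -
  have 1: "(1 * (u^2 * w^2 + y^2) - y^2) ^ n = u^2 * w^2 * u ^ (2 * (n - 1)) * w ^ (2 * (n - 1))"
  proof -
    have "(u^2 * w^2) ^ n = (u^2 * w^2) * (u^2 * w^2) ^ (n - 1)"
      using assms by (simp add: power_eq_if)
    then show ?thesis by (simp add: power_mult_distrib power_mult)
  qed
  have "\<i> * \<i> = (-1::complex)" by simp
  then show ?thesis
    unfolding X_eq_def Let_def Phi_simps 1
    by (simp add: field_simps power2_eq_square)
qed

lemma Phi_in_X_reg:
  assumes n: "n \<ge> 2" and uw: "u \<noteq> 0 \<or> w \<noteq> 0"
  shows "Phi n y u w \<in> X_reg n"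
proof -
  have "Phi n y u w $ 1 \<noteq> 0 \<or> Phi n y u w $ 2 \<noteq> 0"
  proof (rule ccontr)
    assume "\<not> ?thesis"
    then have ab: "Phi n y u w $ 1 = 0" "Phi n y u w $ 2 = 0" by auto
    then have e: "w ^ (2 * (n - 1)) = u ^ (2 * (n - 1))" by (simp add: Phi_simps)
    with ab(1) have "u * w * u ^ (2 * (n - 1)) = 0" by (simp add: Phi_simps)
    then have "u = 0 \<or> w = 0" by auto
    moreover have "2 * (n - 1) > 0" using n by simp
    ultimately show False using e uw by (auto simp: zero_power)
  qed
  then show ?thesis using X_eq_Phi[OF n] by (simp add: X_reg_iff[OF n])
qed

text \<open>With E^2 = - q the left part factors as (c - E b) (c + E b). Dividing both factors by E
  gives \<open>U\<close> and \<open>V\<close> with product q^(n - 1), which are to be the 2(n -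
  1)-th powers of \<open>u\<close> and \<open>w\<close>.\<close>

lemma uniformize_D:
  fixes b c q :: complex
  assumes n: "n \<ge> 2" and eq: "c^2 + q * b^2 + q ^ n = 0"
  obtains u w where "b = (w ^ (2 * (n - 1)) - u ^ (2 * (n - 1))) / 2"
    "c = \<i> * u * w * (u ^ (2 * (n - 1)) + w ^ (2 * (n - 1))) / 2" "q = u^2 * w^2"
proof (cases "q = 0")
  case True
  \<comment> \<open>For \<open>q = 0\<close> the equation gives \<open>c = 0\<close>; then
    \<open>u = 0\<close> is taken and \<open>w\<close> is fitted to \<open>b\<close>.\<close>
  obtain w where w: "2 * b = w ^ (2 * (n - 1))"
    using exists_complex_root[of "2 * (n - 1)" "2 * b"] n by auto
  have "c = 0" using eq True n by (simp add: zero_power)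
  then show ?thesis using that[of w 0] w True n by (simp add: field_simps zero_power)
next
  case False
  define E where "E = csqrt (- q)"
  have E2: "E^2 = - q" by (simp add: E_def)
  then have E0: "E \<noteq> 0" using False by auto
  define U where "U = (c - E * b) / E"
  define V where "V = (c + E * b) / E"
  have "U * V = (c^2 - E^2 * b^2) / E^2" by (simp add: U_def V_def field_simps power2_eq_square)
  also have "\<dots> = q ^ (n - 1)"
  proof -
    have "q ^ n = q * q ^ (n - 1)" using n by (simp add: power_eq_if)
    then have "c^2 + q * b^2 = - q * q ^ (n - 1)" using eq by (simp add: eq_neg_iff_add_eq_0)
    then show ?thesis using False by (simp add: E2 field_simps)
  qed
  finally have UV: "U * V = q ^ (n - 1)" .
  then have U0: "U \<noteq> 0" using False by auto
  obtain u where u: "U = u ^ (2 * (n - 1))"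
    using exists_complex_root[of "2 * (n - 1)" U] n by auto
  have u0: "u \<noteq> 0" using U0 u n by auto
  \<comment> \<open>\<open>u\<close> is a free choice of root, whereas \<open>w\<close> is dictated
    by \<open>\<i> * u * w = E\<close>; that \<open>V\<close> is the right power of \<open>w\<close>
    then follows from the product of \<open>U\<close> and \<open>V\<close>.\<close>
  define w where "w = E / (\<i> * u)"
  have iuw: "\<i> * u * w = E" using u0 by (simp add: w_def)
  have uw2: "q = u^2 * w^2"
  proof -
    have "(\<i> * u * w)^2 = - q" by (simp add: iuw E2)
    then show ?thesis by (simp add: power_mult_distrib)
  qed
  have "u ^ (2 * (n - 1)) * w ^ (2 * (n - 1)) = U * V"
    unfolding UV uw2 by (simp add: power_mult power_mult_distrib)
  then have "U * w ^ (2 * (n - 1)) = U * V" by (simp only: u[symmetric])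
  then have V: "V = w ^ (2 * (n - 1))" using U0 by (simp only: mult_cancel_left) simp
  show ?thesis
  proof (rule that[of w u])
    show "b = (w ^ (2 * (n - 1)) - u ^ (2 * (n - 1))) / 2"
      unfolding u[symmetric] V[symmetric] using E0 by (simp add: U_def V_def field_simps)
    show "c = \<i> * u * w * (u ^ (2 * (n - 1)) + w ^ (2 * (n - 1))) / 2"
      unfolding u[symmetric] V[symmetric] iuw using E0 by (simp add: U_def V_def field_simps)
  qed fact
qed

text \<open>A square root of x scales the point to the slice x = 1, where
  \<open>uniformize_D\<close> applies.\<close>

lemma X_param:
  fixes p :: "complex^5"
  assumes n: "n \<ge> 2" and p: "X_eq n p = 0" and x: "p $ 3 \<noteq> 0"
  obtains t y u w where "t \<noteq> 0" "t^2 = p $ 3" "p = X_action n t (Phi n y u w)"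
proof -
  define t where "t = csqrt (p $ 3)"
  have t: "t \<noteq> 0" "t^2 = p $ 3" using x by (simp_all add: t_def)
  define p' where "p' = X_action n (1 / t) p"
  have pp': "p = X_action n t p'"
    using t(1) by (simp add: p'_def X_action_def vec_eq_iff power_mult_distrib[symmetric] mult.assoc[symmetric])
  have p'0: "X_eq n p' = 0" by (simp add: p'_def X_eq_action[OF n] p)
  have p'3: "p' $ 3 = 1" using t x by (simp add: p'_def X_action_simps power_one_over)
  define q where "q = p' $ 5 - (p' $ 4)^2"
  have "(p' $ 1 + p' $ 2 * p' $ 4)^2 + q * (p' $ 2)^2 + q ^ n = 0"
    using p'0 unfolding X_eq_def Let_def p'3 q_def by (simp add: algebra_simps power2_eq_square)
  from uniformize_D[OF n this] obtain u w where f: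
    "p' $ 2 = (w ^ (2 * (n - 1)) - u ^ (2 * (n - 1))) / 2"
    "p' $ 1 + p' $ 2 * p' $ 4 = \<i> * u * w * (u ^ (2 * (n - 1)) + w ^ (2 * (n - 1))) / 2" "q = u^2 * w^2" .
  then have "p' = Phi n (p' $ 4) u w"
    unfolding vec_eq_iff forall_5 Phi_simps f[symmetric] by (simp add: q_def p'3)
  with pp' t that show ?thesis by metis
qed

text \<open>A symmetry of the equation that commutes with the action. It carries bounds from the
  region where x is bounded away from 0 to the one where z is.\<close>

definition swap :: "complex^5 \<Rightarrow> complex^5" where
  "swap p = (\<chi> i. if i = 1 then p $ 2 else if i = 2 then p $ 1 else if i = 3 then p $ 5 else if i = 4 then p $ 4 else p $ 3)"

lemma swap_simps:
  "swap p $ 1 = p $ 2" "swap p $ 2 = p $ 1" "swap p $ 3 = p $ 5" "swap p $ 4 = p $ 4" "swap p $ 5 = p $ 3"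
  by (simp_all add: swap_def)

lemma swap_swap: "swap (swap p) = p"
  by (simp add: vec_eq_iff forall_5 swap_simps)

lemma X_eq_swap: "X_eq n (swap p) = X_eq n p"
  by (simp add: X_eq_def Let_def swap_simps algebra_simps)

lemma swap_in_X_reg: "n \<ge> 2 \<Longrightarrow> p \<in> X_reg n \<Longrightarrow> swap p \<in> X_reg n"
  by (auto simp: X_reg_iff X_eq_swap swap_simps)

lemma swap_action: "swap (X_action n t p) = X_action n t (swap p)"
  by (simp add: vec_eq_iff forall_5 swap_simps X_action_simps)

lemma regular_fun_curve:
  fixes \<gamma> :: "complex \<Rightarrow> complex^5"
  assumes "regular_fun M g" "open V" "\<And>i. (\<lambda>s. \<gamma> s $ i) holomorphic_on V" "\<And>s. s \<in> V \<Longrightarrow> \<gamma> s \<in> M"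
  shows "(\<lambda>s. g (\<gamma> s)) holomorphic_on V"
proof -
  have "\<gamma> ` V \<subseteq> M" using assms(4) by auto
  then show ?thesis using assms(1,2,3) by (simp add: regular_fun_def)
qed

lemma regular_fun_swap:
  assumes n: "n \<ge> 2" and g: "regular_fun (X_reg n) g"
  shows "regular_fun (X_reg n) (\<lambda>p. g (swap p))"
  unfolding regular_fun_def
proof (intro conjI allI impI)
  have "continuous_on (X_reg n) (\<lambda>p. \<chi> i. swap p $ i)"
  proof (rule continuous_on_vec_lambda)
    fix i
    show "continuous_on (X_reg n) (\<lambda>p. swap p $ i)"
      using exhaust_5[of i] by (elim disjE; simp only: swap_simps; intro continuous_intros)
  qed
  then have "continuous_on (X_reg n) swap" by simp
  then show "continuous_on (X_reg n) (\<lambda>p. g (swap p))"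
    using g swap_in_X_reg[OF n] by (auto simp: regular_fun_def intro: continuous_on_compose2)
next
  fix \<gamma> :: "complex \<Rightarrow> complex^5" and V
  assume V: "open V" and \<gamma>: "\<forall>i. (\<lambda>s. \<gamma> s $ i) holomorphic_on V" and im: "\<gamma> ` V \<subseteq> X_reg n"
  have "\<forall>i. (\<lambda>s. swap (\<gamma> s) $ i) holomorphic_on V"
    using \<gamma> unfolding forall_5 swap_simps by auto
  then show "(\<lambda>s. g (swap (\<gamma> s))) holomorphic_on V"
    by (intro regular_fun_curve[OF g V, where \<gamma>="\<lambda>s. swap (\<gamma> s)"] swap_in_X_reg[OF n]) (use im in auto)
qed

section \<open>Bounds for weighted functions on the uniformization\<close>

definition weighted :: "nat \<Rightarrow> nat \<Rightarrow> (complex^5 \<Rightarrow> complex) \<Rightarrow> bool" where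
  "weighted n W g \<longleftrightarrow> (\<forall>t p. t \<noteq> 0 \<longrightarrow> p \<in> X_reg n \<longrightarrow> g (X_action n t p) = t ^ W * g p)"

lemma Phi_holomorphic_y:
  assumes n: "n \<ge> 2" and g: "regular_fun (X_reg n) g" and uw: "u \<noteq> 0 \<or> w \<noteq> 0"
  shows "(\<lambda>y. g (Phi n y u w)) holomorphic_on UNIV"
proof -
  have "\<forall>i. (\<lambda>y. Phi n y u w $ i) holomorphic_on UNIV"
    unfolding forall_5 Phi_simps by (intro conjI holomorphic_intros)
  then show ?thesis
    by (intro regular_fun_curve[OF g open_UNIV, where \<gamma>="\<lambda>y. Phi n y u w"] Phi_in_X_reg[OF n]) (use uw in auto)
qed

lemma Phi_holomorphic_u:
  assumes n: "n \<ge> 2" and g: "regular_fun (X_reg n) g" and w: "w \<noteq> 0"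
  shows "(\<lambda>u. g (Phi n y u w)) holomorphic_on UNIV"
proof -
  have "\<forall>i. (\<lambda>u. Phi n y u w $ i) holomorphic_on UNIV"
    unfolding forall_5 Phi_simps by (intro conjI holomorphic_intros) simp_all
  then show ?thesis
    by (intro regular_fun_curve[OF g open_UNIV, where \<gamma>="\<lambda>u. Phi n y u w"] Phi_in_X_reg[OF n]) (use w in auto)
qed

lemma Phi_holomorphic_w:
  assumes n: "n \<ge> 2" and g: "regular_fun (X_reg n) g" and u: "u \<noteq> 0"
  shows "(\<lambda>w. g (Phi n y u w)) holomorphic_on UNIV"
proof -
  have "\<forall>i. (\<lambda>w. Phi n y u w $ i) holomorphic_on UNIV"
    unfolding forall_5 Phi_simps by (intro conjI holomorphic_intros) simp_all
  then show ?thesis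
    by (intro regular_fun_curve[OF g open_UNIV, where \<gamma>="\<lambda>w. Phi n y u w"] Phi_in_X_reg[OF n]) (use u in auto)
qed

lemma continuous_on_Phi: "continuous_on S (\<lambda>(y, u, w). Phi n y u w)"
proof -
  have "continuous_on S (\<lambda>v. \<chi> i. Phi n (fst v) (fst (snd v)) (snd (snd v)) $ i)"
  proof (rule continuous_on_vec_lambda)
    fix i
    show "continuous_on S (\<lambda>v. Phi n (fst v) (fst (snd v)) (snd (snd v)) $ i)"
      using exhaust_5[of i]
      by (elim disjE; simp only: Phi_simps; intro continuous_intros; simp)
  qed
  then show ?thesis by (simp add: split_beta)
qed

lemma max_principle_cball:
  assumes "f holomorphic_on UNIV" "\<And>z. norm z = R \<Longrightarrow> norm (f z) \<le> C" "norm z \<le> R"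
  shows "norm (f z) \<le> C"
proof (rule maximum_modulus_frontier[where S="cball 0 R" and f=f])
  show "continuous_on (closure (cball 0 R)) f"
    using assms(1) holomorphic_on_imp_continuous_on continuous_on_subset by blast
qed (use assms in \<open>auto intro: holomorphic_on_subset simp: frontier_cball\<close>)

text \<open>The polydisc contains points with u = w = 0, where \<open>g\<close> is not controlled.
  By the maximum principle in one of the two variables, on a disc avoiding these points, it suffices
  to have bounds where \<open>u\<close> or \<open>w\<close> has modulus \<open>R\<close>; these sets
  are compact and \<open>Phi\<close> maps them into the smooth locus.\<close>

lemma Phi_bounded:
  assumes n: "n \<ge> 2" and g: "regular_fun (X_reg n) g" and R: "R > 0"
  obtains C where "\<And>y u w. u \<noteq> 0 \<or> w \<noteq> 0 \<Longrightarrow> norm y \<le> R \<Longrightarrow> norm u \<le> R \<Longrightarrow> norm w \<le> R \<Longrightarrow> norm (g (Phi n y u w)) \<le> C"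
proof -
  let ?G = "\<lambda>(y, u, w). g (Phi n y u w)"
  have bd: "\<exists>B. \<forall>v\<in>S. norm (?G v) \<le> B" if "compact S" "\<And>y u w. (y, u, w) \<in> S \<Longrightarrow> u \<noteq> 0 \<or> w \<noteq> 0" for S
  proof -
    have "continuous_on S (\<lambda>v. g ((\<lambda>(y, u, w). Phi n y u w) v))"
      by (rule continuous_on_compose2[OF _ continuous_on_Phi, of "X_reg n"])
         (use g Phi_in_X_reg[OF n] that(2) in \<open>auto simp: regular_fun_def\<close>)
    then have "compact ((\<lambda>v. g ((\<lambda>(y, u, w). Phi n y u w) v)) ` S)"
      by (rule compact_continuous_image[OF _ that(1)])
    then have "bounded ((\<lambda>v. g ((\<lambda>(y, u, w). Phi n y u w) v)) ` S)" by (rule compact_imp_bounded)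
    then show ?thesis by (auto simp: bounded_iff split_beta)
  qed
  obtain B1 where B1: "\<And>y u w. norm y \<le> R \<Longrightarrow> norm u = R \<Longrightarrow> norm w \<le> R \<Longrightarrow> norm (g (Phi n y u w)) \<le> B1"
    using bd[of "cball 0 R \<times> sphere 0 R \<times> cball 0 R"] R by (fastforce intro: compact_Times)
  obtain B2 where B2: "\<And>y u w. norm y \<le> R \<Longrightarrow> norm u \<le> R \<Longrightarrow> norm w = R \<Longrightarrow> norm (g (Phi n y u w)) \<le> B2"
    using bd[of "cball 0 R \<times> cball 0 R \<times> sphere 0 R"] R by (fastforce intro: compact_Times)
  show ?thesis
  proof (rule that[of "max B1 B2"])
    fix y u w :: complex
    assume uw: "u \<noteq> 0 \<or> w \<noteq> 0" and R: "norm y \<le> R" "norm u \<le> R" "norm w \<le> R"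
    show "norm (g (Phi n y u w)) \<le> max B1 B2"
    \<comment> \<open>If \<open>w = 0\<close> then \<open>u \<noteq> 0\<close>, and the disc is
      taken in the \<open>w\<close> direction; otherwise in the \<open>u\<close> direction.\<close>
    proof (cases "w = 0")
      case True
      have "norm (g (Phi n y u w)) \<le> B2"
        by (rule max_principle_cball[OF Phi_holomorphic_w[OF n g]]) (use uw True B2 R in auto)
      then show ?thesis by simp
    next
      case False
      have "norm (g (Phi n y u w)) \<le> B1"
        by (rule max_principle_cball[OF Phi_holomorphic_u[OF n g False]]) (use uw B1 R in auto)
      then show ?thesis by simp
    qed
  qed
qed

lemma le_one_plus_of_power_le:
  fixes a M :: real
  assumes "0 \<le> a" "a ^ k \<le> M" "k > 0"
  shows "a \<le> 1 + M"
proof (cases "a \<le> 1")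
  case True
  have "0 \<le> a ^ k" using assms(1) by simp
  then show ?thesis using True assms(2) by linarith
next
  case False
  then show ?thesis using self_le_power[of a k] assms by simp
qed

text \<open>The smaller of the two moduli has square at most 6, hence 2m-th power at most 6^m, and
  the difference then bounds the larger.\<close>

lemma root_bound:
  fixes u w :: complex
  assumes m: "m > 0" and uw: "norm (u * w) \<le> 6" and b: "norm (w ^ (2 * m) - u ^ (2 * m)) \<le> B"
  shows "norm u \<le> 1 + (6 ^ m + B) \<and> norm w \<le> 1 + (6 ^ m + B)"
proof -
  have *: "norm v \<le> 1 + (6 ^ m + B)" "norm u \<le> 1 + (6 ^ m + B)"
    if uv: "norm u \<le> norm v" "norm (u * v) \<le> 6" "norm (v ^ (2 * m) - u ^ (2 * m)) \<le> B" for u v :: complex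
  proof -
    have "norm u ^ 2 \<le> 6"
      using mult_left_mono[OF uv(1), of "norm u"] uv(2) by (simp add: norm_mult power2_eq_square)
    then have "norm u ^ (2 * m) \<le> 6 ^ m"
      unfolding power_mult by (rule power_mono) simp
    moreover have "norm (v ^ (2 * m)) \<le> norm (v ^ (2 * m) - u ^ (2 * m)) + norm (u ^ (2 * m))"
      by (metis diff_add_cancel norm_triangle_ineq)
    ultimately have "norm v ^ (2 * m) \<le> 6 ^ m + B" using uv(3) by (simp add: norm_power)
    then show 1: "norm v \<le> 1 + (6 ^ m + B)" by (intro le_one_plus_of_power_le[where k="2 * m"]) (use m in auto)
    then show "norm u \<le> 1 + (6 ^ m + B)" using uv(1) by linarith
  qed
  show ?thesis
  proof (cases "norm u \<le> norm w")
    case True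
    then show ?thesis using *[OF True uw b] by blast
  next
    case False
    then have "norm w \<le> norm u" by simp
    then show ?thesis using *[of w u] uw b by (simp add: mult.commute norm_minus_commute)
  qed
qed

text \<open>Such points may come arbitrarily close to the singular locus, but their parameters
  \<open>t\<close>, \<open>y\<close>, \<open>u\<close>, \<open>w\<close> stay bounded, so that
  \<open>Phi_bounded\<close> applies.\<close>

lemma weighted_bounded_near_x:
  assumes n: "n \<ge> 2" and g: "regular_fun (X_reg n) g" and wt: "weighted n W g"
  obtains C where "C \<ge> 0" "\<And>p. p \<in> X_reg n \<Longrightarrow> 1/2 \<le> norm (p $ 3) \<Longrightarrow> (\<And>i. norm (p $ i) \<le> 2) \<Longrightarrow> norm (g p) \<le> C"
proof -
  \<comment> \<open>\<open>B\<close> bounds the difference of the powers of \<open>w\<close> and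
    \<open>u\<close>, which is 2 b / t^(2n - 1), from |b| \<le> 2 and |1/t| \<le> 2.
    \<open>R\<close> exceeds both the bound 4 for \<open>y\<close> and the bound of
    \<open>root_bound\<close>.\<close>
  define B where "B = 2 * (2 * 2 ^ (2 * n - 1) :: real)"
  define R where "R = 4 + (6 ^ (n - 1) + B)"
  have B0: "B \<ge> 0" by (simp add: B_def)
  have "(0::real) \<le> 6 ^ (n - 1)" by simp
  then have R0: "R > 0" using B0 unfolding R_def by linarith
  obtain C where C: "\<And>y u w. u \<noteq> 0 \<or> w \<noteq> 0 \<Longrightarrow> norm y \<le> R \<Longrightarrow> norm u \<le> R \<Longrightarrow> norm w \<le> R \<Longrightarrow> norm (g (Phi n y u w)) \<le> C"
    using Phi_bounded[OF n g R0] by blast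
  have C0: "C \<ge> 0" using C[of 1 0 0] R0 norm_ge_zero[of "g (Phi n 0 1 0)"] by (simp add: R_def B_def del: norm_ge_zero)
  show ?thesis
  proof (rule that[of "2 ^ W * C"])
    show "2 ^ W * C \<ge> 0" using C0 by simp
    fix p :: "complex^5" assume p: "p \<in> X_reg n" and x: "1/2 \<le> norm (p $ 3)" and bd: "\<And>i. norm (p $ i) \<le> 2"
    have "X_eq n p = 0" "p $ 3 \<noteq> 0" using p x by (auto simp: X_reg_iff[OF n])
    from X_param[OF n this] obtain t y u w where t: "t \<noteq> 0" "t^2 = p $ 3" and pe: "p = X_action n t (Phi n y u w)" .
    have tn2: "norm t ^ 2 = norm (p $ 3)" using t(2) by (metis norm_power)
    have tl: "1/2 \<le> norm t"
    proof (rule ccontr)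
      assume "\<not> 1/2 \<le> norm t"
      then have "norm t ^ 2 < (1/2)^2" by (intro power_strict_mono) auto
      then show False using tn2 x by (simp add: power2_eq_square)
    qed
    have tu: "norm t \<le> 2"
    proof (rule ccontr)
      assume "\<not> norm t \<le> 2"
      then have "2^2 < norm t ^ 2" by (intro power_strict_mono) auto
      then show False using tn2 bd[of 3] by simp
    qed
    have inv: "norm (1 / t) \<le> 2" using tl t(1) by (simp add: norm_divide field_simps)
    have uw: "u \<noteq> 0 \<or> w \<noteq> 0"
    proof (rule ccontr)
      assume "\<not> (u \<noteq> 0 \<or> w \<noteq> 0)"
      then have "p $ 1 = 0 \<and> p $ 2 = 0" using n by (simp add: pe X_action_simps Phi_simps zero_power)
      then show False using p by (simp add: X_reg_iff[OF n])
    qed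
    have y: "y = p $ 4 / p $ 3" using t by (simp add: pe X_action_simps Phi_simps)
    have "norm y \<le> 2 / (1/2)" unfolding y norm_divide
      using x bd[of 4] by (intro frac_le) auto
    then have y4: "norm y \<le> 4" by simp
    have "u^2 * w^2 = disc p / (p $ 3)^2"
      using t by (simp add: pe X_action_simps Phi_simps field_simps power2_eq_square)
    then have "norm (u * w) ^ 2 = norm (disc p) / norm (p $ 3) ^ 2"
      by (metis norm_divide norm_power power_mult_distrib)
    \<comment> \<open>This is 32 < 36, the origin of the constant 6 in
      \<open>root_bound\<close>.\<close>
    also have "\<dots> \<le> 8 / (1/2)^2"
    proof (rule frac_le)
      have "norm (disc p) \<le> norm (p $ 3) * norm (p $ 5) + norm (p $ 4) ^ 2"
        by (metis norm_mult norm_power norm_triangle_ineq4)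
      also have "\<dots> \<le> 2 * 2 + 2 ^ 2" by (intro add_mono mult_mono power_mono bd) auto
      finally show "norm (disc p) \<le> 8" by simp
      show "(1/2)^2 \<le> norm (p $ 3) ^ 2" using x by (intro power_mono) auto
    qed auto
    also have "\<dots> \<le> 6^2" by (simp add: power2_eq_square)
    finally have uw6: "norm (u * w) \<le> 6" by (rule power2_le_imp_le) simp
    have "w ^ (2 * (n - 1)) - u ^ (2 * (n - 1)) = 2 * (p $ 2 * (1 / t) ^ (2 * n - 1))"
      using t(1) by (simp add: pe X_action_simps Phi_simps field_simps)
    then have "norm (w ^ (2 * (n - 1)) - u ^ (2 * (n - 1))) = 2 * (norm (p $ 2) * norm (1 / t) ^ (2 * n - 1))"
      by (simp only: norm_mult norm_power norm_numeral)
    also have "\<dots> \<le> B"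
      unfolding B_def by (intro mult_left_mono mult_mono power_mono bd inv) auto
    finally have "norm u \<le> 1 + (6 ^ (n - 1) + B) \<and> norm w \<le> 1 + (6 ^ (n - 1) + B)"
      by (intro root_bound uw6) (use n in auto)
    then have "norm (g (Phi n y u w)) \<le> C"
      using y4 B0 by (intro C uw) (auto simp: R_def intro: order_trans[OF y4])
    moreover have "norm (g p) = norm t ^ W * norm (g (Phi n y u w))"
      using wt t(1) Phi_in_X_reg[OF n uw] unfolding pe weighted_def by (simp add: norm_mult norm_power)
    ultimately show "norm (g p) \<le> 2 ^ W * C"
      using tu by (auto intro!: mult_mono power_mono)
  qed
qed

lemma weighted_swap: "n \<ge> 2 \<Longrightarrow> weighted n W g \<Longrightarrow> weighted n W (\<lambda>p. g (swap p))"
  by (simp add: weighted_def swap_action swap_in_X_reg)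

text \<open>Acting by 1/y turns z into 1 + (u w / y)^2, which the hypothesis on \<open>u * w\<close>
  keeps near 1, while all coordinates stay bounded by 2. The new x is 1/y^2 and may be small, so the
  bound is applied to the swapped point. Undoing the action costs the factor
  \<open>R ^ W\<close>.\<close>

lemma Phi_growth:
  assumes n: "n \<ge> 2" and g: "regular_fun (X_reg n) g" and wt: "weighted n W g"
  obtains C where "C \<ge> 0" "\<And>y u w R. u \<noteq> 0 \<or> w \<noteq> 0 \<Longrightarrow> norm y = R \<Longrightarrow> 1 \<le> R \<Longrightarrow> norm u \<le> R \<Longrightarrow> norm w \<le> R \<Longrightarrow>
       norm (u * w) \<le> R / 2 \<Longrightarrow> norm (g (Phi n y u w)) \<le> C * R ^ W"
proof -
  obtain C where C0: "C \<ge> 0" and C: "\<And>p. p \<in> X_reg n \<Longrightarrow> 1/2 \<le> norm (p $ 3) \<Longrightarrow> (\<And>i. norm (p $ i) \<le> 2) \<Longrightarrow> norm (g (swap p)) \<le> C"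
    using weighted_bounded_near_x[OF n regular_fun_swap[OF n g] weighted_swap[OF n wt]] by blast
  show ?thesis
  proof (rule that[OF C0])
    fix y u w :: complex and R :: real
    assume uw: "u \<noteq> 0 \<or> w \<noteq> 0" and y: "norm y = R" and R: "1 \<le> R" and u: "norm u \<le> R" and w: "norm w \<le> R"
      and uwR: "norm (u * w) \<le> R / 2"
    have y0: "y \<noteq> 0" using y R by auto
    define p where "p = X_action n (1 / y) (Phi n y u w)"
    note P = Phi_in_X_reg[OF n uw, of y]
    have p: "p \<in> X_reg n" unfolding p_def using y0 by (intro X_reg_action[OF n _ P]) simp
    have Rinv: "1 / R \<le> 1" using R by simp
    have U: "norm (u ^ (2 * (n - 1))) \<le> R ^ (2 * (n - 1))" "norm (w ^ (2 * (n - 1))) \<le> R ^ (2 * (n - 1))"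
      using u w by (auto simp: norm_power intro: power_mono)
    have e: "2 * n - 1 = Suc (2 * (n - 1))" using n by simp
    have b: "norm ((w ^ (2 * (n - 1)) - u ^ (2 * (n - 1))) / 2) \<le> R ^ (2 * (n - 1))"
      using U norm_triangle_ineq4[of "w ^ (2 * (n - 1))" "u ^ (2 * (n - 1))"] by (simp add: norm_divide)
    have s: "norm ((u ^ (2 * (n - 1)) + w ^ (2 * (n - 1))) / 2) \<le> R ^ (2 * (n - 1))"
      using U norm_triangle_ineq[of "u ^ (2 * (n - 1))" "w ^ (2 * (n - 1))"] by (simp add: norm_divide)
    have 1: "norm (Phi n y u w $ 1) \<le> 2 * R ^ (2 * n - 1)"
    proof -
      have "norm (Phi n y u w $ 1) \<le> norm (u * w) * norm ((u ^ (2 * (n - 1)) + w ^ (2 * (n - 1))) / 2)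
          + norm ((w ^ (2 * (n - 1)) - u ^ (2 * (n - 1))) / 2) * norm y"
        unfolding Phi_simps norm_mult[symmetric]
        by (rule order_trans[OF norm_triangle_ineq4]) (simp add: norm_mult norm_divide)
      also have "\<dots> \<le> (R / 2) * R ^ (2 * (n - 1)) + R ^ (2 * (n - 1)) * R"
        using uwR s b y R by (intro add_mono mult_mono) auto
      also have "\<dots> \<le> 2 * R ^ (2 * n - 1)" unfolding e using R by (simp add: algebra_simps)
      finally show ?thesis .
    qed
    have 2: "norm (Phi n y u w $ 2) \<le> 2 * R ^ (2 * n - 1)"
    proof -
      have "R ^ (2 * (n - 1)) \<le> R ^ (2 * n - 1)" using R by (intro power_increasing) auto
      moreover have "0 \<le> R ^ (2 * n - 1)" using R by simp
      ultimately show ?thesis unfolding Phi_simps using b by linarith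
    qed
    have q: "norm ((u * w / y)^2) \<le> 1/4"
    proof -
      have "norm (u * w / y) \<le> 1/2"
        using uwR y R by (simp add: norm_divide field_simps)
      then have "norm (u * w / y) ^ 2 \<le> (1/2)^2" by (rule power_mono) simp
      also have "(1/2)^2 = (1/4 :: real)" by (simp add: power2_eq_square)
      finally show ?thesis by (simp only: norm_power)
    qed
    have p5: "p $ 5 = 1 + (u * w / y)^2"
      using y0 by (simp add: p_def X_action_simps Phi_simps field_simps)
    have p5l: "1/2 \<le> norm (p $ 5)"
      using norm_triangle_ineq2[of 1 "- ((u * w / y)^2)"] q unfolding p5 by (simp del: norm_power)
    have p5u: "norm (p $ 5) \<le> 2"
      using norm_triangle_ineq[of 1 "(u * w / y)^2"] q unfolding p5 by (simp del: norm_power)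
    have "norm (p $ i) \<le> 2" for i
      using exhaust_5[of i]
    proof (elim disjE; simp only:)
      show "norm (p $ 1) \<le> 2" using 1 R y by (simp add: p_def X_action_simps norm_mult norm_power norm_divide field_simps)
      show "norm (p $ 2) \<le> 2" using 2 R y by (simp add: p_def X_action_simps norm_mult norm_power norm_divide field_simps)
      have "1 \<le> 2 * R^2" using one_le_power[OF R, of 2] by linarith
      then show "norm (p $ 3) \<le> 2" using R y by (simp add: p_def X_action_simps Phi_simps norm_mult norm_power norm_divide field_simps)
      show "norm (p $ 4) \<le> 2" using R y y0
        by (simp add: p_def X_action_simps Phi_simps norm_mult norm_power norm_divide power2_eq_square) (simp add: field_simps)
    qed (rule p5u)
    then have "norm (g (swap (swap p))) \<le> C"
      using p5l by (intro C swap_in_X_reg[OF n p]) (auto simp: swap_def)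
    then have "norm (g p) \<le> C" by (simp add: swap_swap)
    moreover have "norm (g p) = (1 / R) ^ W * norm (g (Phi n y u w))"
      using wt y0 P y unfolding p_def weighted_def by (simp add: norm_mult norm_power norm_divide)
    ultimately show "norm (g (Phi n y u w)) \<le> C * R ^ W"
      using R by (simp add: field_simps)
  qed
qed

section \<open>Regular functions of weight 2 and 2n - 1\<close>

text \<open>For positive \<open>m\<close> a primitive 4m-th root of unity; with
  \<open>m = n - 1\<close> it gives the diagonal generator of the symmetry of
  \<open>Phi\<close>.\<close>

definition zeta :: "nat \<Rightarrow> complex" where
  "zeta m = cis (pi / of_nat (2 * m))"

lemma zeta_power: "zeta m ^ d = cis (of_nat d * pi / of_nat (2 * m))"
  unfolding zeta_def Complex.DeMoivre by simp

lemma zeta_power_2m: "m > 0 \<Longrightarrow> zeta m ^ (2 * m) = -1"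
  by (simp add: zeta_power)

lemma zeta_nonzero: "zeta m \<noteq> 0"
  by (simp add: zeta_def)

lemma zeta_power_ne:
  assumes "0 < d" "d < 2 * m"
  shows "zeta m ^ d \<noteq> 1" "zeta m ^ d \<noteq> -1"
proof -
  have "0 < of_nat d * pi / of_nat (2 * m)" "of_nat d * pi / of_nat (2 * m) < pi"
    using assms by (auto simp: field_simps simp flip: of_nat_mult)
  then have "Im (zeta m ^ d) > 0" unfolding zeta_power by (simp add: sin_gt_zero)
  then show "zeta m ^ d \<noteq> 1" "zeta m ^ d \<noteq> -1" by auto
qed

text \<open>This substitution and the one of \<open>Phi_rotate\<close> both lift the action of -1,
  which fixes x, y, z and negates a and b. Products of two such lifts leave \<open>Phi\<close>
  itself invariant.\<close>

lemma Phi_zeta: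
  assumes "n \<ge> 2"
  shows "Phi n y (zeta (n - 1) * u) (w / zeta (n - 1)) = X_action n (-1) (Phi n y u w)"
proof -
  have z: "zeta (n - 1) ^ (2 * (n - 1)) = -1" using assms by (intro zeta_power_2m) simp
  have 1: "(zeta (n - 1) * u) ^ (2 * (n - 1)) = - (u ^ (2 * (n - 1)))"
    "(w / zeta (n - 1)) ^ (2 * (n - 1)) = - (w ^ (2 * (n - 1)))"
    by (simp_all only: power_mult_distrib power_divide z) simp_all
  have 2: "\<i> * (zeta (n - 1) * u) * (w / zeta (n - 1)) = \<i> * u * w" "(zeta (n - 1) * u)^2 * (w / zeta (n - 1))^2 = u^2 * w^2"
    using zeta_nonzero[of "n - 1"] by (simp_all add: field_simps power2_eq_square)
  have 3: "(-1 :: complex) ^ (2 * n - 1) = -1" using assms by (intro power_minus_odd[of _ 1, simplified]) simp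
  show ?thesis
    unfolding vec_eq_iff forall_5 X_action_simps Phi_simps 1 2 3 by (simp add: algebra_simps)
qed

lemma Phi_rotate:
  assumes "n \<ge> 2"
  shows "Phi n y w (- u) = X_action n (-1) (Phi n y u w)"
proof -
  have 3: "(-1 :: complex) ^ (2 * n - 1) = -1" using assms by (intro power_minus_odd[of _ 1, simplified]) simp
  have 1: "(- u) ^ (2 * (n - 1)) = u ^ (2 * (n - 1))" by simp
  show ?thesis
    unfolding vec_eq_iff forall_5 X_action_simps Phi_simps 3 1 by (simp add: field_simps)
qed

text \<open>Each generator multiplies a function of weight \<open>W\<close> by
  \<open>(-1) ^ W\<close>. Comparing coefficients of the polynomial given by the growth bound turns
  the diagonal one into a condition on the exponents and the other one into a symmetry of the
  coefficients.\<close>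

lemma Phi_expansion:
  assumes n: "n \<ge> 2" and g: "regular_fun (X_reg n) g" and wt: "weighted n W g"
  obtains c where "\<And>y u w. w \<noteq> 0 \<Longrightarrow> g (Phi n y u w) = poly3 W c y u w"
    "\<And>k i j. W < k + i \<or> W < k + j \<Longrightarrow> c k i j = 0"
    "\<And>k i j. c k i j \<noteq> 0 \<Longrightarrow> zeta (n - 1) ^ i = (-1) ^ W * zeta (n - 1) ^ j"
    "\<And>k i j. (-1) ^ i * c k j i = (-1) ^ W * c k i j"
proof -
  let ?z = "zeta (n - 1)"
  from Phi_growth[OF n g wt]
  obtain C where C: "C \<ge> 0" "\<And>y u w R. u \<noteq> 0 \<or> w \<noteq> 0 \<Longrightarrow> norm y = R \<Longrightarrow> 1 \<le> R \<Longrightarrow> norm u \<le> R \<Longrightarrow> norm w \<le> R \<Longrightarrow>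
       norm (u * w) \<le> R / 2 \<Longrightarrow> norm (g (Phi n y u w)) \<le> C * R ^ W" by blast
  from polynomial_of_growth[where h="\<lambda>y u w. g (Phi n y u w)", OF Phi_holomorphic_y[OF n g] Phi_holomorphic_u[OF n g] Phi_holomorphic_w[OF n g] C]
  obtain c where c: "\<And>y u w. w \<noteq> 0 \<Longrightarrow> g (Phi n y u w) = poly3 W c y u w"
    and c0: "\<And>k i j. W < k + i \<or> W < k + j \<Longrightarrow> c k i j = 0" by blast
  have act: "g (X_action n (-1) (Phi n y u w)) = (-1) ^ W * g (Phi n y u w)" if "u \<noteq> 0 \<or> w \<noteq> 0" for y u w
    using wt Phi_in_X_reg[OF n that] unfolding weighted_def by simp
  have c1: "?z ^ i = (-1) ^ W * ?z ^ j" if "c k i j \<noteq> 0" for k i j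
  proof -
    have "\<not> (W < k + i \<or> W < k + j)" using c0[of k i j] that by blast
    then have le: "k \<le> W" "i \<le> W" "j \<le> W" by auto
    have "c k i j * (?z ^ i / ?z ^ j - (-1) ^ W) = 0"
    proof (rule poly_coeffs_zero3[where c="\<lambda>k i j. c k i j * (?z ^ i / ?z ^ j - (-1) ^ W)", OF _ le])
      fix y u w :: complex assume uw: "u \<noteq> 0" "w \<noteq> 0"
      have "g (Phi n y (?z * u) (w / ?z)) = (-1) ^ W * g (Phi n y u w)"
        unfolding Phi_zeta[OF n] using act[of u w y] uw by blast
      then have "poly3 W c y (?z * u) (w / ?z) -
          (-1) ^ W * poly3 W c y u w = 0"
        using uw zeta_nonzero by (simp add: c)
      then show "(\<Sum>k\<le>W. \<Sum>i\<le>W. \<Sum>j\<le>W. c k i j * (?z ^ i / ?z ^ j - (-1) ^ W) * y ^ k * u ^ i * w ^ j) = 0"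
        unfolding sum_distrib_left sum_subtractf[symmetric]
        by (rule trans[rotated]) (intro sum.cong refl, simp add: power_mult_distrib power_divide algebra_simps)
    qed
    then show ?thesis using that zeta_nonzero[of "n - 1"] by (simp add: field_simps)
  qed
  have c2: "(-1) ^ i * c k j i = (-1) ^ W * c k i j" for k i j
  proof (cases "k \<le> W \<and> i \<le> W \<and> j \<le> W")
    case True
    then have le: "k \<le> W" "i \<le> W" "j \<le> W" by auto
    have "(-1) ^ i * c k j i - (-1) ^ W * c k i j = 0"
    proof (rule poly_coeffs_zero3[where c="\<lambda>k i j. (-1) ^ i * c k j i - (-1) ^ W * c k i j", OF _ le])
      fix y u w :: complex assume uw: "u \<noteq> 0" "w \<noteq> 0"
      have "g (Phi n y w (- u)) = (-1) ^ W * g (Phi n y u w)"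
        using act[of u w y] uw by (simp add: Phi_rotate[OF n])
      then have "(\<Sum>k\<le>W. \<Sum>j\<le>W. \<Sum>i\<le>W. c k j i * y ^ k * w ^ j * (- u) ^ i) -
          (-1) ^ W * poly3 W c y u w = 0"
        using uw by (simp add: c)
      moreover have "(\<Sum>k\<le>W. \<Sum>j\<le>W. \<Sum>i\<le>W. c k j i * y ^ k * w ^ j * (- u) ^ i)
          = (\<Sum>k\<le>W. \<Sum>i\<le>W. \<Sum>j\<le>W. c k j i * y ^ k * w ^ j * (- u) ^ i)"
        by (intro sum.cong refl sum.swap)
      ultimately have "(\<Sum>k\<le>W. \<Sum>i\<le>W. \<Sum>j\<le>W. c k j i * y ^ k * w ^ j * (- u) ^ i) -
          (-1) ^ W * poly3 W c y u w = 0" by simp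
      then show "(\<Sum>k\<le>W. \<Sum>i\<le>W. \<Sum>j\<le>W. ((-1) ^ i * c k j i - (-1) ^ W * c k i j) * y ^ k * u ^ i * w ^ j) = 0"
        unfolding sum_distrib_left sum_subtractf[symmetric]
        by (rule trans[rotated]) (intro sum.cong refl, simp add: power_minus[of u] algebra_simps)
    qed
    then show ?thesis by simp
  next
    case False
    then have "c k j i = 0" "c k i j = 0" using c0[of k j i] c0[of k i j] by auto
    then show ?thesis by simp
  qed
  from that[of c] c c0 c1 c2 show ?thesis by blast
qed

text \<open>The exponents of \<open>u\<close> and \<open>w\<close> are at most 2, and neither
  \<open>zeta\<close> nor its square is 1, so they must be equal. The second generator excludes
  exponent 1, and the Newton polygon allows exponent 2 only without \<open>y\<close>.\<close>

lemma weight_2_on_Phi: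
  assumes n: "n \<ge> 2" and g: "regular_fun (X_reg n) g" and wt: "weighted n 2 g"
  obtains c0 c1 c2 c3 where "\<And>y u w. w \<noteq> 0 \<Longrightarrow> g (Phi n y u w) = c0 + c1 * y + c2 * y^2 + c3 * (u^2 * w^2)"
proof -
  let ?z = "zeta (n - 1)"
  from Phi_expansion[OF n g wt]
  obtain c where c: "\<And>y u w. w \<noteq> 0 \<Longrightarrow> g (Phi n y u w) = poly3 2 c y u w"
    and c0: "\<And>k i j. 2 < k + i \<or> 2 < k + j \<Longrightarrow> c k i j = 0"
    and c1: "\<And>k i j. c k i j \<noteq> 0 \<Longrightarrow> ?z ^ i = (-1) ^ 2 * ?z ^ j"
    and c2: "\<And>k i j. (-1) ^ i * c k j i = (-1) ^ 2 * c k i j" by blast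
  have z1: "?z \<noteq> 1" using zeta_power_ne[of 1 "n - 1"] n by simp
  have z2: "?z ^ 2 \<noteq> 1"
  \<comment> \<open>For \<open>n = 2\<close> the exponent 2 equals 2(n - 1), just outside the range
    of \<open>zeta_power_ne\<close>; there the square is -1.\<close>
  proof (cases "n = 2")
    case True
    then show ?thesis using zeta_power_2m[of "n - 1"] by simp
  next
    case False
    then show ?thesis using zeta_power_ne[of 2 "n - 1"] n by simp
  qed
  have z: "c k 0 1 = 0" "c k 1 0 = 0" "c k 0 2 = 0" "c k 2 0 = 0" "c k 1 2 = 0" "c k 2 1 = 0" for k
    using c1[of k 0 1] c1[of k 1 0] c1[of k 0 2] c1[of k 2 0] c1[of k 1 2] c1[of k 2 1] z1 z2 zeta_nonzero[of "n - 1"]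
    by (auto simp: power2_eq_square)
  have d: "c k 1 1 = 0" for k using c2[of 1 k 1] by simp
  have e: "c 1 2 2 = 0" "c 2 2 2 = 0" by (simp_all add: c0)
  have s: "{..2::nat} = {0, 1, 2}" by auto
  show ?thesis
  proof (rule that)
    fix y u w :: complex assume w: "w \<noteq> 0"
    show "g (Phi n y u w) = c 0 0 0 + c 1 0 0 * y + c 2 0 0 * y^2 + c 0 2 2 * (u^2 * w^2)"
      unfolding c[OF w] s using z d e by simp
  qed
qed

text \<open>The diagonal generator requires opposite powers of \<open>zeta\<close>, and within the
  Newton polygon this forces the exponents of \<open>u\<close> and \<open>w\<close> to differ by
  exactly 2(n - 1). Six monomials remain, which the second generator combines into b, b y and c = a
  + b y.\<close>

lemma weight_odd_on_Phi:
  assumes n: "n \<ge> 2" and g: "regular_fun (X_reg n) g" and wt: "weighted n (2 * n - 1) g"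
  obtains c0 c1 c2 where "\<And>y u w. w \<noteq> 0 \<Longrightarrow>
    g (Phi n y u w) = (c0 + c1 * y) * Phi n y u w $ 2 + c2 * (Phi n y u w $ 1 + y * Phi n y u w $ 2)"
proof -
  let ?z = "zeta (n - 1)" and ?W = "2 * n - 1"
  obtain m where nm: "n = Suc m" and m: "m > 0" using n by (cases n) auto
  from Phi_expansion[OF n g wt]
  obtain c where c: "\<And>y u w. w \<noteq> 0 \<Longrightarrow> g (Phi n y u w) = poly3 ?W c y u w"
    and c0: "\<And>k i j. ?W < k + i \<or> ?W < k + j \<Longrightarrow> c k i j = 0"
    and c1: "\<And>k i j. c k i j \<noteq> 0 \<Longrightarrow> ?z ^ i = (-1) ^ ?W * ?z ^ j"
    and c2: "\<And>k i j. (-1) ^ i * c k j i = (-1) ^ ?W * c k i j" by blast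
  have W: "?W = Suc (2 * m)" and sg: "(-1::complex) ^ ?W = -1" by (simp_all add: nm)
  have key: "d = 2 * m" if d: "?z ^ d = -1" and dW: "d \<le> Suc (2 * m)" for d
  proof (rule ccontr)
    assume ne: "d \<noteq> 2 * m"
    consider "d = 0" | "0 < d" "d < 2 * m" | "d = Suc (2 * m)" using ne dW by linarith
    then show False
    proof cases
      case 1
      then show ?thesis using d by simp
    next
      case 2
      then show ?thesis using zeta_power_ne(2)[of d m] d by (simp add: nm)
    next
      case 3
      then have "?z = 1" using d zeta_power_2m[OF m] by (simp add: nm)
      then show ?thesis using zeta_power_ne(1)[of 1 m] m by (simp add: nm)
    qed
  qed
  define S where "S = {(0 :: nat, 2 * m, 0), (1, 2 * m, 0), (0, 0, 2 * m), (1, 0, 2 * m), (0, Suc (2 * m), 1), (0, 1, Suc (2 * m))}"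
  have neg: "d = -1" if "B \<noteq> 0" "A = - B" "A * d = B" for A B d :: complex
  proof -
    have "B * (d + 1) = 0" using that(2,3) by algebra
    then show ?thesis using that(1) by (simp add: eq_neg_iff_add_eq_0)
  qed
  have supp: "(k, i, j) \<in> S" if nz: "c k i j \<noteq> 0" for k i j
  proof -
    have le: "k + i \<le> Suc (2 * m)" "k + j \<le> Suc (2 * m)"
      using c0[of k i j] nz unfolding W by (auto simp: not_less[symmetric])
    have e: "?z ^ i = - (?z ^ j)" using c1[OF nz] unfolding sg by simp
    show ?thesis
    proof (cases "i \<le> j")
      case True
      have "?z ^ i * ?z ^ (j - i) = ?z ^ j" using True by (simp flip: power_add)
      then have "?z ^ (j - i) = -1" by (rule neg[OF power_not_zero[OF zeta_nonzero] e])
      then have "j - i = 2 * m" using key le by simp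
      then have "i = 0 \<and> j = 2 * m \<and> (k = 0 \<or> k = 1) \<or> i = 1 \<and> j = Suc (2 * m) \<and> k = 0"
        using le m True by linarith
      then show ?thesis unfolding S_def by blast
    next
      case False
      have "?z ^ j * ?z ^ (i - j) = ?z ^ i" using False by (simp flip: power_add)
      moreover have "?z ^ j = - (?z ^ i)" unfolding e by (rule minus_minus[symmetric])
      ultimately have "?z ^ (i - j) = -1" by (intro neg[OF power_not_zero[OF zeta_nonzero]])
      then have "i - j = 2 * m" using key le by simp
      then have "j = 0 \<and> i = 2 * m \<and> (k = 0 \<or> k = 1) \<or> j = 1 \<and> i = Suc (2 * m) \<and> k = 0"
        using le m False by linarith
      then show ?thesis unfolding S_def by blast
    qed
  qed
  have sw: "c k 0 (2 * m) = - c k (2 * m) 0" "c 0 (Suc (2 * m)) 1 = c 0 1 (Suc (2 * m))" for k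
    using c2[of "2 * m" k 0, unfolded sg] c2[of 1 0 "Suc (2 * m)", unfolded sg] by simp_all
  show ?thesis
  proof (rule that)
    fix y u w :: complex assume w: "w \<noteq> 0"
    have "g (Phi n y u w) = (\<Sum>(k, i, j)\<in>{..?W} \<times> {..?W} \<times> {..?W}. c k i j * y ^ k * u ^ i * w ^ j)"
      unfolding c[OF w] by (simp add: sum.cartesian_product)
    also have "\<dots> = (\<Sum>(k, i, j)\<in>S. c k i j * y ^ k * u ^ i * w ^ j)"
    proof (rule sum.mono_neutral_right)
      show "S \<subseteq> {..?W} \<times> {..?W} \<times> {..?W}" unfolding S_def W using m by auto
      show "\<forall>v\<in>{..?W} \<times> {..?W} \<times> {..?W} - S. (case v of (k, i, j) \<Rightarrow> c k i j * y ^ k * u ^ i * w ^ j) = 0"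
        using supp by auto
    qed auto
    also have "\<dots> = c 0 (2 * m) 0 * u ^ (2 * m) + c 1 (2 * m) 0 * y * u ^ (2 * m)
       + c 0 0 (2 * m) * w ^ (2 * m) + c 1 0 (2 * m) * y * w ^ (2 * m)
       + c 0 (Suc (2 * m)) 1 * u ^ Suc (2 * m) * w + c 0 1 (Suc (2 * m)) * u * w ^ Suc (2 * m)"
      unfolding S_def using m by (simp add: algebra_simps)
    also have "\<dots> = ((- 2 * c 0 (2 * m) 0) + (- 2 * c 1 (2 * m) 0) * y) * Phi n y u w $ 2
       + (- 2 * \<i> * c 0 1 (Suc (2 * m))) * (Phi n y u w $ 1 + y * Phi n y u w $ 2)"
    proof -
      have "\<i> * \<i> = (-1::complex)" by simp
      then show ?thesis unfolding sw Phi_simps nm by (simp add: field_simps)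
    qed
    finally show "g (Phi n y u w) = ((- 2 * c 0 (2 * m) 0) + (- 2 * c 1 (2 * m) 0) * y) * Phi n y u w $ 2
       + (- 2 * \<i> * c 0 1 (Suc (2 * m))) * (Phi n y u w $ 1 + y * Phi n y u w $ 2)" .
  qed
qed

section \<open>Absence of poles along x = 0\<close>

text \<open>A curve in \<open>X_reg\<close> that meets \<open>x = 0\<close> only at \<open>s = 0\<close>, with \<open>y = 1\<close>; it excludes the summands
  \<open>y\<^sup>2 / x\<close> and \<open>by / x\<close>, which are still possible on the slices \<open>x \<noteq> 0\<close>.\<close>

definition test_curve :: "nat \<Rightarrow> complex \<Rightarrow> complex^5" where
  "test_curve n s = (let a = - ((-1) ^ n) / 2 in
     \<chi> i. if i = 1 then a else if i = 2 then 1 - s * a else if i = 3 then 2 * s else if i = 4 then 1 else 0)"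

lemma test_curve_simps:
  "test_curve n s $ 1 = - ((-1) ^ n) / 2" "test_curve n s $ 2 = 1 - s * (- ((-1) ^ n) / 2)"
  "test_curve n s $ 3 = 2 * s" "test_curve n s $ 4 = 1" "test_curve n s $ 5 = 0"
  by (simp_all add: test_curve_def Let_def)

lemma test_curve_in: "n \<ge> 2 \<Longrightarrow> test_curve n s \<in> X_reg n"
  by (simp add: X_reg_iff X_eq_def Let_def test_curve_simps algebra_simps power2_eq_square)

lemma test_curve_continuous:
  assumes n: "n \<ge> 2" and g: "regular_fun (X_reg n) g"
  shows "continuous_on UNIV (\<lambda>s. g (test_curve n s))"
proof -
  have "\<forall>i. (\<lambda>s. test_curve n s $ i) holomorphic_on UNIV"
    unfolding forall_5 test_curve_simps by (intro conjI holomorphic_intros) simp_all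
  then have "(\<lambda>s. g (test_curve n s)) holomorphic_on UNIV"
    by (intro regular_fun_curve[OF g open_UNIV, where \<gamma>="test_curve n"] test_curve_in[OF n]) auto
  then show ?thesis by (rule holomorphic_on_imp_continuous_on)
qed

text \<open>Otherwise k / s would be a difference of two functions continuous at 0.\<close>

lemma no_pole:
  fixes F P :: "complex \<Rightarrow> complex"
  assumes F: "continuous_on UNIV F" and P: "continuous_on UNIV P"
    and eq: "\<And>s. s \<noteq> 0 \<Longrightarrow> s * F s = s * P s + k"
  shows "k = 0"
proof -
  have "((\<lambda>s. s * F s - s * P s) \<longlongrightarrow> 0 * F 0 - 0 * P 0) (at 0)"
    using F P by (intro tendsto_intros) (auto simp: continuous_on_eq_continuous_at isCont_def)
  moreover have "\<forall>\<^sub>F s in at 0. s * F s - s * P s = k"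
    using eq by (auto simp: eventually_at_filter)
  ultimately have "((\<lambda>s. k) \<longlongrightarrow> 0) (at (0::complex))"
    using tendsto_cong by force
  then show ?thesis by (simp add: tendsto_const_iff)
qed

text \<open>Homogenizing the expansion on the slice writes x g as x times a linear form in x, y, z
  plus a multiple of y^2, and a nonzero multiple would give \<open>g\<close> a pole on the test
  curve. Since the expansion concerns \<open>w \<noteq> 0\<close>, points with x z = y^2 are left to
  the density argument.\<close>

lemma weight_2_classification:
  assumes n: "n \<ge> 2" and g: "regular_fun (X_reg n) g" and wt: "weighted n 2 g"
  obtains c1 c2 c3 where "\<And>p. p \<in> X_reg n \<Longrightarrow> p $ 3 \<noteq> 0 \<Longrightarrow> p $ 3 * p $ 5 \<noteq> (p $ 4)^2 \<Longrightarrow>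
    g p = c1 * p $ 3 + c2 * p $ 4 + c3 * p $ 5"
proof -
  obtain c0 c1 c2 c3 where c: "\<And>y u w. w \<noteq> 0 \<Longrightarrow> g (Phi n y u w) = c0 + c1 * y + c2 * y^2 + c3 * (u^2 * w^2)"
    using weight_2_on_Phi[OF n g wt] by blast
  have gp: "p $ 3 * g p = p $ 3 * (c0 * p $ 3 + c1 * p $ 4) + c2 * (p $ 4)^2 + c3 * disc p"
    if p: "p \<in> X_reg n" and x: "p $ 3 \<noteq> 0" and q: "p $ 3 * p $ 5 \<noteq> (p $ 4)^2" for p :: "complex^5"
  proof -
    have "X_eq n p = 0" using p by (simp add: X_reg_iff[OF n])
    from X_param[OF n this x] obtain t y u w where t: "t \<noteq> 0" "t^2 = p $ 3" and pe: "p = X_action n t (Phi n y u w)" .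
    have w: "w \<noteq> 0" using q unfolding pe X_action_simps Phi_simps by (auto simp: power2_eq_square algebra_simps)
    have "g p = t^2 * g (Phi n y u w)"
      using wt t(1) Phi_in_X_reg[OF n, of u w] w unfolding pe weighted_def by simp
    then show ?thesis
      unfolding pe X_action_simps Phi_simps c[OF w] by (simp add: algebra_simps power2_eq_square)
  qed
  \<comment> \<open>On the curve x = 2s, y^2 = 1 and x z - y^2 = -1, so this is the residue at
    \<open>s = 0\<close>.\<close>
  have "(c2 - c3) / 2 = 0"
  proof (rule no_pole[OF test_curve_continuous[OF n g]])
    show "continuous_on UNIV (\<lambda>s. c0 * (2 * s) + c1)" by (intro continuous_intros)
    fix s :: complex assume "s \<noteq> 0"
    then have "2 * s * g (test_curve n s) = 2 * s * (c0 * (2 * s) + c1) + c2 - c3"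
      using gp[OF test_curve_in[OF n], of s] by (simp add: test_curve_simps)
    then show "s * g (test_curve n s) = s * (c0 * (2 * s) + c1) + (c2 - c3) / 2"
      by (simp add: field_simps)
  qed
  then have e: "c3 = c2" by simp
  show ?thesis
  proof (rule that)
    fix p :: "complex^5" assume a: "p \<in> X_reg n" "p $ 3 \<noteq> 0" "p $ 3 * p $ 5 \<noteq> (p $ 4)^2"
    have "p $ 3 * g p = p $ 3 * (c0 * p $ 3 + c1 * p $ 4 + c2 * p $ 5)"
      unfolding gp[OF a] e by (simp add: algebra_simps)
    then show "g p = c0 * p $ 3 + c1 * p $ 4 + c2 * p $ 5" using a(2) by simp
  qed
qed

lemma weight_odd_classification:
  assumes n: "n \<ge> 2" and g: "regular_fun (X_reg n) g" and wt: "weighted n (2 * n - 1) g"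
  obtains c1 c2 where "\<And>p. p \<in> X_reg n \<Longrightarrow> p $ 3 \<noteq> 0 \<Longrightarrow> p $ 3 * p $ 5 \<noteq> (p $ 4)^2 \<Longrightarrow>
    g p = c1 * p $ 1 + c2 * p $ 2"
proof -
  obtain c0 c1 c2 where c: "\<And>y u w. w \<noteq> 0 \<Longrightarrow>
    g (Phi n y u w) = (c0 + c1 * y) * Phi n y u w $ 2 + c2 * (Phi n y u w $ 1 + y * Phi n y u w $ 2)"
    using weight_odd_on_Phi[OF n g wt] by blast
  have gp: "p $ 3 * g p = p $ 3 * (c0 * p $ 2 + c2 * p $ 1) + (c1 + c2) * (p $ 4 * p $ 2)"
    if p: "p \<in> X_reg n" and x: "p $ 3 \<noteq> 0" and q: "p $ 3 * p $ 5 \<noteq> (p $ 4)^2" for p :: "complex^5"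
  proof -
    have "X_eq n p = 0" using p by (simp add: X_reg_iff[OF n])
    from X_param[OF n this x] obtain t y u w where t: "t \<noteq> 0" "t^2 = p $ 3" and pe: "p = X_action n t (Phi n y u w)" .
    have w: "w \<noteq> 0" using q unfolding pe X_action_simps Phi_simps by (auto simp: power2_eq_square algebra_simps)
    have y: "Phi n y u w $ 4 = y" "Phi n y u w $ 3 = 1" by (simp_all add: Phi_simps)
    have "g p = t ^ (2 * n - 1) * g (Phi n y u w)"
      using wt t(1) Phi_in_X_reg[OF n, of u w] w unfolding pe weighted_def by simp
    then show ?thesis
      unfolding pe X_action_simps y c[OF w] by (simp add: algebra_simps power2_eq_square)
  qed
  define a :: complex where "a = - ((-1) ^ n) / 2"
  define k where "k = (c1 + c2) / 2"
  have k2: "c1 + c2 = 2 * k" by (simp add: k_def)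
  have "k = 0"
  proof (rule no_pole[OF test_curve_continuous[OF n g]])
    \<comment> \<open>The product b y is 1 - s a on the curve: its value 1 at \<open>s = 0\<close>
      produces the residue \<open>k\<close>, and the remainder joins the continuous part as
      \<open>- k * a\<close>.\<close>
    show "continuous_on UNIV (\<lambda>s. c0 * (1 - s * a) + c2 * a - k * a)" by (intro continuous_intros)
    fix s :: complex assume "s \<noteq> 0"
    then have "2 * s * g (test_curve n s) = 2 * s * (c0 * (1 - s * a) + c2 * a) + 2 * k * (1 * (1 - s * a))"
      using gp[OF test_curve_in[OF n], of s] unfolding test_curve_simps a_def[symmetric] k2 by simp
    then have "2 * (s * g (test_curve n s) - (s * (c0 * (1 - s * a) + c2 * a - k * a) + k)) = 0" by algebra
    then have "s * g (test_curve n s) - (s * (c0 * (1 - s * a) + c2 * a - k * a) + k) = 0"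
      by (metis mult_eq_0_iff zero_neq_numeral)
    then show "s * g (test_curve n s) = s * (c0 * (1 - s * a) + c2 * a - k * a) + k" by (simp only: right_minus_eq)
  qed
  then have e: "c1 + c2 = 0" by (simp add: k_def)
  show ?thesis
  proof (rule that)
    fix p :: "complex^5" assume a: "p \<in> X_reg n" "p $ 3 \<noteq> 0" "p $ 3 * p $ 5 \<noteq> (p $ 4)^2"
    have "p $ 3 * g p = p $ 3 * (c2 * p $ 1 + c0 * p $ 2)"
      unfolding gp[OF a] e by (simp add: algebra_simps)
    then show "g p = c2 * p $ 1 + c0 * p $ 2" using a(2) by simp
  qed
qed

section \<open>Density\<close>

lemma in_closure_curve:
  fixes \<gamma> :: "complex \<Rightarrow> complex^5"
  assumes "continuous_on UNIV \<gamma>" "\<gamma> 0 = p" "\<And>e. e > 0 \<Longrightarrow> \<exists>s. norm s < e \<and> \<gamma> s \<in> A"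
  shows "p \<in> closure A"
proof (rule ccontr)
  assume "p \<notin> closure A"
  then have "open (\<gamma> -` (- closure A))" "0 \<in> \<gamma> -` (- closure A)"
    using assms(1,2) by (auto intro!: open_vimage)
  then obtain e where "e > 0" "ball 0 e \<subseteq> \<gamma> -` (- closure A)" by (rule openE)
  moreover obtain s where "norm s < e" "\<gamma> s \<in> A" using assms(3)[OF \<open>e > 0\<close>] by blast
  ultimately show False using closure_subset[of A] by (auto simp: dist_norm)
qed

lemma in_closure_curve_finite:
  fixes \<gamma> :: "complex \<Rightarrow> complex^5"
  assumes "continuous_on UNIV \<gamma>" "\<gamma> 0 = p" "finite F" "\<And>s. s \<notin> F \<Longrightarrow> \<gamma> s \<in> A"
  shows "p \<in> closure A"
proof (rule in_closure_curve[OF assms(1,2)])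
  fix e :: real assume "e > 0"
  then have "infinite (ball (0::complex) e)"
    using uncountable_ball uncountable_infinite by blast
  then obtain s where "s \<in> ball 0 e" "s \<notin> F"
    using assms(3) by (meson finite_subset subsetI)
  then show "\<exists>s. norm s < e \<and> \<gamma> s \<in> A" using assms(4) by (auto simp: dist_norm)
qed

lemma continuous_on_coords5:
  fixes \<gamma> :: "complex \<Rightarrow> complex^5"
  assumes "continuous_on S (\<lambda>s. \<gamma> s $ 1)" "continuous_on S (\<lambda>s. \<gamma> s $ 2)" "continuous_on S (\<lambda>s. \<gamma> s $ 3)"
    "continuous_on S (\<lambda>s. \<gamma> s $ 4)" "continuous_on S (\<lambda>s. \<gamma> s $ 5)"
  shows "continuous_on S \<gamma>"
proof -
  have "continuous_on S (\<lambda>s. \<chi> i. \<gamma> s $ i)"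
    by (rule continuous_on_vec_lambda) (use assms exhaust_5 in metis)
  then show ?thesis by simp
qed

definition vec5 :: "complex \<Rightarrow> complex \<Rightarrow> complex \<Rightarrow> complex \<Rightarrow> complex \<Rightarrow> complex^5" where
  "vec5 a b x y z = (\<chi> i. if i = 1 then a else if i = 2 then b else if i = 3 then x else if i = 4 then y else z)"

lemma vec5_simps [simp]:
  "vec5 a b x y z $ 1 = a" "vec5 a b x y z $ 2 = b" "vec5 a b x y z $ 3 = x" "vec5 a b x y z $ 4 = y" "vec5 a b x y z $ 5 = z"
  by (simp_all add: vec5_def)

lemma vec5_eq: "p = vec5 (p $ 1) (p $ 2) (p $ 3) (p $ 4) (p $ 5)"
  by (simp add: vec_eq_iff forall_5)

text \<open>If y or z is nonzero, a unipotent subgroup of SL2, acting on (a, b) and on (x, y, z),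
  preserves the equation and moves x off 0. Points with x = y = z = 0 are approximated first:
  keeping x or z at 0 makes the equation linear in the other, so it can be solved with y =
  s.\<close>

lemma dense_x:
  assumes n: "n \<ge> 2"
  shows "X_reg n \<subseteq> closure {p \<in> X_reg n. p $ 3 \<noteq> 0}"
proof -
  let ?G = "{p \<in> X_reg n. p $ 3 \<noteq> 0}"
  have A: "p \<in> closure ?G" if p: "p \<in> X_reg n" and yz: "p $ 4 \<noteq> 0 \<or> p $ 5 \<noteq> 0" for p :: "complex^5"
  proof (cases "p $ 3 = 0")
    case False
    then show ?thesis using p closure_subset[of ?G] by auto
  next
    case True
    define \<gamma> where "\<gamma> = (\<lambda>s. vec5 (p $ 1) (p $ 2 - s * p $ 1) (p $ 3 + 2 * s * p $ 4 + s^2 * p $ 5) (p $ 4 + s * p $ 5) (p $ 5))"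
    show ?thesis
    proof (rule in_closure_curve_finite)
      show "continuous_on UNIV \<gamma>"
        unfolding \<gamma>_def by (rule continuous_on_coords5; simp; intro continuous_intros)
      show "\<gamma> 0 = p" by (simp add: \<gamma>_def vec5_eq[symmetric])
      \<comment> \<open>Excluded are the zeros of the new x, which is s (2 y + s z). For z = 0 the
        quotient is 0 by convention, and rightly only s = 0 is excluded.\<close>
      show "finite {0, - 2 * p $ 4 / p $ 5}" by simp
      fix s assume s: "s \<notin> {0, - 2 * p $ 4 / p $ 5}"
      have "2 * p $ 4 + s * p $ 5 \<noteq> 0"
      proof
        assume e: "2 * p $ 4 + s * p $ 5 = 0"
        then have "p $ 5 \<noteq> 0" using yz by auto
        moreover have "s * p $ 5 = - 2 * p $ 4" using e by (simp add: eq_neg_iff_add_eq_0 add.commute)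
        ultimately show False using s by (simp add: field_simps)
      qed
      then have "s * (2 * p $ 4 + s * p $ 5) \<noteq> 0" using s by simp
      then have "\<gamma> s $ 3 \<noteq> 0" using True by (simp add: \<gamma>_def algebra_simps power2_eq_square)
      moreover have "X_eq n (\<gamma> s) = X_eq n p"
      proof -
        have "(p $ 3 + 2 * s * p $ 4 + s^2 * p $ 5) * p $ 5 - (p $ 4 + s * p $ 5)^2 = disc p" by algebra
        then show ?thesis unfolding X_eq_def Let_def \<gamma>_def vec5_simps by (simp only:) (simp add: algebra_simps power2_eq_square)
      qed
      moreover have "\<gamma> s $ 1 \<noteq> 0 \<or> \<gamma> s $ 2 \<noteq> 0" using p by (auto simp: X_reg_iff[OF n] \<gamma>_def)
      ultimately show "\<gamma> s \<in> ?G" using p by (simp add: X_reg_iff[OF n])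
    qed
  qed
  have B: "p \<in> closure {p \<in> X_reg n. p $ 4 \<noteq> 0 \<or> p $ 5 \<noteq> 0}" if p: "p \<in> X_reg n" and 0: "p $ 3 = 0" "p $ 4 = 0" "p $ 5 = 0" for p :: "complex^5"
  proof (cases "p $ 1 = 0")
    case False
    define \<gamma> where "\<gamma> = (\<lambda>s. vec5 (p $ 1) (p $ 2) (- ((- (s^2)) ^ n) / (p $ 1)^2 - 2 * p $ 2 * s / p $ 1) s 0)"
    show ?thesis
    proof (rule in_closure_curve_finite)
      show "continuous_on UNIV \<gamma>"
        unfolding \<gamma>_def using False by (intro continuous_on_coords5; simp; intro continuous_intros; simp)
      show "\<gamma> 0 = p" using 0 n by (simp add: \<gamma>_def vec_eq_iff forall_5 zero_power)
      show "finite {0 :: complex}" by simp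
      fix s :: complex assume "s \<notin> {0}"
      moreover have "X_eq n (\<gamma> s) = 0"
        using False by (simp add: X_eq_def Let_def \<gamma>_def field_simps power2_eq_square)
      ultimately show "\<gamma> s \<in> {p \<in> X_reg n. p $ 4 \<noteq> 0 \<or> p $ 5 \<noteq> 0}"
        using False by (simp add: X_reg_iff[OF n] \<gamma>_def)
    qed
  next
    case True
    then have b: "p $ 2 \<noteq> 0" using p by (simp add: X_reg_iff[OF n])
    define \<gamma> where "\<gamma> = (\<lambda>s. vec5 0 (p $ 2) 0 s (- ((- (s^2)) ^ n) / (p $ 2)^2))"
    show ?thesis
    proof (rule in_closure_curve_finite)
      show "continuous_on UNIV \<gamma>"
        unfolding \<gamma>_def using b by (intro continuous_on_coords5; simp; intro continuous_intros; simp)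
      show "\<gamma> 0 = p" using 0 n True by (simp add: \<gamma>_def vec_eq_iff forall_5 zero_power)
      show "finite {0 :: complex}" by simp
      fix s :: complex assume "s \<notin> {0}"
      moreover have "X_eq n (\<gamma> s) = 0"
        using b by (simp add: X_eq_def Let_def \<gamma>_def)
      ultimately show "\<gamma> s \<in> {p \<in> X_reg n. p $ 4 \<noteq> 0 \<or> p $ 5 \<noteq> 0}"
        using b by (simp add: X_reg_iff[OF n] \<gamma>_def)
    qed
  qed
  have C: "closure {p \<in> X_reg n. p $ 4 \<noteq> 0 \<or> p $ 5 \<noteq> 0} \<subseteq> closure ?G"
    by (rule closure_minimal) (use A in auto)
  show ?thesis
  proof
    fix p assume p: "p \<in> X_reg n"
    show "p \<in> closure ?G"
    proof (cases "p $ 3 = 0 \<and> p $ 4 = 0 \<and> p $ 5 = 0")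
      case True
      then show ?thesis using B[OF p] C by blast
    next
      case False
      then show ?thesis using A[OF p] p closure_subset[of ?G] by blast
    qed
  qed
qed

lemma X_action_Phi_c:
  assumes "n \<ge> 2"
  shows "X_action n t (Phi n y u w) $ 1 * X_action n t (Phi n y u w) $ 3 + X_action n t (Phi n y u w) $ 2 * X_action n t (Phi n y u w) $ 4
    = t ^ (2 * n - 1) * t^2 * (\<i> * u * w * (u ^ (2 * (n - 1)) + w ^ (2 * (n - 1))) / 2)"
  unfolding X_action_simps Phi_simps by (simp add: algebra_simps)

lemma continuous_on_action_Phi:
  assumes "continuous_on S f" "continuous_on S g"
  shows "continuous_on S (\<lambda>s::complex. X_action n t (Phi n y (f s) (g s)))"
  by (rule continuous_on_coords5; simp only: X_action_simps Phi_simps; intro continuous_intros assms; simp)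

text \<open>On the image of \<open>Phi\<close>, \<open>crit\<close> is a nonzero factor times u w
  (u^(2(n - 1)) + w^(2(n - 1))). A first perturbation makes \<open>u\<close> and \<open>w\<close>
  nonzero; a second one stretches \<open>u\<close> by a real factor above 1, so that the two powers
  no longer have equal modulus.\<close>

lemma dense_xc:
  assumes n: "n \<ge> 2"
  shows "X_reg n \<subseteq> closure {p \<in> X_reg n. p $ 3 \<noteq> 0 \<and> crit p \<noteq> 0}"
proof -
  let ?G1 = "{p \<in> X_reg n. p $ 3 \<noteq> 0}"
  let ?G2 = "{p. \<exists>t y u w. t \<noteq> 0 \<and> u \<noteq> 0 \<and> w \<noteq> 0 \<and> p = X_action n t (Phi n y u w)}"
  let ?G3 = "{p \<in> X_reg n. p $ 3 \<noteq> 0 \<and> crit p \<noteq> 0}"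
  have 1: "?G1 \<subseteq> closure ?G2"
  proof
    fix p assume "p \<in> ?G1"
    then have "X_eq n p = 0" "p $ 3 \<noteq> 0" by (auto simp: X_reg_iff[OF n])
    from X_param[OF n this] obtain t y u w where t: "t \<noteq> 0" and pe: "p = X_action n t (Phi n y u w)" .
    show "p \<in> closure ?G2"
    proof (rule in_closure_curve_finite[where \<gamma>="\<lambda>s. X_action n t (Phi n y (u + s) (w + s))" and F="{-u, -w}"])
      fix s assume "s \<notin> {-u, -w}"
      then have "u + s \<noteq> 0" "w + s \<noteq> 0" by (auto simp: add_eq_0_iff)
      then show "X_action n t (Phi n y (u + s) (w + s)) \<in> ?G2" using t by blast
    qed (use pe in \<open>auto intro!: continuous_on_action_Phi continuous_intros\<close>)
  qed
  have 2: "?G2 \<subseteq> closure ?G3"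
  proof
    fix p assume "p \<in> ?G2"
    then obtain t y u w where t: "t \<noteq> 0" and u: "u \<noteq> 0" and w: "w \<noteq> 0" and pe: "p = X_action n t (Phi n y u w)" by blast
    have mem: "X_action n t (Phi n y u' w) \<in> ?G3" if u': "u' \<noteq> 0" and ne: "u' ^ (2 * (n - 1)) + w ^ (2 * (n - 1)) \<noteq> 0" for u'
    proof -
      have "X_action n t (Phi n y u' w) \<in> X_reg n" by (intro X_reg_action[OF n t] Phi_in_X_reg[OF n]) (use w in simp)
      then show ?thesis
        using t u' w ne by (simp add: X_action_Phi_c[OF n]) (simp add: X_action_simps Phi_simps)
    qed
    show "p \<in> closure ?G3"
    proof (cases "u ^ (2 * (n - 1)) + w ^ (2 * (n - 1)) = 0")
      case False
      then show ?thesis using mem[OF u] pe closure_subset[of ?G3] by blast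
    next
      case True
      show ?thesis
      proof (rule in_closure_curve[where \<gamma>="\<lambda>s. X_action n t (Phi n y (u * (1 + s)) w)"])
        fix e :: real assume e: "e > 0"
        define s where "s = e / 2"
        have s: "s > 0" using e by (simp add: s_def)
        have m: "2 * (n - 1) > 0" using n by simp
        have "(u * (1 + of_real s)) ^ (2 * (n - 1)) + w ^ (2 * (n - 1)) \<noteq> 0"
        proof
          assume "(u * (1 + of_real s)) ^ (2 * (n - 1)) + w ^ (2 * (n - 1)) = 0"
          with True have "(u * (1 + of_real s)) ^ (2 * (n - 1)) = u ^ (2 * (n - 1))" by (simp add: add_eq_0_iff)
          then have "(1 + complex_of_real s) ^ (2 * (n - 1)) = 1" using u by (simp only: power_mult_distrib) simp
          then have "complex_of_real ((1 + s) ^ (2 * (n - 1))) = of_real 1" by simp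
          then have "(1 + s) ^ (2 * (n - 1)) = 1" by (simp only: of_real_eq_iff)
          moreover have "(1 + s) ^ (2 * (n - 1)) > 1" using s m by (intro one_less_power) auto
          ultimately show False by simp
        qed
        moreover have "u * (1 + of_real s) \<noteq> 0"
        proof -
          have "1 + s \<noteq> 0" using s by simp
          then have "complex_of_real (1 + s) \<noteq> 0" by (simp only: of_real_eq_0_iff) simp
          then show ?thesis using u by simp
        qed
        ultimately show "\<exists>s. norm s < e \<and> X_action n t (Phi n y (u * (1 + s)) w) \<in> ?G3"
          by (intro exI[of _ "of_real s"] conjI mem) (use e in \<open>auto simp: s_def\<close>)
      qed (use pe in \<open>auto intro!: continuous_on_action_Phi continuous_intros\<close>)
    qed
  qed
  have "closure ?G1 \<subseteq> closure ?G2" by (rule closure_minimal[OF 1 closed_closure])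
  moreover have "closure ?G2 \<subseteq> closure ?G3" by (rule closure_minimal[OF 2 closed_closure])
  ultimately show ?thesis using dense_x[OF n] by blast
qed

lemma eq_on_X_reg:
  fixes f g :: "complex^5 \<Rightarrow> complex"
  assumes n: "n \<ge> 2" and f: "continuous_on (X_reg n) f" and g: "continuous_on (X_reg n) g"
    and eq: "\<And>p. p \<in> X_reg n \<Longrightarrow> p $ 3 \<noteq> 0 \<Longrightarrow> crit p \<noteq> 0 \<Longrightarrow> f p = g p"
    and p: "p \<in> X_reg n"
  shows "f p = g p"
proof -
  let ?G3 = "{p \<in> X_reg n. p $ 3 \<noteq> 0 \<and> crit p \<noteq> 0}"
  have "p \<in> closure ?G3" using dense_xc[OF n] p by blast
  then obtain xs where xs: "\<And>k. xs k \<in> ?G3" "xs \<longlonglongrightarrow> p" unfolding closure_sequential by blast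
  have "(\<lambda>k. f (xs k)) \<longlonglongrightarrow> f p" "(\<lambda>k. g (xs k)) \<longlonglongrightarrow> g p"
    using continuous_on_tendsto_compose[OF f xs(2) p] continuous_on_tendsto_compose[OF g xs(2) p] xs(1) by auto
  moreover have "(\<lambda>k. f (xs k)) = (\<lambda>k. g (xs k))" using eq xs(1) by auto
  ultimately show ?thesis using LIMSEQ_unique by metis
qed

section \<open>Tangent bivectors\<close>

lemma quadratic_vanishing:
  fixes c0 c1 c2 :: complex
  assumes "finite F" "\<And>s. s \<notin> F \<Longrightarrow> c0 + c1 * s + c2 * s^2 = 0"
  shows "c0 = 0" "c1 = 0" "c2 = 0"
proof -
  define c where "c = (\<lambda>k::nat. if k = 0 then c0 else if k = 1 then c1 else c2)"
  have "infinite (- F)" using assms(1) by (simp add: infinite_UNIV_char_0 finite_compl)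
  then have "c k = 0" if "k \<le> 2" for k
    using poly_coeffs_zero[where N="- F" and d=2 and c=c and k=k] assms(2) that
    by (simp add: c_def numeral_2_eq_2)
  from this[of 0] this[of 1] this[of 2] show "c0 = 0" "c1 = 0" "c2 = 0" by (simp_all add: c_def)
qed

text \<open>A relation that is quadratic in \<open>(a, b)\<close> and holds on all of \<open>X_reg\<close> is a multiple of the
  quadratic form of \<open>(a, b)\<close> in the equation: rescaling \<open>(a, b)\<close> turns \<open>(xz - y\<^sup>2)\<^sup>n\<close> into that form.\<close>

lemma quadratic_relation:
  fixes x y z A1 A2 A3 B :: complex
  assumes n: "n \<ge> 2" and q: "x * z - y^2 \<noteq> 0"
    and rel: "\<And>a b. a^2 * x + 2 * a * b * y + b^2 * z = - ((x * z - y^2) ^ n) \<Longrightarrow>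
      A1 * a^2 + 2 * A2 * a * b + A3 * b^2 + (x * z - y^2) ^ (n - 1) * B = 0"
  shows "A1 * (x * z - y^2) = x * B" "A2 * (x * z - y^2) = y * B" "A3 * (x * z - y^2) = z * B"
proof -
  let ?q = "x * z - y^2"
  define H where "H = ?q ^ (n - 1)"
  have qn: "?q ^ n = ?q * H" using n by (simp add: H_def power_eq_if)
  have hom: "(A1 * ?q - x * B) * a^2 + 2 * (A2 * ?q - y * B) * a * b + (A3 * ?q - z * B) * b^2 = 0"
    if h: "a^2 * x + 2 * a * b * y + b^2 * z \<noteq> 0" for a b
  proof -
    let ?h = "a^2 * x + 2 * a * b * y + b^2 * z"
    \<comment> \<open>This factor puts \<open>(r * a, r * b)\<close> on the hypersurface above the
      given x, y, z.\<close>
    define r where "r = csqrt (- (?q ^ n) / ?h)"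
    have "r^2 = - (?q ^ n) / ?h" by (simp add: r_def)
    then have r: "r^2 * ?h = - (?q ^ n)" using h by simp
    have "(r * a)^2 * x + 2 * (r * a) * (r * b) * y + (r * b)^2 * z = r^2 * ?h" by algebra
    from rel[OF this[unfolded r], folded H_def]
    have "r^2 * (A1 * a^2 + 2 * A2 * a * b + A3 * b^2) = - (H * B)" by algebra
    moreover have "r^2 * ?h = - (?q * H)" using r by (simp only: qn)
    ultimately have "H * (?q * (A1 * a^2 + 2 * A2 * a * b + A3 * b^2) - ?h * B) * r^2 = 0"
      by algebra
    moreover have "r \<noteq> 0" using r q by auto
    moreover have "H \<noteq> 0" using q by (simp add: H_def)
    ultimately have "?q * (A1 * a^2 + 2 * A2 * a * b + A3 * b^2) - ?h * B = 0"
      by (metis mult_eq_0_iff power_eq_0_iff)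
    then show ?thesis by algebra
  qed
  \<comment> \<open>The slopes b / a at which the quadratic form vanishes; a form of nonzero
    discriminant has finitely many.\<close>
  define F where "F = {s. x + 2 * y * s + z * s^2 = 0}"
  have "finite F"
  proof (rule ccontr)
    assume inf: "infinite F"
    define c where "c = (\<lambda>k::nat. if k = 0 then x else if k = 1 then 2 * y else z)"
    have "c k = 0" if "k \<le> 2" for k
      using poly_coeffs_zero[where N=F and d=2 and c=c and k=k] inf that
      by (simp add: c_def numeral_2_eq_2 F_def)
    from this[of 0] this[of 1] this[of 2] show False using q by (simp add: c_def)
  qed
  have "(A1 * ?q - x * B) + (2 * (A2 * ?q - y * B)) * s + (A3 * ?q - z * B) * s^2 = 0" if "s \<notin> F" for s
    using hom[of 1 s] that by (simp add: F_def algebra_simps)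
  from quadratic_vanishing[OF \<open>finite F\<close> this]
  show "A1 * ?q = x * B" "A2 * ?q = y * B" "A3 * ?q = z * B" by simp_all
qed

text \<open>R1 to R5 say that the skew matrix with entries \<open>P\<close> annihilates the
  gradient. With linear entries, R3 to R5 are quadratic in (a, b), so
  \<open>quadratic_relation\<close> applies, and evaluation at a few points expresses all constants
  through \<open>\<beta>3\<close>. R1 and R2 then give \<open>P12\<close>, as their coefficients 2(a
  y + b z) and 2 crit have no common zero on \<open>G\<close>.\<close>

lemma tangent_bivector_unique:
  fixes P12 P13 P14 P15 P23 P24 P25 P34 P35 P45 :: "complex^5 \<Rightarrow> complex"
  assumes n: "n \<ge> 2"
    and G: "\<And>p. p \<in> G \<longleftrightarrow> p \<in> X_reg n \<and> p $ 3 \<noteq> 0 \<and> p $ 3 * p $ 5 \<noteq> (p $ 4)^2"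
    and R1: "\<And>p. p \<in> G \<Longrightarrow> grad n p $ 2 * P12 p + grad n p $ 3 * P13 p + grad n p $ 4 * P14 p + grad n p $ 5 * P15 p = 0"
    and R2: "\<And>p. p \<in> G \<Longrightarrow> grad n p $ 1 * P12 p - grad n p $ 3 * P23 p - grad n p $ 4 * P24 p - grad n p $ 5 * P25 p = 0"
    and R3: "\<And>p. p \<in> G \<Longrightarrow> grad n p $ 1 * P13 p + grad n p $ 2 * P23 p - grad n p $ 4 * P34 p - grad n p $ 5 * P35 p = 0"
    and R4: "\<And>p. p \<in> G \<Longrightarrow> grad n p $ 1 * P14 p + grad n p $ 2 * P24 p + grad n p $ 3 * P34 p - grad n p $ 5 * P45 p = 0"
    and R5: "\<And>p. p \<in> G \<Longrightarrow> grad n p $ 1 * P15 p + grad n p $ 2 * P25 p + grad n p $ 3 * P35 p + grad n p $ 4 * P45 p = 0"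
    and F34: "\<And>p. p \<in> G \<Longrightarrow> P34 p = p1 * p $ 3 + p2 * p $ 4 + p3 * p $ 5"
    and F35: "\<And>p. p \<in> G \<Longrightarrow> P35 p = q1 * p $ 3 + q2 * p $ 4 + q3 * p $ 5"
    and F45: "\<And>p. p \<in> G \<Longrightarrow> P45 p = r1 * p $ 3 + r2 * p $ 4 + r3 * p $ 5"
    and F13: "\<And>p. p \<in> G \<Longrightarrow> P13 p = \<alpha>3 * p $ 1 + \<beta>3 * p $ 2" and F23: "\<And>p. p \<in> G \<Longrightarrow> P23 p = \<gamma>3 * p $ 1 + \<delta>3 * p $ 2"
    and F14: "\<And>p. p \<in> G \<Longrightarrow> P14 p = \<alpha>4 * p $ 1 + \<beta>4 * p $ 2" and F24: "\<And>p. p \<in> G \<Longrightarrow> P24 p = \<gamma>4 * p $ 1 + \<delta>4 * p $ 2"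
    and F15: "\<And>p. p \<in> G \<Longrightarrow> P15 p = \<alpha>5 * p $ 1 + \<beta>5 * p $ 2" and F25: "\<And>p. p \<in> G \<Longrightarrow> P25 p = \<gamma>5 * p $ 1 + \<delta>5 * p $ 2"
  shows "\<exists>l. \<forall>p\<in>G. P34 p = l * p $ 3 \<and> P35 p = l * (2 * p $ 4) \<and> P45 p = l * p $ 5 \<and>
     P13 p = l * p $ 2 \<and> P23 p = 0 \<and> P14 p = l * (- p $ 1 / 2) \<and> P24 p = l * (p $ 2 / 2) \<and>
     P15 p = 0 \<and> P25 p = l * (- p $ 1) \<and>
     P12 p = l * (- of_nat n * disc p ^ (n - 1) / 2)"
proof -
  have good: "vec5 a b x y z \<in> G"
    if "x \<noteq> 0" "x * z - y^2 \<noteq> 0" "a^2 * x + 2 * a * b * y + b^2 * z = - ((x * z - y^2) ^ n)" for a b x y z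
  proof -
    have "a \<noteq> 0 \<or> b \<noteq> 0" using that n by (auto simp: zero_power)
    then show ?thesis using that unfolding G X_reg_iff[OF n] by (auto simp: X_eq_def Let_def)
  qed
  have conjD3: "P \<and> Q \<and> R \<Longrightarrow> P" "P \<and> Q \<and> R \<Longrightarrow> Q" "P \<and> Q \<and> R \<Longrightarrow> R" for P Q R by auto
  have S3: "(2 * x * \<alpha>3 + 2 * y * \<gamma>3) * (x * z - y^2) = x * B \<and>
      (x * \<beta>3 + y * \<alpha>3 + y * \<delta>3 + z * \<gamma>3 - (p1 * x + p2 * y + p3 * z)) * (x * z - y^2) = y * B \<and>
      (2 * y * \<beta>3 + 2 * z * \<delta>3 - (q1 * x + q2 * y + q3 * z)) * (x * z - y^2) = z * B"
    if x: "x \<noteq> 0" and q: "x * z - y^2 \<noteq> 0"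
      and B: "B = of_nat n * (2 * y * (p1 * x + p2 * y + p3 * z) - x * (q1 * x + q2 * y + q3 * z))" for x y z B
  proof -
    have rel: "(2 * x * \<alpha>3 + 2 * y * \<gamma>3) * a^2 + 2 * (x * \<beta>3 + y * \<alpha>3 + y * \<delta>3 + z * \<gamma>3 - (p1 * x + p2 * y + p3 * z)) * a * b
        + (2 * y * \<beta>3 + 2 * z * \<delta>3 - (q1 * x + q2 * y + q3 * z)) * b^2 + (x * z - y^2) ^ (n - 1) * B = 0"
      if "a^2 * x + 2 * a * b * y + b^2 * z = - ((x * z - y^2) ^ n)" for a b
      using R3[OF good[OF x q that]] unfolding F34[OF good[OF x q that]] F35[OF good[OF x q that]]
        F13[OF good[OF x q that]] F23[OF good[OF x q that]] grad_simps vec5_simps B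
      by (simp add: algebra_simps power2_eq_square)
    show ?thesis using quadratic_relation[OF n q rel] by blast
  qed
  have S4: "(2 * x * \<alpha>4 + 2 * y * \<gamma>4 + (p1 * x + p2 * y + p3 * z)) * (x * z - y^2) = x * B \<and>
      (x * \<beta>4 + y * \<alpha>4 + y * \<delta>4 + z * \<gamma>4) * (x * z - y^2) = y * B \<and>
      (2 * y * \<beta>4 + 2 * z * \<delta>4 - (r1 * x + r2 * y + r3 * z)) * (x * z - y^2) = z * B"
    if x: "x \<noteq> 0" and q: "x * z - y^2 \<noteq> 0"
      and B: "B = of_nat n * (z * (p1 * x + p2 * y + p3 * z) - x * (r1 * x + r2 * y + r3 * z))" for x y z B
  proof -
    have rel: "(2 * x * \<alpha>4 + 2 * y * \<gamma>4 + (p1 * x + p2 * y + p3 * z)) * a^2 + 2 * (x * \<beta>4 + y * \<alpha>4 + y * \<delta>4 + z * \<gamma>4) * a * b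
        + (2 * y * \<beta>4 + 2 * z * \<delta>4 - (r1 * x + r2 * y + r3 * z)) * b^2 + (x * z - y^2) ^ (n - 1) * B = 0"
      if "a^2 * x + 2 * a * b * y + b^2 * z = - ((x * z - y^2) ^ n)" for a b
      using R4[OF good[OF x q that]] unfolding F34[OF good[OF x q that]] F45[OF good[OF x q that]]
        F14[OF good[OF x q that]] F24[OF good[OF x q that]] grad_simps vec5_simps B
      by (simp add: algebra_simps power2_eq_square)
    show ?thesis using quadratic_relation[OF n q rel] by blast
  qed
  have S5: "(2 * x * \<alpha>5 + 2 * y * \<gamma>5 + (q1 * x + q2 * y + q3 * z)) * (x * z - y^2) = x * B \<and>
      (x * \<beta>5 + y * \<alpha>5 + y * \<delta>5 + z * \<gamma>5 + (r1 * x + r2 * y + r3 * z)) * (x * z - y^2) = y * B \<and>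
      (2 * y * \<beta>5 + 2 * z * \<delta>5) * (x * z - y^2) = z * B"
    if x: "x \<noteq> 0" and q: "x * z - y^2 \<noteq> 0"
      and B: "B = of_nat n * (z * (q1 * x + q2 * y + q3 * z) - 2 * y * (r1 * x + r2 * y + r3 * z))" for x y z B
  proof -
    have rel: "(2 * x * \<alpha>5 + 2 * y * \<gamma>5 + (q1 * x + q2 * y + q3 * z)) * a^2
        + 2 * (x * \<beta>5 + y * \<alpha>5 + y * \<delta>5 + z * \<gamma>5 + (r1 * x + r2 * y + r3 * z)) * a * b
        + (2 * y * \<beta>5 + 2 * z * \<delta>5) * b^2 + (x * z - y^2) ^ (n - 1) * B = 0"
      if "a^2 * x + 2 * a * b * y + b^2 * z = - ((x * z - y^2) ^ n)" for a b
      using R5[OF good[OF x q that]] unfolding F35[OF good[OF x q that]] F45[OF good[OF x q that]]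
        F15[OF good[OF x q that]] F25[OF good[OF x q that]] grad_simps vec5_simps B
      by (simp add: algebra_simps power2_eq_square)
    show ?thesis using quadratic_relation[OF n q rel] by blast
  qed
  \<comment> \<open>For \<open>x = 1\<close> the first of the three relations reads
    \<open>A1 * q = B\<close>, so \<open>B\<close> can be eliminated and \<open>q\<close>
    cancelled.\<close>
  have elim: "zz * A1 = A3" "yy * A1 = A2" if "A1 * q = B" "A2 * q = yy * B" "A3 * q = zz * B" "q \<noteq> 0" for A1 A2 A3 B q yy zz :: complex
  proof -
    have "q * (zz * A1 - A3) = zz * (A1 * q) - A3 * q" by (simp add: algebra_simps)
    then have "q * (zz * A1 - A3) = 0" unfolding that by simp
    moreover have "q * (yy * A1 - A2) = yy * (A1 * q) - A2 * q" by (simp add: algebra_simps)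
    then have "q * (yy * A1 - A2) = 0" unfolding that by simp
    ultimately show "zz * A1 = A3" "yy * A1 = A2" using that(4) by auto
  qed
  note S3' = conjD3[OF S3[of 1, OF one_neq_zero _ refl, unfolded mult_1 mult_1_right]]
    and S5' = conjD3[OF S5[of 1, OF one_neq_zero _ refl, unfolded mult_1 mult_1_right]]
    and S4' = conjD3[OF S4[of 1, OF one_neq_zero _ refl, unfolded mult_1 mult_1_right]]
  have E3: "z * (2 * \<alpha>3 + 2 * y * \<gamma>3) = 2 * y * \<beta>3 + 2 * z * \<delta>3 - (q1 + q2 * y + q3 * z)"
     "y * (2 * \<alpha>3 + 2 * y * \<gamma>3) = \<beta>3 + y * \<alpha>3 + y * \<delta>3 + z * \<gamma>3 - (p1 + p2 * y + p3 * z)" if "z - y^2 \<noteq> 0" for y z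
    using elim[OF S3'[OF that] that] by simp_all
  have E5: "z * (2 * \<alpha>5 + 2 * y * \<gamma>5 + (q1 + q2 * y + q3 * z)) = 2 * y * \<beta>5 + 2 * z * \<delta>5"
     "y * (2 * \<alpha>5 + 2 * y * \<gamma>5 + (q1 + q2 * y + q3 * z)) = \<beta>5 + y * \<alpha>5 + y * \<delta>5 + z * \<gamma>5 + (r1 + r2 * y + r3 * z)" if "z - y^2 \<noteq> 0" for y z
    using elim[OF S5'[OF that] that] by simp_all
  \<comment> \<open>The numbers substituted here and below are pairs (y, z) off the parabola z =
    y^2, where the relations hold.\<close>
  have q1: "q1 = 0" using E3(1)[of 0 1, simplified] E3(1)[of 0 2, simplified] by algebra
  have q2: "q2 = 2 * \<beta>3" using E3(1)[of 0 1, simplified] q1 by algebra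
  have q3: "q3 = 2 * \<delta>3 - 2 * \<alpha>3" using E3(1)[of 1 0, simplified] q1 by algebra
  have g3: "\<gamma>3 = 0" using E3(1)[of 2 1, simplified] q1 q2 q3 by algebra
  have p3: "p3 = 0" using E3(2)[of 1 0, simplified] E3(2)[of 2 0, simplified] g3 by algebra
  have p1: "p1 = \<beta>3" using E3(2)[of 1 0, simplified] g3 p3 by algebra
  have p2: "p2 = \<delta>3 - \<alpha>3" using E3(2)[of 0 1, simplified] g3 p3 p1 by algebra
  have b5: "\<beta>5 = 0" using E5(1)[of 0 1] by simp
  have q3': "q3 = 0" using E5(1)[of 1 0, simplified] E5(1)[of 2 0, simplified] q1 b5 by algebra
  have d5: "\<alpha>5 = \<delta>5" using E5(1)[of 1 0] q1 q3' b5 by simp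
  have g5: "\<gamma>5 = - \<beta>3" using E5(1)[of 2 1, simplified] q1 q2 q3' b5 d5 by algebra
  have a3: "\<alpha>3 = \<delta>3" using q3 q3' by simp
  have p2': "p2 = 0" using p2 a3 by simp
  have r1: "r1 = 0" using E5(2)[of 1 0, simplified] E5(2)[of 2 0, simplified] b5 g5 by algebra
  have r3: "r3 = \<beta>3" using E5(2)[of 1 0, simplified] b5 g5 r1 by algebra
  have r2: "r2 = 0" using E5(2)[of 0 1, simplified] q1 q2 q3' b5 g5 d5 r1 r3 by algebra
  have a5: "\<alpha>5 = 0" using S5'(1)[of 1 0] q1 q2 q3' r1 r2 r3 by simp
  have a30: "\<alpha>3 = 0" using S3'(1)[of 1 0] q1 q3' g3 by simp
  have E4: "2 * \<alpha>4 + 2 * y * \<gamma>4 + \<beta>3 = 0" "2 * y * \<beta>4 + 2 * z * \<delta>4 - \<beta>3 * z = 0" if "z - y^2 \<noteq> 0" for y z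
    using S4'(1,3)[OF that] that unfolding p1 p2' p3 r1 r2 r3 by (simp_all add: mult.commute)
  have g4: "\<gamma>4 = 0" using E4(1)[of 1 0, simplified] E4(1)[of 0 1, simplified] by algebra
  have a4: "\<alpha>4 = - \<beta>3 / 2" using E4(1)[of 1 0] by (simp add: field_simps eq_neg_iff_add_eq_0)
  have b4: "\<beta>4 = 0" using E4(2)[of 0 1] by simp
  have d4: "\<delta>4 = \<beta>3 / 2" using E4(2)[of 1 0] by (simp add: field_simps)
  have fin: "P34 p = \<beta>3 * p $ 3 \<and> P35 p = \<beta>3 * (2 * p $ 4) \<and> P45 p = \<beta>3 * p $ 5 \<and>
     P13 p = \<beta>3 * p $ 2 \<and> P23 p = 0 \<and> P14 p = \<beta>3 * (- p $ 1 / 2) \<and> P24 p = \<beta>3 * (p $ 2 / 2) \<and>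
     P15 p = 0 \<and> P25 p = \<beta>3 * (- p $ 1)" if "p \<in> G" for p
    using a3 by (simp add: F34[OF that] F35[OF that] F45[OF that] F13[OF that] F23[OF that] F14[OF that]
        F24[OF that] F15[OF that] F25[OF that] q1 q2 q3' p1 p2' p3 r1 r2 r3 g3 a30 b5 d5[symmetric] g5 a5 g4 a4 b4 d4)
  have P12: "P12 p = \<beta>3 * (- of_nat n * disc p ^ (n - 1) / 2)" if p: "p \<in> G" for p
  proof -
    define Q where "Q = disc p ^ (n - 1)"
    define N :: complex where "N = of_nat n"
    have "2 * (p $ 1 * p $ 4 + p $ 2 * p $ 5) * (2 * P12 p + \<beta>3 * N * Q) = 0"
      using R1[OF p] fin[OF p] unfolding grad_simps Q_def[symmetric] N_def[symmetric] by simp algebra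
    moreover have "2 * crit p * (2 * P12 p + \<beta>3 * N * Q) = 0"
      using R2[OF p] fin[OF p] unfolding grad_simps Q_def[symmetric] N_def[symmetric] by simp algebra
    moreover have "p $ 1 * p $ 4 + p $ 2 * p $ 5 \<noteq> 0 \<or> crit p \<noteq> 0"
    proof (rule ccontr)
      assume "\<not> ?thesis"
      then have e: "p $ 1 * p $ 4 + p $ 2 * p $ 5 = 0" "crit p = 0" by auto
      have "p $ 1 * disc p = 0" using e by algebra
      moreover have "p $ 2 * disc p = 0" using e by algebra
      ultimately show False using p unfolding G X_reg_iff[OF n] by auto
    qed
    ultimately have "2 * P12 p + \<beta>3 * N * Q = 0" by (metis mult_eq_0_iff zero_neq_numeral)
    then show ?thesis unfolding Q_def[symmetric] N_def[symmetric] by (simp add: add_eq_0_iff) algebra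
  qed
  show ?thesis using fin P12 by blast
qed

section \<open>The symplectic form\<close>

text \<open>Minus the bracket of a and b. Treated as an indeterminate, it turns the identities below
  into polynomial ones without the exponent \<open>n - 1\<close>.\<close>

definition hq :: "nat \<Rightarrow> complex^5 \<Rightarrow> complex" where
  "hq n p = of_nat n * disc p ^ (n - 1) / 2"

lemma grad_hq:
  "grad n p $ 1 = 2 * crit p" "grad n p $ 2 = 2 * (p $ 1 * p $ 4 + p $ 2 * p $ 5)"
  "grad n p $ 3 = (p $ 1)^2 + 2 * hq n p * p $ 5" "grad n p $ 4 = 2 * p $ 1 * p $ 2 - 4 * hq n p * p $ 4"
  "grad n p $ 5 = (p $ 2)^2 + 2 * hq n p * p $ 3"
  by (simp_all add: grad_simps hq_def)

lemma double_half: "2 * c / 2 = c" "- (2 * c) / 2 = - c" for c :: complex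
  by simp_all

text \<open>\<open>tau n p u v $ r\<close> is the value at \<open>(u, v, e\<^sub>r)\<close> of the contraction of \<open>da db dx dy dz\<close> with the Poisson
  bivector; for tangent vectors it must be \<open>omega0 u v\<close> times the gradient.\<close>

definition tau :: "nat \<Rightarrow> complex^5 \<Rightarrow> complex^5 \<Rightarrow> complex^5 \<Rightarrow> complex^5" where
  "tau n p u v = (let w = (\<lambda>k l. u $ k * v $ l - u $ l * v $ k);
      a = p $ 1; b = p $ 2; x = p $ 3; y = p $ 4; z = p $ 5; h = hq n p
    in vec5
      (z * w 2 3 - 2 * y * w 2 4 + x * w 2 5 - a * w 3 4 - b / 2 * w 3 5)
      (- z * w 1 3 + 2 * y * w 1 4 - x * w 1 5 - a / 2 * w 3 5 - b * w 4 5)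
      (z * w 1 2 + a * w 1 4 + b / 2 * w 1 5 + a / 2 * w 2 5 - h * w 4 5)
      (- 2 * y * w 1 2 - a * w 1 3 + b * w 2 5 + h * w 3 5)
      (x * w 1 2 - b / 2 * w 1 3 - a / 2 * w 2 3 - b * w 2 4 - h * w 3 4))"

lemma tau_simps:
  fixes n :: nat and p u v :: "complex^5"
  defines "w \<equiv> \<lambda>k l. u $ k * v $ l - u $ l * v $ k"
    and "h \<equiv> hq n p"
  shows
  "tau n p u v $ 1 = p $ 5 * w 2 3 - 2 * p $ 4 * w 2 4 + p $ 3 * w 2 5 - p $ 1 * w 3 4 - p $ 2 / 2 * w 3 5"
  "tau n p u v $ 2 = - p $ 5 * w 1 3 + 2 * p $ 4 * w 1 4 - p $ 3 * w 1 5 - p $ 1 / 2 * w 3 5 - p $ 2 * w 4 5"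
  "tau n p u v $ 3 = p $ 5 * w 1 2 + p $ 1 * w 1 4 + p $ 2 / 2 * w 1 5 + p $ 1 / 2 * w 2 5 - h * w 4 5"
  "tau n p u v $ 4 = - 2 * p $ 4 * w 1 2 - p $ 1 * w 1 3 + p $ 2 * w 2 5 + h * w 3 5"
  "tau n p u v $ 5 = p $ 3 * w 1 2 - p $ 2 / 2 * w 1 3 - p $ 1 / 2 * w 2 3 - p $ 2 * w 2 4 - h * w 3 4"
  by (simp_all add: tau_def Let_def w_def h_def)

lemma axis_5_simps:
  "axis (1::5) (c::complex) = vec5 c 0 0 0 0" "axis (2::5) c = vec5 0 c 0 0 0" "axis (3::5) c = vec5 0 0 c 0 0"
  "axis (4::5) c = vec5 0 0 0 c 0" "axis (5::5) c = vec5 0 0 0 0 c"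
  by (simp_all add: vec_eq_iff forall_5) (simp_all add: axis_def)

text \<open>The Poisson bivector annihilates dX, so dX wedged with the contracted volume form is 0;
  this is that identity on u, v and two basis vectors. For tangent u and v it makes
  \<open>tau\<close> proportional to the gradient.\<close>

lemma tau_relation:
  "r = s \<or> grad n p $ s * tau n p u v $ r - grad n p $ r * tau n p u v $ s =
     dX n p u * tau n p v (axis r 1) $ s - dX n p v * tau n p u (axis r 1) $ s"
proof -
  \<comment> \<open>Writing the coordinates a and b as doubles clears the halves in
    \<open>tau\<close> and leaves polynomial identities.\<close>
  define a b where "a = p $ 1 / 2" and "b = p $ 2 / 2"
  have ab: "p $ 1 = 2 * a" "p $ 2 = 2 * b" by (simp_all add: a_def b_def)
  have ne: "(1::5) \<noteq> 2" "(1::5) \<noteq> 3" "(1::5) \<noteq> 4" "(1::5) \<noteq> 5" "(2::5) \<noteq> 3" "(2::5) \<noteq> 4" "(2::5) \<noteq> 5" "(3::5) \<noteq> 4" "(3::5) \<noteq> 5" "(4::5) \<noteq> 5"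
    by simp_all
  have "\<forall>r s. r = s \<or> grad n p $ s * tau n p u v $ r - grad n p $ r * tau n p u v $ s =
     dX n p u * tau n p v (axis r 1) $ s - dX n p v * tau n p u (axis r 1) $ s"
    unfolding forall_5
    by (intro conjI; simp only: tau_simps dX_def sum_5 grad_hq axis_5_simps vec5_simps ab double_half
          simp_thms ne ne[symmetric] mult_zero_left mult_zero_right add_0_left add_0_right diff_0_right diff_0
          minus_zero mult_1_left mult_1_right; algebra)
  then show ?thesis by blast
qed

text \<open>The Hamiltonian vector fields of the coordinate functions; by \<open>tau_ham\<close> they invert \<open>omega0\<close>
  up to the factor \<open>-1/2\<close>.\<close>

definition ham :: "nat \<Rightarrow> complex^5 \<Rightarrow> 5 \<Rightarrow> complex^5" where
  "ham n p i = (let a = p $ 1; b = p $ 2; x = p $ 3; y = p $ 4; z = p $ 5; h = hq n p in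
     if i = 1 then vec5 0 (- h) b (- a / 2) 0 else if i = 2 then vec5 h 0 0 (b / 2) (- a)
     else if i = 3 then vec5 (- b) 0 0 x (2 * y) else if i = 4 then vec5 (a / 2) (- b / 2) (- x) 0 z
     else vec5 0 a (- 2 * y) (- z) 0)"

lemma ham_simps:
  fixes n :: nat and p :: "complex^5"
  defines "h \<equiv> hq n p"
  shows "ham n p 1 = vec5 0 (- h) (p $ 2) (- p $ 1 / 2) 0" "ham n p 2 = vec5 h 0 0 (p $ 2 / 2) (- p $ 1)"
    "ham n p 3 = vec5 (- p $ 2) 0 0 (p $ 3) (2 * p $ 4)" "ham n p 4 = vec5 (p $ 1 / 2) (- p $ 2 / 2) (- p $ 3) 0 (p $ 5)"
    "ham n p 5 = vec5 0 (p $ 1) (- 2 * p $ 4) (- p $ 5) 0"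
  by (simp_all add: ham_def Let_def h_def)

lemma dX_ham: "dX n p (ham n p i) = 0"
proof -
  define a b where "a = p $ 1 / 2" and "b = p $ 2 / 2"
  have ab: "p $ 1 = 2 * a" "p $ 2 = 2 * b" by (simp_all add: a_def b_def)
  show ?thesis
    using exhaust_5[of i]
    by (elim disjE; simp only: ham_simps dX_def sum_5 grad_hq vec5_simps ab double_half mult_zero_left mult_zero_right add_0_left add_0_right diff_0_right; simp add: algebra_simps power2_eq_square)
qed

text \<open>The right side is minus the value of dx_i wedge dX on \<open>u\<close> and the r-th
  basis vector. The identity holds because the square of the Poisson bivector is dual to dX: its
  4-by-4 Pfaffians are, up to sign, half the components of the gradient.\<close>

lemma tau_ham:
  "2 * tau n p u (ham n p i) $ r = (if i = r then dX n p u else 0) - grad n p $ r * u $ i"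
proof -
  define a b where "a = p $ 1 / 2" and "b = p $ 2 / 2"
  have ab: "p $ 1 = 2 * a" "p $ 2 = 2 * b" by (simp_all add: a_def b_def)
  have ne: "(1::5) \<noteq> 2" "(1::5) \<noteq> 3" "(1::5) \<noteq> 4" "(1::5) \<noteq> 5" "(2::5) \<noteq> 3" "(2::5) \<noteq> 4" "(2::5) \<noteq> 5" "(3::5) \<noteq> 4" "(3::5) \<noteq> 5" "(4::5) \<noteq> 5"
    by simp_all
  have "\<forall>i r. 2 * tau n p u (ham n p i) $ r = (if i = r then dX n p u else 0) - grad n p $ r * u $ i"
    unfolding forall_5
    by (intro conjI; simp only: ham_simps tau_simps dX_def sum_5 grad_hq vec5_simps
       ne ne[symmetric] if_True if_False refl simp_thms ab double_half mult_zero_left mult_zero_right add_0_left add_0_right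
       diff_0_right diff_0 minus_zero mult_1_left mult_1_right; simp add: algebra_simps power2_eq_square)
  then show ?thesis by blast
qed

lemma tau_bilinear:
  "tau n p (u + v) w = tau n p u w + tau n p v w" "tau n p w (u + v) = tau n p w u + tau n p w v"
  "tau n p (c *s u) v = c *s tau n p u v" "tau n p u (c *s v) = c *s tau n p u v" "tau n p u u = 0"
  unfolding vec_eq_iff forall_5
  by (simp_all add: tau_simps field_simps)

text \<open>A residue of the contracted volume form along the hypersurface. For tangent vectors the
  quotient is the same for every admissible \<open>r\<close>, by
  \<open>tau_relation\<close>.\<close>

definition omega0 :: "nat \<Rightarrow> 5 form2" where
  "omega0 n p u v = (let r = SOME r. grad n p $ r \<noteq> 0 in tau n p u v $ r / grad n p $ r)"

lemma omega0_eq: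
  assumes r: "grad n p $ r \<noteq> 0" and u: "u \<in> X_tangent n p" and v: "v \<in> X_tangent n p"
  shows "omega0 n p u v = tau n p u v $ r / grad n p $ r"
proof -
  define s where "s = (SOME s. grad n p $ s \<noteq> 0)"
  have s: "grad n p $ s \<noteq> 0" unfolding s_def using r by (rule someI)
  have "grad n p $ s * tau n p u v $ r = grad n p $ r * tau n p u v $ s"
    using tau_relation[of r s n p u v] u v by (auto simp: X_tangent_iff)
  then show ?thesis
    unfolding omega0_def Let_def s_def[symmetric] using r s by (simp add: field_simps)
qed

lemma omega0_alternating:
  assumes n: "n \<ge> 2" and p: "p \<in> X_reg n"
  shows "alternating_bilinear_on (X_tangent n p) (omega0 n p)"
  unfolding alternating_bilinear_on_def omega0_def Let_def
  by (simp add: tau_bilinear add_divide_distrib)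

text \<open>Pairing a tangent \<open>u\<close> with \<open>ham n p i\<close> gives
  \<open>- u $ i / 2\<close>, so the kernel is zero.\<close>

lemma omega0_nondegenerate:
  assumes n: "n \<ge> 2" and p: "p \<in> X_reg n"
  shows "nondegenerate_on (X_tangent n p) (omega0 n p)"
  unfolding nondegenerate_on_def
proof (intro ballI impI)
  fix u assume u: "u \<in> X_tangent n p" and z: "\<forall>v\<in>X_tangent n p. omega0 n p u v = 0"
  obtain r where r: "grad n p $ r \<noteq> 0" using X_regE[OF n p] .
  have "u $ i = 0" for i
  proof -
    have h: "ham n p i \<in> X_tangent n p" by (simp add: X_tangent_iff dX_ham)
    have "tau n p u (ham n p i) $ r = 0" using z h omega0_eq[OF r u h] r by simp
    then show ?thesis using tau_ham[of n p u i r] u r by (auto simp: X_tangent_iff split: if_splits)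
  qed
  then show "u = 0" by (simp add: vec_eq_iff)
qed

lemma tau_action:
  assumes "n \<ge> 2"
  shows "t ^ X_weight n r * tau n (X_action n t p) (X_action n t u) (X_action n t v) $ r = t ^ (4 * n + 2) * tau n p u v $ r"
proof -
  obtain m where m: "n = Suc m" using assms by (cases n) auto
  define T where "T = t ^ m"
  have 1: "t ^ (2 * n - 1) = T^2 * t" "t ^ (4 * n + 2) = T^4 * t^6"
    by (simp_all add: T_def m power_add power_mult[symmetric] mult.commute)
  have 2: "hq n (X_action n t p) = T^4 * hq n p"
  proof -
    have "(t^2 * p $ 3) * (t^2 * p $ 5) - (t^2 * p $ 4)^2 = t^4 * disc p" by algebra
    then have "((t^2 * p $ 3) * (t^2 * p $ 5) - (t^2 * p $ 4)^2) ^ (n - 1) = T^4 * disc p ^ (n - 1)"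
      by (simp add: T_def power_mult_distrib power_mult[symmetric] m mult.commute)
    then show ?thesis by (simp add: hq_def X_action_simps)
  qed
  show ?thesis
    using exhaust_5[of r]
    by (elim disjE; simp only: X_weight_simps tau_simps 2 X_action_simps 1; simp add: field_simps eval_nat_numeral)
qed

lemma omega0_weight:
  assumes n: "n \<ge> 2"
  shows "has_weight n (omega0 n) 2"
  unfolding has_weight_def pullback_def frechet_X_action
proof (intro allI impI ballI)
  fix t :: complex and p u v :: "complex^5"
  assume t: "t \<noteq> 0" and p: "p \<in> X_reg n" and u: "u \<in> X_tangent n p" and v: "v \<in> X_tangent n p"
  obtain r where r: "grad n p $ r \<noteq> 0" using X_regE[OF n p] .
  have g: "t ^ X_weight n r * grad n (X_action n t p) $ r = t ^ (4 * n) * grad n p $ r" by (rule grad_action[OF n])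
  then have r': "grad n (X_action n t p) $ r \<noteq> 0" using r t by auto
  have tu: "X_action n t u \<in> X_tangent n (X_action n t p)" "X_action n t v \<in> X_tangent n (X_action n t p)"
    using u v by (simp_all add: X_tangent_iff dX_action[OF n])
  have "omega0 n (X_action n t p) (X_action n t u) (X_action n t v)
      = (t ^ X_weight n r * tau n (X_action n t p) (X_action n t u) (X_action n t v) $ r) / (t ^ X_weight n r * grad n (X_action n t p) $ r)"
    using t by (simp add: omega0_eq[OF r' tu])
  also have "\<dots> = t^2 * (tau n p u v $ r / grad n p $ r)"
    unfolding tau_action[OF n] g using t by (simp add: power_add power2_eq_square)
  finally show "omega0 n (X_action n t p) (X_action n t u) (X_action n t v) = t powi 2 * omega0 n p u v"
    by (simp add: omega0_eq[OF r u v])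
qed

section \<open>Proportionality of forms of weight 2\<close>

lemma wedge_coeff_weighted:
  assumes "n \<ge> 2" "holomorphic_2form n \<omega>" "has_weight n \<omega> 2"
    "W + (X_weight n k + X_weight n l + X_weight n m) = 4 * n + 2"
  shows "weighted n W (wedge_coeff n \<omega> k l m)"
  unfolding weighted_def using wedge_coeff_action[OF assms(1,2,3) _ _ assms(4)] by blast

text \<open>On the hypersurface
  \<open>crit p ^ 2 = - p $ 3 * disc p ^ n - (p $ 2)^2 * disc p\<close>, so
  \<open>disc p = 0\<close> forces \<open>crit p = 0\<close>.\<close>

lemma X_reg_square_relation:
  fixes p :: "complex^5"
  assumes n: "n \<ge> 2" and p: "p \<in> X_reg n" and c: "crit p \<noteq> 0"
  shows "p $ 3 * p $ 5 \<noteq> (p $ 4)^2"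
proof
  assume q: "p $ 3 * p $ 5 = (p $ 4)^2"
  have "(p $ 1)^2 * p $ 3 + 2 * p $ 1 * p $ 2 * p $ 4 + (p $ 2)^2 * p $ 5 = 0"
    using p q n by (simp add: X_reg_iff[OF n] X_eq_def Let_def zero_power)
  with q have "crit p^2 = 0" by algebra
  then show False using c by simp
qed

text \<open>The components of the 3-form are those of a bivector with complementary indices. Weights
  and tangency determine them up to one scalar where x and x z - y^2 are nonzero, and density
  extends this to \<open>X_reg\<close>. Evaluating the 3-form on u, v and a normal gives back the
  form.\<close>

lemma weight_2_form_proportional:
  assumes n: "n \<ge> 2" and \<omega>: "holomorphic_2form n \<omega>" and wt: "has_weight n \<omega> 2"
  obtains l where "\<And>p u v. p \<in> X_reg n \<Longrightarrow> u \<in> X_tangent n p \<Longrightarrow> v \<in> X_tangent n p \<Longrightarrow> \<omega> p u v = l * omega0 n p u v"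
proof -
  define T where "T = wedge_coeff n \<omega>"
  have alt: "alternating_bilinear_on (X_tangent n p) (\<omega> p)" if "p \<in> X_reg n" for p
    using \<omega> that unfolding holomorphic_2form_def by blast
  have nor: "\<exists>N. dX n p N = 1" if "p \<in> X_reg n" for p
    using X_regE[OF n that] dX_axis_normal by metis
  have reg: "regular_fun (X_reg n) (T i j k)" for i j k
    unfolding T_def by (rule wedge_coeff_regular[OF n \<omega>])
  have perm: "T j i k p = - T i j k p" "T j k i p = T i j k p" if p: "p \<in> X_reg n" for i j k p
  proof -
    obtain N where N: "dX n p N = 1" using nor[OF p] by blast
    note e = wedge_coeff_eq[where \<omega>=\<omega>, OF alt[OF p] N]
    show "T j i k p = - T i j k p"
      unfolding T_def e by (rule wedge_dX_anti[where \<omega>=\<omega>, OF alt[OF p] N])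
    show "T j k i p = T i j k p"
      unfolding T_def e by (rule wedge_dX_cyclic[where \<omega>=\<omega>, OF alt[OF p], symmetric])
  qed
  have rel: "grad n p $ i * T j k m p - grad n p $ j * T i k m p + grad n p $ k * T i j m p - grad n p $ m * T i j k p = 0"
    if p: "p \<in> X_reg n" for i j k m p
  proof -
    obtain N where N: "dX n p N = 1" using nor[OF p] by blast
    show ?thesis
      using wedge_dX_relation[where \<omega>=\<omega>, OF alt[OF p] N, of "axis i 1" "axis j 1" "axis k 1" "axis m 1"]
      by (simp add: T_def wedge_coeff_eq[where \<omega>=\<omega>, OF alt[OF p] N] dX_axis)
  qed
  \<comment> \<open>Two indices of weight 2n - 1 and one of weight 2 leave 2 out of 4n + 2; one of
    weight 2n - 1 and two of weight 2 leave 2n - 1.\<close>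
  have w2: "weighted n 2 (T 1 2 5)" "weighted n 2 (T 1 2 4)" "weighted n 2 (T 1 2 3)"
    unfolding T_def by (intro wedge_coeff_weighted[OF n \<omega> wt]; use n in \<open>simp add: X_weight_simps\<close>)+
  have wo: "weighted n (2 * n - 1) (T i j k)" if "X_weight n i = 2 * n - 1" "X_weight n j = 2" "X_weight n k = 2" for i j k
    unfolding T_def by (intro wedge_coeff_weighted[OF n \<omega> wt]) (use n that in simp)
  define G where "G = {p \<in> X_reg n. p $ 3 \<noteq> 0 \<and> p $ 3 * p $ 5 \<noteq> (p $ 4)^2}"
  have c2: "\<exists>c1 c2 c3. \<forall>p\<in>G. g p = c1 * p $ 3 + c2 * p $ 4 + c3 * p $ 5" if "regular_fun (X_reg n) g" "weighted n 2 g" for g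
    using weight_2_classification[OF n that] unfolding G_def by (metis (mono_tags, lifting) mem_Collect_eq)
  have co: "\<exists>c1 c2. \<forall>p\<in>G. g p = c1 * p $ 1 + c2 * p $ 2" if "regular_fun (X_reg n) g" "weighted n (2 * n - 1) g" for g
    using weight_odd_classification[OF n that] unfolding G_def by (metis (mono_tags, lifting) mem_Collect_eq)
  obtain p1 p2 p3 where F34: "\<forall>p\<in>G. T 1 2 5 p = p1 * p $ 3 + p2 * p $ 4 + p3 * p $ 5" using c2[OF reg w2(1)] by blast
  obtain q1 q2 q3 where F35: "\<forall>p\<in>G. T 1 2 4 p = q1 * p $ 3 + q2 * p $ 4 + q3 * p $ 5" using c2[OF reg w2(2)] by blast
  obtain r1 r2 r3 where F45: "\<forall>p\<in>G. T 1 2 3 p = r1 * p $ 3 + r2 * p $ 4 + r3 * p $ 5" using c2[OF reg w2(3)] by blast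
  obtain a3 b3 where F13: "\<forall>p\<in>G. T 2 4 5 p = a3 * p $ 1 + b3 * p $ 2" using co[OF reg wo[OF X_weight_simps(2,4,5)]] by blast
  obtain c3 d3 where F23: "\<forall>p\<in>G. T 1 4 5 p = c3 * p $ 1 + d3 * p $ 2" using co[OF reg wo[OF X_weight_simps(1,4,5)]] by blast
  obtain a4 b4 where F14: "\<forall>p\<in>G. T 2 3 5 p = a4 * p $ 1 + b4 * p $ 2" using co[OF reg wo[OF X_weight_simps(2,3,5)]] by blast
  obtain c4 d4 where F24: "\<forall>p\<in>G. T 1 3 5 p = c4 * p $ 1 + d4 * p $ 2" using co[OF reg wo[OF X_weight_simps(1,3,5)]] by blast
  obtain a5 b5 where F15: "\<forall>p\<in>G. T 2 3 4 p = a5 * p $ 1 + b5 * p $ 2" using co[OF reg wo[OF X_weight_simps(2,3,4)]] by blast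
  obtain c5 d5 where F25: "\<forall>p\<in>G. T 1 3 4 p = c5 * p $ 1 + d5 * p $ 2" using co[OF reg wo[OF X_weight_simps(1,3,4)]] by blast
  have "\<exists>l. \<forall>p\<in>G. T 1 2 5 p = l * p $ 3 \<and> - T 1 2 4 p = l * (2 * p $ 4) \<and> T 1 2 3 p = l * p $ 5 \<and>
     - T 2 4 5 p = l * p $ 2 \<and> T 1 4 5 p = 0 \<and> T 2 3 5 p = l * (- p $ 1 / 2) \<and> - T 1 3 5 p = l * (p $ 2 / 2) \<and>
     - T 2 3 4 p = 0 \<and> T 1 3 4 p = l * (- p $ 1) \<and>
     T 3 4 5 p = l * (- of_nat n * disc p ^ (n - 1) / 2)"
  \<comment> \<open>Each bivector entry is the component with the complementary indices, with the
    sign of the corresponding permutation of 1 to 5.\<close>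
  proof (rule tangent_bivector_unique[where ?P34.0="T 1 2 5" and ?P35.0="\<lambda>p. - T 1 2 4 p" and ?P45.0="T 1 2 3"
        and ?P13.0="\<lambda>p. - T 2 4 5 p" and ?P23.0="T 1 4 5" and ?P14.0="T 2 3 5" and ?P24.0="\<lambda>p. - T 1 3 5 p"
        and ?P15.0="\<lambda>p. - T 2 3 4 p" and ?P25.0="T 1 3 4" and ?P12.0="T 3 4 5" and G=G
        and ?p1.0=p1 and ?p2.0=p2 and ?p3.0=p3 and ?q1.0="-q1" and ?q2.0="-q2" and ?q3.0="-q3" and ?r1.0=r1 and ?r2.0=r2 and ?r3.0=r3
        and ?\<alpha>3.0="-a3" and ?\<beta>3.0="-b3" and ?\<gamma>3.0=c3 and ?\<delta>3.0=d3 and ?\<alpha>4.0=a4 and ?\<beta>4.0=b4 and ?\<gamma>4.0="-c4" and ?\<delta>4.0="-d4"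
        and ?\<alpha>5.0="-a5" and ?\<beta>5.0="-b5" and ?\<gamma>5.0=c5 and ?\<delta>5.0=d5, OF n])
    fix p
    show "p \<in> G \<longleftrightarrow> p \<in> X_reg n \<and> p $ 3 \<noteq> 0 \<and> p $ 3 * p $ 5 \<noteq> (p $ 4)^2" by (simp add: G_def)
    assume pG: "p \<in> G"
    then have p: "p \<in> X_reg n" by (simp add: G_def)
    show "grad n p $ 2 * T 3 4 5 p + grad n p $ 3 * - T 2 4 5 p + grad n p $ 4 * T 2 3 5 p + grad n p $ 5 * - T 2 3 4 p = 0"
      using rel[OF p, of 2 3 4 5] by simp
    show "grad n p $ 1 * T 3 4 5 p - grad n p $ 3 * T 1 4 5 p - grad n p $ 4 * - T 1 3 5 p - grad n p $ 5 * T 1 3 4 p = 0"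
      using rel[OF p, of 1 3 4 5] by simp
    show "grad n p $ 1 * - T 2 4 5 p + grad n p $ 2 * T 1 4 5 p - grad n p $ 4 * T 1 2 5 p - grad n p $ 5 * - T 1 2 4 p = 0"
      using rel[OF p, of 1 2 4 5] by algebra
    show "grad n p $ 1 * T 2 3 5 p + grad n p $ 2 * - T 1 3 5 p + grad n p $ 3 * T 1 2 5 p - grad n p $ 5 * T 1 2 3 p = 0"
      using rel[OF p, of 1 2 3 5] by simp
    show "grad n p $ 1 * - T 2 3 4 p + grad n p $ 2 * T 1 3 4 p + grad n p $ 3 * - T 1 2 4 p + grad n p $ 4 * T 1 2 3 p = 0"
      using rel[OF p, of 1 2 3 4] by algebra
  qed (use F34 F35 F45 F13 F23 F14 F24 F15 F25 in simp_all)
  then obtain l where l: "\<forall>p\<in>G. T 1 2 5 p = l * p $ 3 \<and> - T 1 2 4 p = l * (2 * p $ 4) \<and> T 1 2 3 p = l * p $ 5 \<and>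
     - T 2 4 5 p = l * p $ 2 \<and> T 1 4 5 p = 0 \<and> T 2 3 5 p = l * (- p $ 1 / 2) \<and> - T 1 3 5 p = l * (p $ 2 / 2) \<and>
     - T 2 3 4 p = 0 \<and> T 1 3 4 p = l * (- p $ 1) \<and>
     T 3 4 5 p = l * (- of_nat n * disc p ^ (n - 1) / 2)" by blast
  have ext: "f p = g p" if "regular_fun (X_reg n) f" "continuous_on UNIV g" "\<And>p. p \<in> G \<Longrightarrow> f p = g p" "p \<in> X_reg n" for f g p
  proof (rule eq_on_X_reg[OF n _ _ _ that(4)])
    show "continuous_on (X_reg n) f" using that(1) by (simp add: regular_fun_def)
    show "continuous_on (X_reg n) g" using that(2) continuous_on_subset by blast
    show "p \<in> X_reg n \<Longrightarrow> p $ 3 \<noteq> 0 \<Longrightarrow> crit p \<noteq> 0 \<Longrightarrow> f p = g p" for p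
      using that(3)[of p] X_reg_square_relation[OF n] by (simp add: G_def)
  qed
  have val: "T 1 2 5 p = l * p $ 3" "T 1 2 4 p = - (l * (2 * p $ 4))" "T 1 2 3 p = l * p $ 5"
    "T 2 4 5 p = - (l * p $ 2)" "T 1 4 5 p = 0" "T 2 3 5 p = - (l * p $ 1 / 2)" "T 1 3 5 p = - (l * p $ 2 / 2)"
    "T 2 3 4 p = 0" "T 1 3 4 p = - (l * p $ 1)" "T 3 4 5 p = - (l * hq n p)" if p: "p \<in> X_reg n" for p
  proof -
    have neg: "a = - b" if "- a = b" for a b :: complex using that by auto
    have v: "T 1 2 5 p = l * p $ 3" if "p \<in> G" for p
      using l[rule_format, OF that] by (simp add: hq_def)
    show "T 1 2 5 p = l * p $ 3" by (rule ext[OF reg _ v p]) (intro continuous_intros; simp)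
    have v: "T 1 2 4 p = - (l * (2 * p $ 4))" if "p \<in> G" for p
      using l[rule_format, OF that] neg[of "T 1 2 4 p"] by (simp only: hq_def; simp)
    show "T 1 2 4 p = - (l * (2 * p $ 4))" by (rule ext[OF reg _ v p]) (intro continuous_intros; simp)
    have v: "T 1 2 3 p = l * p $ 5" if "p \<in> G" for p
      using l[rule_format, OF that] by (simp add: hq_def)
    show "T 1 2 3 p = l * p $ 5" by (rule ext[OF reg _ v p]) (intro continuous_intros; simp)
    have v: "T 2 4 5 p = - (l * p $ 2)" if "p \<in> G" for p
      using l[rule_format, OF that] neg[of "T 2 4 5 p"] by (simp only: hq_def; simp)
    show "T 2 4 5 p = - (l * p $ 2)" by (rule ext[OF reg _ v p]) (intro continuous_intros; simp)
    have v: "T 1 4 5 p = 0" if "p \<in> G" for p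
      using l[rule_format, OF that] by (simp add: hq_def)
    show "T 1 4 5 p = 0" by (rule ext[OF reg _ v p]) (intro continuous_intros; simp)
    have v: "T 2 3 5 p = - (l * p $ 1 / 2)" if "p \<in> G" for p
      using l[rule_format, OF that] by (simp add: hq_def)
    show "T 2 3 5 p = - (l * p $ 1 / 2)" by (rule ext[OF reg _ v p]) (intro continuous_intros; simp)
    have v: "T 1 3 5 p = - (l * p $ 2 / 2)" if "p \<in> G" for p
      using l[rule_format, OF that] neg[of "T 1 3 5 p"] by (simp only: hq_def; simp)
    show "T 1 3 5 p = - (l * p $ 2 / 2)" by (rule ext[OF reg _ v p]) (intro continuous_intros; simp)
    have v: "T 2 3 4 p = 0" if "p \<in> G" for p
      using l[rule_format, OF that] neg[of "T 2 3 4 p"] by (simp only: hq_def; simp)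
    show "T 2 3 4 p = 0" by (rule ext[OF reg _ v p]) (intro continuous_intros; simp)
    have v: "T 1 3 4 p = - (l * p $ 1)" if "p \<in> G" for p
      using l[rule_format, OF that] by (simp add: hq_def)
    show "T 1 3 4 p = - (l * p $ 1)" by (rule ext[OF reg _ v p]) (intro continuous_intros; simp)
    have v: "T 3 4 5 p = - (l * hq n p)" if "p \<in> G" for p
      using l[rule_format, OF that] by (simp add: hq_def)
    show "T 3 4 5 p = - (l * hq n p)" by (rule ext[OF reg _ v p]) (auto simp: hq_def intro!: continuous_intros)
  qed
  have tau: "(\<Sum>k\<in>UNIV. \<Sum>m\<in>UNIV. u $ k * v $ m * T k m r p) = l * tau n p u v $ r" if p: "p \<in> X_reg n" for p u v r
  proof -
    have z: "T i i j p = 0" "T i j i p = 0" "T j i i p = 0" for i j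
      using perm[OF p, of i i j] perm(2)[OF p, of i i j] perm(2)[OF p, of i j i] by auto
    have s: "T j i k p = - T i j k p" "T j k i p = T i j k p" "T k i j p = T i j k p" "T i k j p = - T i j k p" "T k j i p = - T i j k p"
      for i j k
      using perm[OF p, of i j k] perm(2)[OF p, of k i j] perm[OF p, of i k j] perm(1)[OF p, of j k i] perm(2)[OF p, of j i k]
      by auto
    note S = s[where i=1 and j=2 and k=3] s[where i=1 and j=2 and k=4] s[where i=1 and j=2 and k=5] s[where i=1 and j=3 and k=4]
      s[where i=1 and j=3 and k=5] s[where i=1 and j=4 and k=5] s[where i=2 and j=3 and k=4] s[where i=2 and j=3 and k=5]
      s[where i=2 and j=4 and k=5] s[where i=3 and j=4 and k=5]
    have "\<forall>r. (\<Sum>k\<in>UNIV. \<Sum>m\<in>UNIV. u $ k * v $ m * T k m r p) = l * tau n p u v $ r"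
      unfolding forall_5 sum_5 z S val[OF p] tau_simps
      by (intro conjI; simp add: field_simps)
    then show ?thesis by blast
  qed
  show ?thesis
  proof (rule that[of l])
    fix p u v assume p: "p \<in> X_reg n" and u: "u \<in> X_tangent n p" and v: "v \<in> X_tangent n p"
    obtain r where r: "grad n p $ r \<noteq> 0" using X_regE[OF n p] .
    define N where "N = axis r (1 / grad n p $ r)"
    have N: "dX n p N = 1" unfolding N_def by (rule dX_axis_normal[OF r])
    have Nr: "N = (1 / grad n p $ r) *s axis r 1" by (simp add: N_def vec_eq_iff axis_def)
    note e = wedge_dX_expand[where \<omega>=\<omega>, OF alt[OF p] N] and cyc = wedge_dX_cyclic[where \<omega>=\<omega>, OF alt[OF p]]
    have "\<omega> p u v = wedge_dX n \<omega> N p u v N" by (rule wedge_dX_normal[where \<omega>=\<omega>, OF alt[OF p] N u v, symmetric])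
    also have "\<dots> = (1 / grad n p $ r) * wedge_dX n \<omega> N p u v (axis r 1)"
      by (subst (2) Nr) (rule wedge_dX_scale[where \<omega>=\<omega>, OF alt[OF p] N])
    also have "wedge_dX n \<omega> N p u v (axis r 1) = (\<Sum>k\<in>UNIV. \<Sum>m\<in>UNIV. u $ k * v $ m * T k m r p)"
    proof -
      have "wedge_dX n \<omega> N p u v (axis r 1) = wedge_dX n \<omega> N p v (axis r 1) u" by (rule cyc)
      also have "\<dots> = (\<Sum>k\<in>UNIV. u $ k * wedge_dX n \<omega> N p v (axis r 1) (axis k 1))" by (rule e)
      also have "\<dots> = (\<Sum>k\<in>UNIV. u $ k * wedge_dX n \<omega> N p (axis r 1) (axis k 1) v)"
        by (intro sum.cong refl arg_cong2[where f="(*)"] cyc)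
      also have "\<dots> = (\<Sum>k\<in>UNIV. u $ k * (\<Sum>m\<in>UNIV. v $ m * wedge_dX n \<omega> N p (axis r 1) (axis k 1) (axis m 1)))"
        by (intro sum.cong refl arg_cong2[where f="(*)"] e)
      also have "\<dots> = (\<Sum>k\<in>UNIV. u $ k * (\<Sum>m\<in>UNIV. v $ m * T k m r p))"
        unfolding T_def wedge_coeff_eq[where \<omega>=\<omega>, OF alt[OF p] N]
        by (intro sum.cong refl arg_cong2[where f="(*)"] cyc)
      finally show ?thesis by (simp add: sum_distrib_left mult.assoc)
    qed
    finally show "\<omega> p u v = l * omega0 n p u v"
      unfolding tau[OF p] omega0_eq[OF r u v] by simp
  qed
qed

section \<open>Holomorphy and closedness\<close>

lemma partial_deriv_frechet: "(f has_derivative F) (at z) \<Longrightarrow> partial_deriv i f z = F (axis i 1)"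
  using frechet_derivative_at[of f F z] by (simp add: partial_deriv_def)

lemma partial_deriv_const: "partial_deriv i (\<lambda>z. c) z = 0"
  using partial_deriv_frechet[OF has_derivative_const] .

lemma holomorphic_fun_on_differentiable:
  "holomorphic_fun_on f U \<Longrightarrow> z \<in> U \<Longrightarrow> f differentiable (at z)"
  using holomorphic_fun_on_has_derivative differentiable_def by blast

context
  fixes f g :: "complex^'d::finite \<Rightarrow> complex" and z :: "complex^'d"
  assumes f: "f differentiable (at z)" and g: "g differentiable (at z)"
begin

lemma partial_deriv_add: "partial_deriv i (\<lambda>z. f z + g z) z = partial_deriv i f z + partial_deriv i g z"
  using partial_deriv_frechet[OF has_derivative_add[OF f[unfolded frechet_derivative_works] g[unfolded frechet_derivative_works]]]
  by (simp add: partial_deriv_def)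

lemma partial_deriv_diff: "partial_deriv i (\<lambda>z. f z - g z) z = partial_deriv i f z - partial_deriv i g z"
  using partial_deriv_frechet[OF has_derivative_diff[OF f[unfolded frechet_derivative_works] g[unfolded frechet_derivative_works]]]
  by (simp add: partial_deriv_def)

lemma partial_deriv_mult: "partial_deriv i (\<lambda>z. f z * g z) z = f z * partial_deriv i g z + partial_deriv i f z * g z"
  using partial_deriv_frechet[OF has_derivative_mult[OF f[unfolded frechet_derivative_works] g[unfolded frechet_derivative_works]]]
  by (simp add: partial_deriv_def)

end

lemma partial_deriv_cmult:
  assumes "f differentiable (at z)"
  shows "partial_deriv i (\<lambda>z. c * f z) z = c * partial_deriv i f z"
  using partial_deriv_frechet[OF has_derivative_mult_right[OF assms[unfolded frechet_derivative_works]]]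
  by (simp add: partial_deriv_def)

lemma partial_deriv_cong_open:
  assumes "open V" "z \<in> V" "f differentiable (at z)" "\<And>x. x \<in> V \<Longrightarrow> f x = g x"
  shows "partial_deriv i f z = partial_deriv i g z"
proof -
  have "(g has_derivative frechet_derivative f (at z)) (at z)"
    by (rule has_derivative_transform_within_open[OF assms(3)[unfolded frechet_derivative_works] assms(1,2,4)])
  then show ?thesis using partial_deriv_frechet by (metis partial_deriv_def)
qed

lemma holomorphic_fun_on_const: "open U \<Longrightarrow> holomorphic_fun_on (\<lambda>z. c) U"
  unfolding holomorphic_fun_on_def by (auto intro!: exI[of _ "\<lambda>v. 0"])

lemma holomorphic_fun_on_add:
  assumes "holomorphic_fun_on f U" "holomorphic_fun_on g U"
  shows "holomorphic_fun_on (\<lambda>z. f z + g z) U"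
  unfolding holomorphic_fun_on_def
proof (intro conjI ballI)
  fix z assume "z \<in> U"
  then obtain f' g' where "(f has_derivative f') (at z)" "\<And>c v. f' (c *s v) = c * f' v"
    "(g has_derivative g') (at z)" "\<And>c v. g' (c *s v) = c * g' v"
    using assms unfolding holomorphic_fun_on_def by blast
  then show "\<exists>h. ((\<lambda>z. f z + g z) has_derivative h) (at z) \<and> (\<forall>c v. h (c *s v) = c * h v)"
    by (intro exI[of _ "\<lambda>v. f' v + g' v"]) (auto intro: has_derivative_add simp: algebra_simps)
qed (use assms holomorphic_fun_on_def in blast)

lemma holomorphic_fun_on_mult:
  assumes "holomorphic_fun_on f U" "holomorphic_fun_on g U"
  shows "holomorphic_fun_on (\<lambda>z. f z * g z) U"
  unfolding holomorphic_fun_on_def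
proof (intro conjI ballI)
  fix z assume "z \<in> U"
  then obtain f' g' where "(f has_derivative f') (at z)" "\<And>c v. f' (c *s v) = c * f' v"
    "(g has_derivative g') (at z)" "\<And>c v. g' (c *s v) = c * g' v"
    using assms unfolding holomorphic_fun_on_def by blast
  then show "\<exists>h. ((\<lambda>z. f z * g z) has_derivative h) (at z) \<and> (\<forall>c v. h (c *s v) = c * h v)"
    by (intro exI[of _ "\<lambda>v. f z * g' v + f' v * g z"]) (auto intro: has_derivative_mult simp: algebra_simps)
qed (use assms holomorphic_fun_on_def in blast)

lemma holomorphic_fun_on_diff:
  assumes "holomorphic_fun_on f U" "holomorphic_fun_on g U"
  shows "holomorphic_fun_on (\<lambda>z. f z - g z) U"
proof -
  have "open U" using assms(1) by (rule holomorphic_fun_on_open)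
  then have "holomorphic_fun_on (\<lambda>z. f z + (- 1) * g z) U"
    by (intro holomorphic_fun_on_add holomorphic_fun_on_mult holomorphic_fun_on_const assms)
  then show ?thesis by simp
qed

lemma holomorphic_fun_on_power: "holomorphic_fun_on f U \<Longrightarrow> holomorphic_fun_on (\<lambda>z. f z ^ k) U"
  by (induction k) (auto intro: holomorphic_fun_on_mult holomorphic_fun_on_const holomorphic_fun_on_open)

lemma holomorphic_fun_on_inverse:
  assumes "holomorphic_fun_on f U" "\<And>z. z \<in> U \<Longrightarrow> f z \<noteq> 0"
  shows "holomorphic_fun_on (\<lambda>z. inverse (f z)) U"
  unfolding holomorphic_fun_on_def
proof (intro conjI ballI)
  fix z assume z: "z \<in> U"
  then obtain f' where "(f has_derivative f') (at z)" "\<And>c v. f' (c *s v) = c * f' v"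
    using assms unfolding holomorphic_fun_on_def by blast
  then show "\<exists>h. ((\<lambda>z. inverse (f z)) has_derivative h) (at z) \<and> (\<forall>c v. h (c *s v) = c * h v)"
    using assms(2)[OF z]
    by (intro exI[of _ "\<lambda>v. - (inverse (f z) * f' v * inverse (f z))"]) (auto intro: has_derivative_inverse)
qed (use assms holomorphic_fun_on_def in blast)

lemma holomorphic_fun_on_divide_const: "holomorphic_fun_on f U \<Longrightarrow> holomorphic_fun_on (\<lambda>z. f z / c) U"
  using holomorphic_fun_on_mult[OF _ holomorphic_fun_on_const[of U "1 / c"]] holomorphic_fun_on_open by fastforce

lemma holomorphic_fun_on_uminus: "holomorphic_fun_on f U \<Longrightarrow> holomorphic_fun_on (\<lambda>z. - f z) U"
  using holomorphic_fun_on_diff[OF holomorphic_fun_on_const[of U 0]] holomorphic_fun_on_open by fastforce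

lemmas hol_intros = holomorphic_fun_on_add holomorphic_fun_on_diff holomorphic_fun_on_mult holomorphic_fun_on_power
  holomorphic_fun_on_const holomorphic_fun_on_divide_const holomorphic_fun_on_uminus

lemma holomorphic_fun_on_local:
  assumes "open U" "\<And>z. z \<in> U \<Longrightarrow> \<exists>V g. open V \<and> z \<in> V \<and> holomorphic_fun_on g V \<and> (\<forall>x\<in>V. g x = f x)"
  shows "holomorphic_fun_on f U"
  unfolding holomorphic_fun_on_def
proof (intro conjI ballI assms(1))
  fix z assume "z \<in> U"
  then obtain V g where V: "open V" "z \<in> V" "holomorphic_fun_on g V" "\<And>x. x \<in> V \<Longrightarrow> g x = f x"
    using assms(2) by metis
  then obtain g' where g': "(g has_derivative g') (at z)" "\<forall>c v. g' (c *s v) = c * g' v"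
    unfolding holomorphic_fun_on_def by blast
  then have "(f has_derivative g') (at z)"
    using has_derivative_transform_within_open[OF g'(1) V(1,2,4)] by blast
  with g'(2) show "\<exists>f'. (f has_derivative f') (at z) \<and> (\<forall>c v. f' (c *s v) = c * f' v)" by blast
qed

text \<open>Where \<open>crit p \<noteq> 0\<close> the form is \<open>tau\<^sub>1 / (2 crit)\<close>, and \<open>2 crit\<close> times
  \<open>crit d(tau\<^sub>1) - d(crit) \<and> tau\<^sub>1\<close> equals \<open>dX \<and> eta1\<close>, which vanishes on tangent vectors.\<close>

definition dtau1 :: "complex^5 \<Rightarrow> complex^5 \<Rightarrow> complex^5 \<Rightarrow> complex" where
  "dtau1 t u v = t $ 5 * (u $ 2 * v $ 3 - u $ 3 * v $ 2) - 2 * t $ 4 * (u $ 2 * v $ 4 - u $ 4 * v $ 2)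
      + t $ 3 * (u $ 2 * v $ 5 - u $ 5 * v $ 2) - t $ 1 * (u $ 3 * v $ 4 - u $ 4 * v $ 3) - t $ 2 / 2 * (u $ 3 * v $ 5 - u $ 5 * v $ 3)"

definition dgrad1 :: "complex^5 \<Rightarrow> complex^5 \<Rightarrow> complex" where
  "dgrad1 p u = p $ 1 * u $ 3 + u $ 1 * p $ 3 + p $ 2 * u $ 4 + u $ 2 * p $ 4"

definition eta1 :: "complex^5 \<Rightarrow> complex^5 \<Rightarrow> complex^5 \<Rightarrow> complex" where
  "eta1 p u v = - p $ 2 * p $ 4 * (u $ 3 * v $ 4 - u $ 4 * v $ 3) - p $ 3 * p $ 5 * (u $ 2 * v $ 3 - u $ 3 * v $ 2)
     + 2 * p $ 3 * p $ 4 * (u $ 2 * v $ 4 - u $ 4 * v $ 2) - (p $ 3)^2 * (u $ 2 * v $ 5 - u $ 5 * v $ 2)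
     + p $ 2 / 2 * p $ 3 * (u $ 3 * v $ 5 - u $ 5 * v $ 3)"

lemma closed_identity:
  fixes p u v w :: "complex^5"
  defines "c \<equiv> crit p"
  assumes "dX n p u = 0" "dX n p v = 0" "dX n p w = 0"
  shows "c * (c * (dtau1 u v w + dtau1 v w u + dtau1 w u v) - (dgrad1 p u * tau n p v w $ 1 + dgrad1 p v * tau n p w u $ 1 + dgrad1 p w * tau n p u v $ 1)) = 0"
proof -
  \<comment> \<open>Halving the second coordinates clears the denominators in \<open>tau\<close>,
    \<open>dtau1\<close> and \<open>eta1\<close>.\<close>
  define b where "b = p $ 2 / 2"
  have b: "p $ 2 = 2 * b" by (simp add: b_def)
  define u2 v2 w2 where "u2 = u $ 2 / 2" and "v2 = v $ 2 / 2" and "w2 = w $ 2 / 2"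
  have uvw: "u $ 2 = 2 * u2" "v $ 2 = 2 * v2" "w $ 2 = 2 * w2" by (simp_all add: u2_def v2_def w2_def)
  have "2 * (c * (c * (dtau1 u v w + dtau1 v w u + dtau1 w u v) - (dgrad1 p u * tau n p v w $ 1 + dgrad1 p v * tau n p w u $ 1 + dgrad1 p w * tau n p u v $ 1)))
     = dX n p u * eta1 p v w + dX n p v * eta1 p w u + dX n p w * eta1 p u v"
    by (simp only: c_def dtau1_def dgrad1_def eta1_def tau_simps dX_def sum_5 grad_hq b uvw double_half) algebra
  then show ?thesis using assms by simp
qed

section \<open>The form in an arbitrary chart\<close>

context
  fixes n :: nat and U :: "(complex^4) set" and \<phi> :: "complex^4 \<Rightarrow> complex^5"
  assumes n: "n \<ge> 2" and par: "holomorphic_parametrization (X_reg n) U \<phi>"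
begin

lemma par_component: "holomorphic_fun_on (\<lambda>z. \<phi> z $ k) U"
  using par unfolding holomorphic_parametrization_def holomorphic_map_on_def by blast

lemma par_open: "open U"
  using par_component holomorphic_fun_on_open by blast

lemma par_in: "z \<in> U \<Longrightarrow> \<phi> z \<in> X_reg n"
  using par openin_subset[of "top_of_set (X_reg n)" "\<phi> ` U"] unfolding holomorphic_parametrization_def by auto

lemma par_has_derivative:
  assumes "z \<in> U"
  shows "(\<phi> has_derivative (\<lambda>v. \<chi> k. frechet_derivative (\<lambda>z. \<phi> z $ k) (at z) v)) (at z)"
proof -
  have "((\<lambda>z. \<Sum>k\<in>UNIV. axis k (\<phi> z $ k)) has_derivative
      (\<lambda>v. \<Sum>k\<in>UNIV. axis k (frechet_derivative (\<lambda>z. \<phi> z $ k) (at z) v))) (at z)"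
    using holomorphic_fun_on_differentiable[OF par_component assms]
    by (intro has_derivative_sum bounded_linear.has_derivative[OF bounded_linear_axis]) (simp add: frechet_derivative_works)
  moreover have "(\<Sum>k\<in>UNIV. axis k (\<phi> z $ k)) = \<phi> z" for z by (rule vec_eq_sum_axis[symmetric])
  moreover have "(\<Sum>k\<in>UNIV. axis k (g k)) = (\<chi> k. g k)" for g :: "5 \<Rightarrow> complex"
    by (subst vec_eq_sum_axis[of "\<chi> k. g k"]) simp
  ultimately show ?thesis by simp
qed

definition par_deriv :: "4 \<Rightarrow> complex^4 \<Rightarrow> complex^5" where
  "par_deriv j z = frechet_derivative \<phi> (at z) (axis j 1)"

lemma par_deriv_nth:
  assumes "z \<in> U"
  shows "par_deriv j z $ k = partial_deriv j (\<lambda>z. \<phi> z $ k) z"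
  unfolding par_deriv_def frechet_derivative_at[OF par_has_derivative[OF assms], symmetric]
  by (simp add: partial_deriv_def)

lemma par_deriv_tangent:
  assumes z: "z \<in> U"
  shows "par_deriv j z \<in> X_tangent n (\<phi> z)"
proof -
  have d: "(\<phi> has_derivative frechet_derivative \<phi> (at z)) (at z)"
    by (rule frechet_derivative_works[THEN iffD1, OF differentiableI[OF par_has_derivative[OF z]]])
  have A: "((\<lambda>z. X_eq n (\<phi> z)) has_derivative (\<lambda>v. dX n (\<phi> z) (frechet_derivative \<phi> (at z) v))) (at z)"
    by (rule has_derivative_compose[OF d X_eq_has_derivative])
  have B: "X_eq n (\<phi> x) = 0" if "x \<in> U" for x using par_in[OF that] X_reg_iff[OF n] by blast
  have "((\<lambda>z. 0) has_derivative (\<lambda>v. dX n (\<phi> z) (frechet_derivative \<phi> (at z) v))) (at z)"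
    by (rule has_derivative_transform_within_open[OF A par_open z]) (rule B)
  then have "(\<lambda>v. dX n (\<phi> z) (frechet_derivative \<phi> (at z) v)) = (\<lambda>v. 0)"
    by (rule has_derivative_unique[OF _ has_derivative_const])
  then show ?thesis by (simp add: X_tangent_iff par_deriv_def fun_eq_iff)
qed

lemma coeff_omega0:
  assumes z: "z \<in> U" and r: "grad n (\<phi> z) $ r \<noteq> 0"
  shows "form_coeff (pullback \<phi> (omega0 n)) i j z * grad n (\<phi> z) $ r = tau n (\<phi> z) (par_deriv i z) (par_deriv j z) $ r"
  using omega0_eq[OF r par_deriv_tangent[OF z] par_deriv_tangent[OF z]] r
  by (simp add: form_coeff_def pullback_def par_deriv_def)

lemma par_deriv_holomorphic: "holomorphic_fun_on (\<lambda>z. par_deriv j z $ k) U"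
proof (rule holomorphic_fun_on_local[OF par_open])
  fix z assume "z \<in> U"
  then show "\<exists>V g. open V \<and> z \<in> V \<and> holomorphic_fun_on g V \<and> (\<forall>x\<in>V. g x = par_deriv j x $ k)"
    by (intro exI[of _ U] exI[of _ "partial_deriv j (\<lambda>z. \<phi> z $ k)"])
       (auto simp: par_open par_deriv_nth intro: holomorphic_fun_on_partial_deriv[OF par_component])
qed

lemma grad_par_holomorphic: "holomorphic_fun_on (\<lambda>z. grad n (\<phi> z) $ r) U"
  using exhaust_5[of r]
  by (elim disjE; simp only: grad_simps; intro hol_intros par_component par_open)

lemma tau_par_holomorphic: "holomorphic_fun_on (\<lambda>z. tau n (\<phi> z) (par_deriv i z) (par_deriv j z) $ r) U"
  using exhaust_5[of r]
  by (elim disjE; simp only: tau_simps hq_def; intro hol_intros par_component par_deriv_holomorphic par_open)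

lemma coeff_holomorphic: "holomorphic_fun_on (form_coeff (pullback \<phi> (omega0 n)) i j) U"
proof (rule holomorphic_fun_on_local[OF par_open])
  fix z assume z: "z \<in> U"
  obtain r where r: "grad n (\<phi> z) $ r \<noteq> 0" using X_regE[OF n par_in[OF z]] .
  define V where "V = {x \<in> U. grad n (\<phi> x) $ r \<noteq> 0}"
  have V: "open V" "z \<in> V" "V \<subseteq> U"
  proof -
    have "open (U \<inter> (\<lambda>x. grad n (\<phi> x) $ r) -` (- {0}))"
      by (rule continuous_open_preimage[OF holomorphic_fun_on_continuous[OF grad_par_holomorphic] par_open open_Compl[OF closed_singleton]])
    moreover have "U \<inter> (\<lambda>x. grad n (\<phi> x) $ r) -` (- {0}) = V" by (auto simp: V_def)
    ultimately show "open V" by simp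
  qed (use z r V_def in auto)
  have "holomorphic_fun_on (\<lambda>x. tau n (\<phi> x) (par_deriv i x) (par_deriv j x) $ r * inverse (grad n (\<phi> x) $ r)) V"
    by (intro holomorphic_fun_on_mult holomorphic_fun_on_inverse holomorphic_fun_on_subset[OF tau_par_holomorphic V(1,3)]
        holomorphic_fun_on_subset[OF grad_par_holomorphic V(1,3)]) (simp add: V_def)
  moreover have "tau n (\<phi> x) (par_deriv i x) (par_deriv j x) $ r * inverse (grad n (\<phi> x) $ r) = form_coeff (pullback \<phi> (omega0 n)) i j x"
    if "x \<in> V" for x
  proof -
    have x: "x \<in> U" "grad n (\<phi> x) $ r \<noteq> 0" using that by (auto simp: V_def)
    show ?thesis unfolding coeff_omega0[OF x, symmetric] using x(2) by simp
  qed
  ultimately show "\<exists>V g. open V \<and> z \<in> V \<and> holomorphic_fun_on g V \<and> (\<forall>x\<in>V. g x = form_coeff (pullback \<phi> (omega0 n)) i j x)"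
    using V(1,2) by blast
qed

text \<open>Component 1 of \<open>tau\<close> is linear in the point and free of \<open>hq\<close>,
  so differentiating the point gives \<open>dtau1\<close>; the other two terms carry the second
  derivatives of the chart.\<close>

lemma partial_deriv_tau:
  assumes z: "z \<in> U"
  defines "S \<equiv> \<lambda>i j. \<chi> k. partial_deriv i (\<lambda>z. par_deriv j z $ k) z"
  shows "partial_deriv i (\<lambda>z. tau n (\<phi> z) (par_deriv j z) (par_deriv k z) $ 1) z =
    dtau1 (par_deriv i z) (par_deriv j z) (par_deriv k z) + tau n (\<phi> z) (S i j) (par_deriv k z) $ 1 + tau n (\<phi> z) (par_deriv j z) (S i k) $ 1"
proof -
  have d: "(\<lambda>z. \<phi> z $ m) differentiable (at z)" "(\<lambda>z. par_deriv j z $ m) differentiable (at z)" for j m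
    using holomorphic_fun_on_differentiable[OF par_component z] holomorphic_fun_on_differentiable[OF par_deriv_holomorphic z] by auto
  have half: "(\<lambda>z. \<phi> z $ 2 / 2) differentiable (at z)"
    using differentiable_mult[OF differentiable_const[of "1/2"] d(1)[of 2]] by simp
  have ph: "partial_deriv i (\<lambda>z. \<phi> z $ 2 / 2) z = par_deriv i z $ 2 / 2"
    using partial_deriv_cmult[OF d(1)[of 2], of i "1/2"] by (simp add: par_deriv_nth[OF z])
  show ?thesis
    unfolding tau_simps
    by (simp only: partial_deriv_add partial_deriv_diff partial_deriv_mult partial_deriv_const half ph d
        differentiable_add differentiable_diff differentiable_mult differentiable_const par_deriv_nth[OF z, symmetric] S_def dtau1_def vec_lambda_beta)
       (simp add: algebra_simps)
qed

text \<open>Where \<open>crit\<close> is nonzero, 2 crit times a coefficient of the form is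
  component 1 of \<open>tau\<close>. Differentiating this and summing cyclically, the second
  derivatives of the chart cancel, being symmetric while \<open>tau\<close> is alternating;
  \<open>closed_identity\<close> disposes of the rest.\<close>

lemma closed_at_good:
  assumes z: "z \<in> U" and c: "\<phi> z $ 1 * \<phi> z $ 3 + \<phi> z $ 2 * \<phi> z $ 4 \<noteq> 0"
  defines "W \<equiv> form_coeff (pullback \<phi> (omega0 n))"
  shows "partial_deriv i (W j k) z + partial_deriv j (W k i) z + partial_deriv k (W i j) z = 0"
proof -
  define C where "C = (\<lambda>z. \<phi> z $ 1 * \<phi> z $ 3 + \<phi> z $ 2 * \<phi> z $ 4)"
  define V where "V = {x \<in> U. C x \<noteq> 0}"
  have Chol: "holomorphic_fun_on C U"
    unfolding C_def by (intro hol_intros par_component)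
  have V: "open V" "z \<in> V"
  proof -
    have "open (U \<inter> C -` (- {0}))"
      by (rule continuous_open_preimage[OF holomorphic_fun_on_continuous[OF Chol] par_open open_Compl[OF closed_singleton]])
    moreover have "U \<inter> C -` (- {0}) = V" by (auto simp: V_def)
    ultimately show "open V" by simp
  qed (use z c in \<open>auto simp: V_def C_def\<close>)
  define p where "p = \<phi> z"
  define u where "u = (\<lambda>i. par_deriv i z)"
  define S where "S = (\<lambda>i j. \<chi> k. partial_deriv i (\<lambda>z. par_deriv j z $ k) z)"
  have Ssym: "S i j = S j i" for i j
  proof -
    have "partial_deriv i (\<lambda>z. par_deriv j z $ k) z = partial_deriv j (\<lambda>z. par_deriv i z $ k) z" for k
    proof -
      have e: "partial_deriv i (\<lambda>z. par_deriv j z $ k) z = partial_deriv i (partial_deriv j (\<lambda>z. \<phi> z $ k)) z" for i j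
        by (rule partial_deriv_cong_open[OF par_open z holomorphic_fun_on_differentiable[OF par_deriv_holomorphic z]])
           (simp add: par_deriv_nth)
      show ?thesis unfolding e by (rule partial_deriv_commute[OF par_component z])
    qed
    then show ?thesis by (simp add: S_def vec_eq_iff)
  qed
  have dC: "partial_deriv i C z = dgrad1 p (u i)" for i
    unfolding C_def dgrad1_def p_def u_def using holomorphic_fun_on_differentiable[OF par_component z]
    by (simp add: partial_deriv_add partial_deriv_mult par_deriv_nth[OF z, symmetric])
  have Wd: "W i j differentiable (at z)" for i j
    unfolding W_def by (rule holomorphic_fun_on_differentiable[OF coeff_holomorphic z])
  have Cd: "C differentiable (at z)" by (rule holomorphic_fun_on_differentiable[OF Chol z])
  have WC: "W i j x * (2 * C x) = tau n (\<phi> x) (par_deriv i x) (par_deriv j x) $ 1" if "x \<in> V" for i j x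
  proof -
    have g: "grad n (\<phi> x) $ 1 = 2 * C x" by (simp add: grad_simps C_def)
    have "x \<in> U" "grad n (\<phi> x) $ 1 \<noteq> 0" using that by (auto simp: g V_def)
    from coeff_omega0[OF this, of i j] show ?thesis by (simp only: W_def g)
  qed
  have der: "W j k z * (2 * dgrad1 p (u i)) + partial_deriv i (W j k) z * (2 * C z)
      = dtau1 (u i) (u j) (u k) + tau n p (S i j) (u k) $ 1 + tau n p (u j) (S i k) $ 1" for i j k
  proof -
    have C2: "(\<lambda>x. 2 * C x) differentiable (at z)" using Cd by simp
    have "partial_deriv i (\<lambda>x. W j k x * (2 * C x)) z = partial_deriv i (\<lambda>x. tau n (\<phi> x) (par_deriv j x) (par_deriv k x) $ 1) z"
      by (rule partial_deriv_cong_open[OF V differentiable_mult[OF Wd C2]]) (rule WC)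
    then show ?thesis
      unfolding partial_deriv_tau[OF z] partial_deriv_mult[OF Wd C2] partial_deriv_cmult[OF Cd] dC
      by (simp add: S_def u_def p_def)
  qed
  have anti: "tau n p v w $ 1 = - tau n p w v $ 1" for v w by (simp add: tau_simps algebra_simps)
  have Wz: "W i j z * (2 * C z) = tau n p (u i) (u j) $ 1" for i j
    using WC[OF V(2)] by (simp add: p_def u_def)
  have Cz: "C z = crit p" by (simp add: C_def p_def)
  have tan: "dX n p (u i) = 0" for i
    using par_deriv_tangent[OF z] by (simp add: X_tangent_iff p_def u_def)
  define D where "D = partial_deriv i (W j k) z + partial_deriv j (W k i) z + partial_deriv k (W i j) z"
  define \<Sigma> where "\<Sigma> = dtau1 (u i) (u j) (u k) + dtau1 (u j) (u k) (u i) + dtau1 (u k) (u i) (u j)"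
  have Sg: "D * (2 * C z) + 2 * (W j k z * dgrad1 p (u i) + W k i z * dgrad1 p (u j) + W i j z * dgrad1 p (u k)) = \<Sigma>"
    using der[of j k i] der[of k i j] der[of i j k]
      anti[of "u j" "S i k"] anti[of "u k" "S j i"] anti[of "u i" "S k j"]
    unfolding D_def \<Sigma>_def Ssym[of j i] Ssym[of k j] Ssym[of k i] by algebra
  have "C z * (C z * \<Sigma> - (dgrad1 p (u i) * tau n p (u j) (u k) $ 1 + dgrad1 p (u j) * tau n p (u k) (u i) $ 1 + dgrad1 p (u k) * tau n p (u i) (u j) $ 1))
      = C z * (C z * (D * (2 * C z)))"
    unfolding Wz[symmetric] Sg[symmetric] by (simp add: algebra_simps)
  moreover have "C z * (C z * \<Sigma> - (dgrad1 p (u i) * tau n p (u j) (u k) $ 1 + dgrad1 p (u j) * tau n p (u k) (u i) $ 1 + dgrad1 p (u k) * tau n p (u i) (u j) $ 1)) = 0"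
    unfolding Cz \<Sigma>_def by (rule closed_identity[OF tan tan tan])
  ultimately have "C z * (C z * (D * (2 * C z))) = 0" by (simp only:)
  moreover have "C z \<noteq> 0" using c by (simp add: C_def)
  ultimately have "D = 0" by simp
  then show ?thesis by (simp add: D_def)
qed

text \<open>The cyclic sum is continuous. An open set on which it is nonzero would have an image
  open in \<open>X_reg\<close>, which meets the dense set of \<open>closed_at_good\<close>.\<close>

lemma closed_omega0: "closed_form_on (pullback \<phi> (omega0 n)) U"
  unfolding closed_form_on_def
proof (intro ballI allI)
  fix z i j k assume z: "z \<in> U"
  let ?W = "form_coeff (pullback \<phi> (omega0 n))"
  define D where "D = (\<lambda>z. partial_deriv i (?W j k) z + partial_deriv j (?W k i) z + partial_deriv k (?W i j) z)"
  have D: "continuous_on U D"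
    unfolding D_def by (intro continuous_intros continuous_on_partial_deriv coeff_holomorphic)
  show "D z = 0"
  proof (rule ccontr)
    assume nz: "D z \<noteq> 0"
    define V where "V = U \<inter> D -` (- {0})"
    have V: "open V" unfolding V_def by (rule continuous_open_preimage[OF D par_open open_Compl[OF closed_singleton]])
    have zV: "z \<in> V" using z nz by (simp add: V_def)
    obtain \<psi> where hom: "homeomorphism U (\<phi> ` U) \<phi> \<psi>" and op: "openin (top_of_set (X_reg n)) (\<phi> ` U)"
      using par unfolding holomorphic_parametrization_def by blast
    have "openin (top_of_set U) V" by (rule open_subset[OF _ V]) (simp add: V_def)
    then have "openin (top_of_set (\<phi> ` U)) (\<phi> ` V)" by (rule homeomorphism_imp_open_map[OF hom])
    then have "openin (top_of_set (X_reg n)) (\<phi> ` V)" using op openin_trans by blast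
    then obtain O' where O': "open O'" "\<phi> ` V = X_reg n \<inter> O'" by (auto simp: openin_open)
    let ?G = "{p \<in> X_reg n. p $ 3 \<noteq> 0 \<and> crit p \<noteq> 0}"
    have "\<phi> z \<in> closure ?G" using dense_xc[OF n] par_in[OF z] by blast
    moreover have "\<phi> z \<in> O'" using O' zV by blast
    ultimately obtain q where "q \<in> ?G" "q \<in> O'"
      using O'(1) by (meson closure_iff_nhds_not_empty disjoint_iff order_refl)
    then have "q \<in> \<phi> ` V" using O' by blast
    then obtain x where x: "x \<in> V" "q = \<phi> x" by blast
    then have "D x = 0" unfolding D_def using \<open>q \<in> ?G\<close> by (intro closed_at_good) (auto simp: V_def)
    then show False using x by (simp add: V_def)
  qed
qed

end

theorem mainTheorem5:
  fixes n :: nat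
  assumes "n \<ge> 2"
  shows "(\<exists>\<omega>. holomorphic_symplectic n \<omega> \<and> has_weight n \<omega> 2) \<and>
    (\<forall>\<omega> \<omega>'. holomorphic_symplectic n \<omega> \<and> has_weight n \<omega> 2 \<and>
       holomorphic_symplectic n \<omega>' \<and> has_weight n \<omega>' 2 \<longrightarrow>
       (\<exists>c::complex. c \<noteq> 0 \<and>
          (\<forall>p\<in>X_reg n. \<forall>u\<in>X_tangent n p. \<forall>v\<in>X_tangent n p. \<omega>' p u v = c * \<omega> p u v)))"
proof (intro conjI allI impI)
  have "holomorphic_symplectic n (omega0 n)"
    unfolding holomorphic_symplectic_def holomorphic_2form_def d_closed_def holomorphic_form_on_def
    using omega0_alternating[OF assms] coeff_holomorphic[OF assms] closed_omega0[OF assms] omega0_nondegenerate[OF assms]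
    by blast
  then show "\<exists>\<omega>. holomorphic_symplectic n \<omega> \<and> has_weight n \<omega> 2"
    using omega0_weight[OF assms] by blast
next
  fix \<omega> \<omega>'
  assume as: "holomorphic_symplectic n \<omega> \<and> has_weight n \<omega> 2 \<and> holomorphic_symplectic n \<omega>' \<and> has_weight n \<omega>' 2"
  have scalar: "\<exists>l. l \<noteq> 0 \<and> (\<forall>p u v. p \<in> X_reg n \<longrightarrow> u \<in> X_tangent n p \<longrightarrow> v \<in> X_tangent n p \<longrightarrow> \<eta> p u v = l * omega0 n p u v)"
    if \<eta>: "holomorphic_symplectic n \<eta>" "has_weight n \<eta> 2" for \<eta>
  proof -
    have "holomorphic_2form n \<eta>" using \<eta>(1) by (simp add: holomorphic_symplectic_def)
    from weight_2_form_proportional[OF assms this \<eta>(2)] obtain l where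
      l: "\<And>p u v. p \<in> X_reg n \<Longrightarrow> u \<in> X_tangent n p \<Longrightarrow> v \<in> X_tangent n p \<Longrightarrow> \<eta> p u v = l * omega0 n p u v" by blast
    \<comment> \<open>One smooth point with a nonzero tangent vector suffices for
      \<open>l \<noteq> 0\<close>. Here b = 1, and b is component 3 of
      \<open>ham n p 1\<close>.\<close>
    define p where "p = test_curve n 0"
    have p: "p \<in> X_reg n" unfolding p_def by (rule test_curve_in[OF assms])
    have t: "ham n p 1 \<in> X_tangent n p" by (simp add: X_tangent_iff dX_ham)
    have "ham n p 1 $ 3 \<noteq> 0" by (simp add: ham_simps p_def test_curve_simps)
    then have "ham n p 1 \<noteq> 0" by auto
    then obtain v where "v \<in> X_tangent n p" "\<eta> p (ham n p 1) v \<noteq> 0"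
      using \<eta>(1) p t unfolding holomorphic_symplectic_def nondegenerate_on_def by blast
    then have "l \<noteq> 0" using l[OF p t] by auto
    then show ?thesis using l by blast
  qed
  obtain l where l: "l \<noteq> 0" "\<And>p u v. p \<in> X_reg n \<Longrightarrow> u \<in> X_tangent n p \<Longrightarrow> v \<in> X_tangent n p \<Longrightarrow> \<omega> p u v = l * omega0 n p u v"
    using scalar as by blast
  obtain l' where l': "l' \<noteq> 0" "\<And>p u v. p \<in> X_reg n \<Longrightarrow> u \<in> X_tangent n p \<Longrightarrow> v \<in> X_tangent n p \<Longrightarrow> \<omega>' p u v = l' * omega0 n p u v"
    using scalar as by blast
  show "\<exists>c::complex. c \<noteq> 0 \<and> (\<forall>p\<in>X_reg n. \<forall>u\<in>X_tangent n p. \<forall>v\<in>X_tangent n p. \<omega>' p u v = c * \<omega> p u v)"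
    by (rule exI[of _ "l' / l"]) (use l l' in simp)
qed

end
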